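(* Let $G$ be a finite group and let $F$ be a field whose characteristic does not divide $|G|$. The following conditions are equivalent. (i) $G$ possesses an irreducible representation $\sigma$ over $F$ with $\mathrm{Z}(\sigma)=\mathrm{Z}(G)$. (ii) There exists a character $\chi\in\widehat{\mathrm{Z}(G)}$ such that: (1) $\omega_\chi\colon\mathrm{Z}_2(G)/\mathrm{Z}(G)\to\widehat{G/[G,G]}$ is injective, and (2) $\operatorname{SocA}(G/\ker(\chi))$ is generated by a single conjugacy class. If in addition $G$ is nilpotent, then those conditions are equivalent to: (iii) There exists a character $\chi\in\widehat{\mathrm{Z}(G)}$ such that $\omega_\chi$ is injective.
   Context: Representations are finite-dimensional linear representations over $F$. $\mathrm{Z}(G)$ is the center of $G$ and $\mathrm{Z}_2(G)$ the second center, i.e. the preimage in $G$ of the center of $G/\mathrm{Z}(G)$. For a representation $\sigma$ of $G$, $\mathrm{Z}(\sigma)=\sigma^{-1}\big(\mathrm{Z}(\sigma(G))\big)$. For a finite abelian group $N$, $\widehat{N}=\operatorname{Hom}(N,\mathbb{Q}/\mathbb{Z})$ is its Pontryagin dual. For $z_2\in\mathrm{Z}_2(G)$ and $g\in G$, the commutator $[z_2,g]$ lies in $\mathrm{Z}(G)$ and depends only on the cosets $z_2\mathrm{Z}(G)$ and $g[G,G]$, in a bimultiplicative way; for $\chi\in\widehat{\mathrm{Z}(G)}$, $\omega_\chi$ is the group homomorphism sending $z_2\mathrm{Z}(G)$ to the character $g[G,G]\mapsto\chi([z_2,g])$ of $G/[G,G]$. For a finite group $L$, $\operatorname{SocA}(L)$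 (the abelian part of the socle) is the subgroup of $L$ generated by all the minimal normal subgroups of $L$ that are abelian. "Generated by a single conjugacy class" means generated as a group by one conjugacy class of the ambient group (here $G/\ker(\chi)$). *)

theory Defs
  imports
    "HOL-Algebra.Algebra"
    "HOL-Computational_Algebra.Computational_Algebra"
    "Jordan_Normal_Form.VS_Connect"
begin

section \<open>Centers, commutators, nilpotency\<close>

definition center :: "('a, 'b) monoid_scheme \<Rightarrow> 'a set" where
  "center G = {z \<in> carrier G. \<forall>g \<in> carrier G. z \<otimes>\<^bsub>G\<^esub> g = g \<otimes>\<^bsub>G\<^esub> z}"

abbreviation center_group :: "('a, 'b) monoid_scheme \<Rightarrow> ('a, 'b) monoid_scheme" where
  "center_group G \<equiv> G\<lparr>carrier := center G\<rparr>"

text \<open>The preimage in \<open>G\<close> of the center of \<open>G/N\<close>.\<close>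
definition center_modulo :: "('a, 'b) monoid_scheme \<Rightarrow> 'a set \<Rightarrow> 'a set" where
  "center_modulo G N = {x \<in> carrier G. N #>\<^bsub>G\<^esub> x \<in> center (G Mod N)}"

definition second_center :: "('a, 'b) monoid_scheme \<Rightarrow> 'a set" where
  "second_center G = center_modulo G (center G)"

primrec upper_central :: "('a, 'b) monoid_scheme \<Rightarrow> nat \<Rightarrow> 'a set" where
  "upper_central G 0 = {\<one>\<^bsub>G\<^esub>}"
| "upper_central G (Suc n) = center_modulo G (upper_central G n)"

definition nilpotent_group :: "('a, 'b) monoid_scheme \<Rightarrow> bool" where
  "nilpotent_group G \<longleftrightarrow> group G \<and> (\<exists>n. upper_central G n = carrier G)"

text \<open>The convention for \<open>[x,y]\<close> is the one of \<^const>\<open>derived\<close>.\<close>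
definition commutator :: "('a, 'b) monoid_scheme \<Rightarrow> 'a \<Rightarrow> 'a \<Rightarrow> 'a" where
  "commutator G x y = x \<otimes>\<^bsub>G\<^esub> y \<otimes>\<^bsub>G\<^esub> inv\<^bsub>G\<^esub> x \<otimes>\<^bsub>G\<^esub> inv\<^bsub>G\<^esub> y"

abbreviation abelianization :: "('a, 'b) monoid_scheme \<Rightarrow> 'a set monoid" where
  "abelianization G \<equiv> G Mod (derived G (carrier G))"

abbreviation second_center_quotient :: "('a, 'b) monoid_scheme \<Rightarrow> 'a set monoid" where
  "second_center_quotient G \<equiv> (G\<lparr>carrier := second_center G\<rparr>) Mod (center G)"


section \<open>Pontryagin duals and the homomorphism \<open>\<omega>\<^sub>\<chi>\<close>\<close>

definition rat_group :: "rat monoid" where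
  "rat_group = \<lparr>carrier = UNIV, monoid.mult = (+), one = 0\<rparr>"

definition rat_mod_int :: "rat set monoid" where
  "rat_mod_int = rat_group Mod \<int>"

text \<open>Characters are extensional, so that equality of characters is equality of functions.\<close>
definition pontryagin_dual :: "('a, 'b) monoid_scheme \<Rightarrow> ('a \<Rightarrow> rat set) monoid" where
  "pontryagin_dual N =
    \<lparr>carrier = hom N rat_mod_int \<inter> extensional (carrier N),
     monoid.mult = (\<lambda>\<phi> \<psi>. \<lambda>x\<in>carrier N. \<phi> x \<otimes>\<^bsub>rat_mod_int\<^esub> \<psi> x),
     one = (\<lambda>x\<in>carrier N. \<one>\<^bsub>rat_mod_int\<^esub>)\<rparr>"

text \<open>On cosets \<open>A\<close> of \<open>Z(G)\<close> in \<open>Z\<^sub>2(G)\<close> and \<open>B\<close> of \<open>[G,G]\<close> in \<open>G\<close>, the value is the common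
  value of \<open>\<chi> [z,g]\<close> over all representatives \<open>z \<in> A\<close> and \<open>g \<in> B\<close>; see \<open>omega_coset\<close> below.\<close>
definition omega ::
  "('a, 'b) monoid_scheme \<Rightarrow> ('a \<Rightarrow> rat set) \<Rightarrow> 'a set \<Rightarrow> 'a set \<Rightarrow> rat set" where
  "omega G \<chi> = (\<lambda>A \<in> carrier (second_center_quotient G). \<lambda>B \<in> carrier (abelianization G).
     the_elem {\<chi> (commutator G z g) | z g. z \<in> A \<and> g \<in> B})"

context group
begin

lemma centerI: "z \<in> carrier G \<Longrightarrow> (\<And>g. g \<in> carrier G \<Longrightarrow> z \<otimes> g = g \<otimes> z) \<Longrightarrow> z \<in> center G"
  by (simp add: center_def)

lemma center_carrier: "z \<in> center G \<Longrightarrow> z \<in> carrier G"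
  by (simp add: center_def)

lemma center_comm: "z \<in> center G \<Longrightarrow> g \<in> carrier G \<Longrightarrow> z \<otimes> g = g \<otimes> z"
  by (simp add: center_def)

lemma center_subgroup: "subgroup (center G) G"
proof
  show "center G \<subseteq> carrier G" by (auto simp: center_def)
  show "\<one> \<in> center G" by (auto simp: center_def)
next
  fix x y assume xy: "x \<in> center G" "y \<in> center G"
  have "x \<otimes> y \<otimes> g = g \<otimes> (x \<otimes> y)" if g: "g \<in> carrier G" for g
  proof -
    have c: "x \<in> carrier G" "y \<in> carrier G" "x \<otimes> g = g \<otimes> x" "y \<otimes> g = g \<otimes> y"
      using center_carrier[OF xy(1)] center_carrier[OF xy(2)] center_comm[OF xy(1) g] center_comm[OF xy(2) g] by fast+
    have "x \<otimes> y \<otimes> g = x \<otimes> (y \<otimes> g)" using c(1,2) g by (rule m_assoc)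
    also have "\<dots> = x \<otimes> g \<otimes> y" unfolding c(4) using c(1,2) g by (simp only: m_assoc)
    also have "\<dots> = g \<otimes> (x \<otimes> y)" unfolding c(3) using c(1,2) g by (simp only: m_assoc)
    finally show ?thesis .
  qed
  then show "x \<otimes> y \<in> center G" using xy center_carrier by (intro centerI m_closed)
next
  fix x assume x: "x \<in> center G"
  then have xc: "x \<in> carrier G" by (rule center_carrier)
  have "inv x \<otimes> g = g \<otimes> inv x" if g: "g \<in> carrier G" for g
  proof -
    have e: "x \<otimes> g = g \<otimes> x" using x g by (rule center_comm)
    have "inv x \<otimes> g = inv x \<otimes> (g \<otimes> x) \<otimes> inv x"
      using xc g by (simp add: m_assoc)
    also have "\<dots> = inv x \<otimes> (x \<otimes> g) \<otimes> inv x" by (simp only: e)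
    also have "\<dots> = g \<otimes> inv x" using xc g by (simp add: m_assoc[symmetric])
    finally show ?thesis .
  qed
  then show "inv x \<in> center G" using xc by (intro centerI inv_closed)
qed

lemma center_normal: "center G \<lhd> G"
proof -
  have "g \<otimes> z \<otimes> inv g \<in> center G" if z: "z \<in> center G" and g: "g \<in> carrier G" for g z
  proof -
    have zc: "z \<in> carrier G" and e: "g \<otimes> z = z \<otimes> g" using center_carrier[OF z] center_comm[OF z g] by simp_all
    have "g \<otimes> z \<otimes> inv g = z" unfolding e using zc g by (simp add: m_assoc)
    then show ?thesis using z by simp
  qed
  then show ?thesis using center_subgroup normal_inv_iff by simp
qed

lemma inv_cancel:
  assumes "a \<in> carrier G" "b \<in> carrier G"
  shows "inv a \<otimes> (a \<otimes> b) = b" "a \<otimes> (inv a \<otimes> b) = b"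
  using assms by (simp_all flip: m_assoc)

lemma commutator_closed: "x \<in> carrier G \<Longrightarrow> y \<in> carrier G \<Longrightarrow> commutator G x y \<in> carrier G"
  by (simp add: commutator_def)

lemma commutator_swap: "x \<in> carrier G \<Longrightarrow> y \<in> carrier G \<Longrightarrow> x \<otimes> y = commutator G x y \<otimes> (y \<otimes> x)"
  by (simp add: commutator_def m_assoc inv_cancel)

lemma commutator_eqI:
  assumes "x \<in> carrier G" "y \<in> carrier G" "c \<in> carrier G" "x \<otimes> y = c \<otimes> (y \<otimes> x)"
  shows "commutator G x y = c"
proof -
  have "commutator G x y = x \<otimes> y \<otimes> inv (y \<otimes> x)"
    using assms(1,2) by (simp add: commutator_def inv_mult_group m_assoc)
  also have "\<dots> = c \<otimes> ((y \<otimes> x) \<otimes> inv (y \<otimes> x))"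
    unfolding assms(4) using assms(1-3) by (intro m_assoc) auto
  finally show ?thesis using assms by simp
qed

lemma center_modulo_iff:
  assumes "N \<lhd> G"
  shows "x \<in> center_modulo G N \<longleftrightarrow> x \<in> carrier G \<and> (\<forall>g \<in> carrier G. commutator G x g \<in> N)"
proof -
  interpret N: normal N G by fact
  have "(N #> x) <#> (N #> g) = (N #> g) <#> (N #> x) \<longleftrightarrow> commutator G x g \<in> N"
    if x: "x \<in> carrier G" and g: "g \<in> carrier G" for g
  proof -
    have "(N #> x) <#> (N #> g) = (N #> g) <#> (N #> x) \<longleftrightarrow> N #> (x \<otimes> g) = N #> (g \<otimes> x)"
      using x g by (simp add: N.rcos_sum)
    also have "\<dots> \<longleftrightarrow> x \<otimes> g \<in> N #> (g \<otimes> x)"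
      using x g rcos_self[of "x \<otimes> g" N] repr_independence[of "x \<otimes> g" N "g \<otimes> x"] N.subgroup_axioms
      by auto
    also have "\<dots> \<longleftrightarrow> x \<otimes> g \<otimes> inv (g \<otimes> x) \<in> N"
      using x g by (intro N.rcos_module) (auto simp: group_axioms)
    also have "x \<otimes> g \<otimes> inv (g \<otimes> x) = commutator G x g"
      using x g by (simp add: commutator_def inv_mult_group m_assoc)
    finally show ?thesis .
  qed
  moreover have "N #> x \<in> carrier (G Mod N)" if "x \<in> carrier G"
    using that by (auto simp: FactGroup_def RCOSETS_def)
  ultimately show ?thesis
    by (auto simp: center_modulo_def center_def FactGroup_def RCOSETS_def)
qed

lemma second_center_iff:
  "z \<in> second_center G \<longleftrightarrow> z \<in> carrier G \<and> (\<forall>g \<in> carrier G. commutator G z g \<in> center G)"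
  by (simp add: second_center_def center_modulo_iff[OF center_normal])

lemma commutator_mult_left:
  assumes z: "z \<in> second_center G" and z': "z' \<in> second_center G" and g: "g \<in> carrier G"
  shows "commutator G (z \<otimes> z') g = commutator G z g \<otimes> commutator G z' g"
proof (rule commutator_eqI)
  let ?c = "commutator G z g" and ?d = "commutator G z' g"
  have C: "z \<in> carrier G" "z' \<in> carrier G" "?c \<in> carrier G" "?d \<in> carrier G" "?d \<in> center G"
    using z z' g by (auto simp: second_center_iff commutator_closed)
  then show "z \<otimes> z' \<in> carrier G" "?c \<otimes> ?d \<in> carrier G" by auto
  show "g \<in> carrier G" by fact
  have "z \<otimes> z' \<otimes> g = z \<otimes> (?d \<otimes> (g \<otimes> z'))"
    using C g commutator_swap[of z' g] by (simp add: m_assoc)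
  also have "\<dots> = ?d \<otimes> (z \<otimes> g \<otimes> z')"
    using C g center_comm[of ?d z] by (simp flip: m_assoc)
  also have "\<dots> = ?d \<otimes> (?c \<otimes> (g \<otimes> z) \<otimes> z')"
    using C g commutator_swap[of z g] by simp
  also have "\<dots> = ?c \<otimes> ?d \<otimes> (g \<otimes> (z \<otimes> z'))"
    using C g center_comm[of ?d ?c] by (simp flip: m_assoc)
  finally show "z \<otimes> z' \<otimes> g = ?c \<otimes> ?d \<otimes> (g \<otimes> (z \<otimes> z'))" .
qed

lemma commutator_mult_right:
  assumes z: "z \<in> second_center G" and g: "g \<in> carrier G" and h: "h \<in> carrier G"
  shows "commutator G z (g \<otimes> h) = commutator G z g \<otimes> commutator G z h"
proof (rule commutator_eqI)
  let ?c = "commutator G z g" and ?d = "commutator G z h"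
  have C: "z \<in> carrier G" "?c \<in> carrier G" "?d \<in> carrier G" "?d \<in> center G"
    using z g h by (auto simp: second_center_iff commutator_closed)
  then show "z \<in> carrier G" "?c \<otimes> ?d \<in> carrier G" by auto
  show "g \<otimes> h \<in> carrier G" using g h by simp
  have "z \<otimes> (g \<otimes> h) = ?c \<otimes> (g \<otimes> z) \<otimes> h"
    using C g h commutator_swap[of z g] by (simp flip: m_assoc)
  also have "\<dots> = ?c \<otimes> (g \<otimes> (?d \<otimes> (h \<otimes> z)))"
    using C g h commutator_swap[of z h] by (simp add: m_assoc)
  also have "\<dots> = ?c \<otimes> (g \<otimes> ?d \<otimes> (h \<otimes> z))"
    using C g h by (simp add: m_assoc)
  also have "\<dots> = ?c \<otimes> (?d \<otimes> g \<otimes> (h \<otimes> z))"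
    using C g center_comm[of ?d g] by simp
  finally show "z \<otimes> (g \<otimes> h) = ?c \<otimes> ?d \<otimes> (g \<otimes> h \<otimes> z)"
    using C g h by (simp add: m_assoc)
qed

lemma second_center_subgroup: "subgroup (second_center G) G"
proof
  show "second_center G \<subseteq> carrier G" by (auto simp: second_center_iff)
  show "\<one> \<in> second_center G"
    using subgroup.one_closed[OF center_subgroup] by (auto simp: second_center_iff commutator_def)
next
  fix x y assume xy: "x \<in> second_center G" "y \<in> second_center G"
  then show "x \<otimes> y \<in> second_center G"
    using subgroup.m_closed[OF center_subgroup]
    by (subst second_center_iff) (auto simp: commutator_mult_left second_center_iff)
next
  fix x assume x: "x \<in> second_center G"
  then have xc: "x \<in> carrier G" by (simp add: second_center_iff)
  have "commutator G (inv x) g \<in> center G" if g: "g \<in> carrier G" for g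
  proof -
    let ?c = "commutator G x g"
    have c: "?c \<in> center G" "?c \<in> carrier G" using x g by (auto simp: second_center_iff commutator_closed)
    have "g \<otimes> inv x = inv x \<otimes> (x \<otimes> g) \<otimes> inv x"
      using xc g by (simp add: m_assoc inv_cancel)
    also have "\<dots> = inv x \<otimes> (?c \<otimes> (g \<otimes> x)) \<otimes> inv x" using commutator_swap[OF xc g] by simp
    also have "\<dots> = inv x \<otimes> ?c \<otimes> g"
      using xc g c by (simp add: m_assoc)
    also have "\<dots> = ?c \<otimes> (inv x \<otimes> g)"
      using xc g c center_comm[of ?c "inv x"] by (simp flip: m_assoc)
    finally have "inv x \<otimes> g = inv ?c \<otimes> (g \<otimes> inv x)"
      using xc g c by (simp add: m_assoc inv_cancel)
    then have "commutator G (inv x) g = inv ?c"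
      using xc g c by (intro commutator_eqI) auto
    then show ?thesis using c subgroup.m_inv_closed[OF center_subgroup] by simp
  qed
  then show "inv x \<in> second_center G" using xc by (simp add: second_center_iff)
qed

lemma center_le_second_center: "center G \<subseteq> second_center G"
proof
  fix z assume z: "z \<in> center G"
  then have zc: "z \<in> carrier G" by (simp add: center_def)
  have "commutator G z g = \<one>" if "g \<in> carrier G" for g
    using zc that center_comm[OF z that] by (intro commutator_eqI) simp_all
  then show "z \<in> second_center G"
    using zc subgroup.one_closed[OF center_subgroup] by (simp add: second_center_iff)
qed

lemma commutator_center: "z \<in> center G \<Longrightarrow> g \<in> carrier G \<Longrightarrow> commutator G z g = \<one>"
  using center_comm[of z g] center_carrier[of z] by (intro commutator_eqI) simp_all

lemma commutator_derived:
  assumes z: "z \<in> second_center G" and d: "d \<in> derived G (carrier G)"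
  shows "commutator G z d = \<one>"
proof -
  have zc: "z \<in> carrier G" using z by (simp add: second_center_iff)
  have unit: "commutator G z \<one> = \<one>" using zc by (simp add: commutator_def)
  have invs: "commutator G z (inv g) = inv (commutator G z g)" if g: "g \<in> carrier G" for g
  proof -
    have "commutator G z (inv g) \<otimes> commutator G z g = \<one>"
      using commutator_mult_right[OF z, of "inv g" g] g unit by simp
    then show ?thesis using g zc by (metis commutator_closed inv_closed inv_equality)
  qed
  have gen: "commutator G z h = \<one>" if hd: "h \<in> derived_set G (carrier G)" for h
  proof -
    obtain x y where x: "x \<in> carrier G" and y: "y \<in> carrier G"
      and h: "h = x \<otimes> y \<otimes> inv x \<otimes> inv y" using hd by auto
    have c: "commutator G z x \<in> center G" "commutator G z x \<in> carrier G" "commutator G z y \<in> carrier G"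
      using z zc x y by (auto simp: second_center_iff commutator_closed)
    have "commutator G z h = commutator G z x \<otimes> commutator G z y \<otimes> inv (commutator G z x) \<otimes> inv (commutator G z y)"
      using x y z by (simp add: h commutator_mult_right invs)
    also have "\<dots> = \<one>"
      using commutator_center[OF c(1) c(3)] by (simp add: commutator_def)
    finally show ?thesis .
  qed
  have sub: "derived_set G (carrier G) \<subseteq> carrier G" by auto
  have "d \<in> generate G (derived_set G (carrier G))" using d by (simp add: derived_def)
  then show ?thesis
  proof (induction rule: generate.induct)
    case one show ?case by (rule unit)
  next
    case (incl h) then show ?case by (rule gen)
  next
    case (inv h)
    have h: "h \<in> carrier G" using inv sub by blast
    show ?case unfolding invs[OF h] gen[OF inv] by simp
  next
    case (eng a b)
    have ab: "a \<in> carrier G" "b \<in> carrier G" using eng(1,2) generate_in_carrier[OF sub] by blast+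
    show ?case unfolding commutator_mult_right[OF z ab] eng(3,4) by simp
  qed
qed

lemma omega_coset:
  assumes z: "z \<in> second_center G" and g: "g \<in> carrier G"
  shows "omega G \<chi> (center G #> z) (derived G (carrier G) #> g) = \<chi> (commutator G z g)"
proof -
  have A: "center G #> z \<in> carrier (second_center_quotient G)"
    using z by (auto simp: FactGroup_def RCOSETS_def r_coset_def)
  have B: "derived G (carrier G) #> g \<in> carrier (abelianization G)"
    using g by (auto simp: FactGroup_def RCOSETS_def)
  have const: "commutator G z' g' = commutator G z g"
    if zg: "z' \<in> center G #> z" "g' \<in> derived G (carrier G) #> g" for z' g'
  proof -
    obtain c d where c: "c \<in> center G" and d: "d \<in> derived G (carrier G)"
      and eq: "z' = c \<otimes> z" "g' = d \<otimes> g" using zg by (auto simp: r_coset_def)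
    have dc: "d \<in> carrier G" using d derived_in_carrier by auto
    have c2: "c \<in> second_center G" using c center_le_second_center by auto
    have "commutator G z' g' = commutator G c (d \<otimes> g) \<otimes> (commutator G z d \<otimes> commutator G z g)"
      using z c2 dc g by (simp add: eq commutator_mult_left commutator_mult_right)
    then show ?thesis
      using z c d dc g by (simp add: commutator_center commutator_derived second_center_iff commutator_closed)
  qed
  have rep: "z \<in> center G #> z" "g \<in> derived G (carrier G) #> g"
    using z g center_subgroup derived_is_subgroup[of "carrier G"]
    by (auto simp: second_center_iff intro: rcos_self)
  have "{\<chi> (commutator G z' g') | z' g'. z' \<in> center G #> z \<and> g' \<in> derived G (carrier G) #> g}
      = {\<chi> (commutator G z g)}" (is "?S = _")
  proof
    show "?S \<subseteq> {\<chi> (commutator G z g)}" using const by auto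
    show "{\<chi> (commutator G z g)} \<subseteq> ?S" using rep by auto
  qed
  then show ?thesis using A B by (simp add: omega_def)
qed

lemma omega_hom:
  assumes \<chi>: "\<chi> \<in> carrier (pontryagin_dual (center_group G))"
  shows "omega G \<chi> \<in> hom (second_center_quotient G) (pontryagin_dual (abelianization G))"
proof -
  let ?Z = "center G" and ?D = "derived G (carrier G)"
  interpret Z: normal ?Z G by (rule center_normal)
  interpret D: normal ?D G by (rule derived_self_is_normal)
  have chi: "\<chi> c \<in> carrier rat_mod_int" "\<chi> (c \<otimes> d) = \<chi> c \<otimes>\<^bsub>rat_mod_int\<^esub> \<chi> d"
    if "c \<in> center G" "d \<in> center G" for c d
    using \<chi> that by (auto simp: pontryagin_dual_def hom_def)
  note chi(1)[OF _ Z.one_closed, simp]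
  have comm: "commutator G z g \<in> center G" if "z \<in> second_center G" "g \<in> carrier G" for z g
    using that by (simp add: second_center_iff)
  have sm: "set_mult (G\<lparr>carrier := S\<rparr>) = set_mult G" for S
    by (simp add: set_mult_def fun_eq_iff)
  have A: "\<exists>z \<in> second_center G. A = ?Z #> z" if "A \<in> carrier (second_center_quotient G)" for A
    using that by (auto simp: FactGroup_def RCOSETS_def r_coset_def)
  have B: "\<exists>g \<in> carrier G. B = ?D #> g" if "B \<in> carrier (abelianization G)" for B
    using that by (auto simp: FactGroup_def RCOSETS_def)
  have ext: "omega G \<chi> C \<in> extensional (carrier (abelianization G))"
    if "C \<in> carrier (second_center_quotient G)" for C
    using that by (simp add: omega_def)
  have Zc: "?Z #> z \<in> carrier (second_center_quotient G)" if "z \<in> second_center G" for z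
    using that by (auto simp: FactGroup_def RCOSETS_def r_coset_def)
  have Dc: "?D #> g \<in> carrier (abelianization G)" if "g \<in> carrier G" for g
    using that by (auto simp: FactGroup_def RCOSETS_def)
  have zc: "z \<in> carrier G" if "z \<in> second_center G" for z
    using that by (simp add: second_center_iff)
  have multB: "(?D #> g) \<otimes>\<^bsub>abelianization G\<^esub> (?D #> h) = ?D #> (g \<otimes> h)"
    if "g \<in> carrier G" "h \<in> carrier G" for g h
    using that by (simp add: FactGroup_def D.rcos_sum)
  have multA: "(?Z #> z) \<otimes>\<^bsub>second_center_quotient G\<^esub> (?Z #> w) = ?Z #> (z \<otimes> w)"
    if "z \<in> second_center G" "w \<in> second_center G" for z w
    using that zc by (simp add: FactGroup_def sm Z.rcos_sum)
  have dual: "omega G \<chi> C \<in> carrier (pontryagin_dual (abelianization G))"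
    if C: "C \<in> carrier (second_center_quotient G)" for C
  proof -
    obtain z where z: "z \<in> second_center G" "C = ?Z #> z" using A[OF C] by auto
    have "omega G \<chi> C \<in> hom (abelianization G) rat_mod_int"
    proof (rule homI)
      fix B assume "B \<in> carrier (abelianization G)"
      then obtain g where "g \<in> carrier G" "B = ?D #> g" using B by auto
      then show "omega G \<chi> C B \<in> carrier rat_mod_int"
        using z comm chi by (simp add: omega_coset)
    next
      fix B B' assume "B \<in> carrier (abelianization G)" "B' \<in> carrier (abelianization G)"
      then obtain g h where g: "g \<in> carrier G" "B = ?D #> g" and h: "h \<in> carrier G" "B' = ?D #> h"
        using B by metis
      have "omega G \<chi> C (B \<otimes>\<^bsub>abelianization G\<^esub> B') = \<chi> (commutator G z (g \<otimes> h))"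
        using z g h by (simp only: multB omega_coset m_closed)
      then show "omega G \<chi> C (B \<otimes>\<^bsub>abelianization G\<^esub> B') = omega G \<chi> C B \<otimes>\<^bsub>rat_mod_int\<^esub> omega G \<chi> C B'"
        using z g h comm chi by (simp add: omega_coset commutator_mult_right)
    qed
    then show ?thesis using ext[OF C] by (simp add: pontryagin_dual_def)
  qed
  show ?thesis
  proof (rule homI)
    fix C assume "C \<in> carrier (second_center_quotient G)"
    then show "omega G \<chi> C \<in> carrier (pontryagin_dual (abelianization G))" by (rule dual)
  next
    fix C C' assume "C \<in> carrier (second_center_quotient G)" "C' \<in> carrier (second_center_quotient G)"
    then obtain z w where z: "z \<in> second_center G" "C = ?Z #> z"
      and w: "w \<in> second_center G" "C' = ?Z #> w"
      using A by metis
    have zw: "z \<otimes> w \<in> second_center G"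
      using z w subgroup.m_closed[OF second_center_subgroup] by simp
    have CC: "C \<otimes>\<^bsub>second_center_quotient G\<^esub> C' = ?Z #> (z \<otimes> w)"
      using z w by (simp only: multA)
    show "omega G \<chi> (C \<otimes>\<^bsub>second_center_quotient G\<^esub> C') =
        omega G \<chi> C \<otimes>\<^bsub>pontryagin_dual (abelianization G)\<^esub> omega G \<chi> C'"
    proof (rule extensionalityI[of _ "carrier (abelianization G)"])
      show "omega G \<chi> (C \<otimes>\<^bsub>second_center_quotient G\<^esub> C') \<in> extensional (carrier (abelianization G))"
        unfolding CC by (rule ext[OF Zc[OF zw]])
      show "omega G \<chi> C \<otimes>\<^bsub>pontryagin_dual (abelianization G)\<^esub> omega G \<chi> C' \<in> extensional (carrier (abelianization G))"
        by (simp add: pontryagin_dual_def)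
    next
      fix B assume Bc: "B \<in> carrier (abelianization G)"
      then obtain g where g: "g \<in> carrier G" "B = ?D #> g" using B by auto
      show "omega G \<chi> (C \<otimes>\<^bsub>second_center_quotient G\<^esub> C') B =
          (omega G \<chi> C \<otimes>\<^bsub>pontryagin_dual (abelianization G)\<^esub> omega G \<chi> C') B"
        using z w g zw Bc comm chi unfolding CC
        by (simp add: pontryagin_dual_def omega_coset commutator_mult_left)
    qed
  qed
qed

end


section \<open>The abelian part of the socle\<close>

definition minimal_normal :: "'a set \<Rightarrow> ('a, 'b) monoid_scheme \<Rightarrow> bool" where
  "minimal_normal N L \<longleftrightarrow> N \<lhd> L \<and> N \<noteq> {\<one>\<^bsub>L\<^esub>} \<and>
     (\<forall>M. M \<lhd> L \<and> M \<subseteq> N \<longrightarrow> M = {\<one>\<^bsub>L\<^esub>} \<or> M = N)"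

definition SocA :: "('a, 'b) monoid_scheme \<Rightarrow> 'a set" where
  "SocA L = generate L (\<Union>{N. minimal_normal N L \<and> comm_group (L\<lparr>carrier := N\<rparr>)})"

definition conjugacy_class :: "('a, 'b) monoid_scheme \<Rightarrow> 'a \<Rightarrow> 'a set" where
  "conjugacy_class L x = (\<lambda>g. g \<otimes>\<^bsub>L\<^esub> x \<otimes>\<^bsub>L\<^esub> inv\<^bsub>L\<^esub> g) ` carrier L"

definition generated_by_single_class :: "'a set \<Rightarrow> ('a, 'b) monoid_scheme \<Rightarrow> bool" where
  "generated_by_single_class S L \<longleftrightarrow> (\<exists>x \<in> carrier L. S = generate L (conjugacy_class L x))"


section \<open>Finite-dimensional linear representations\<close>

text \<open>A representation of dimension \<open>n\<close> over the field (type) \<open>'f\<close> is given, after choosing a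
  basis, by a homomorphism into \<open>GL\<^sub>n\<close>.\<close>

abbreviation GL :: "'f :: field itself \<Rightarrow> nat \<Rightarrow> 'f mat monoid" where
  "GL F n \<equiv> units_of (ring_mat F n ())"

definition representation :: "('a, 'b) monoid_scheme \<Rightarrow> nat \<Rightarrow> ('a \<Rightarrow> 'f :: field mat) \<Rightarrow> bool" where
  "representation G n \<sigma> \<longleftrightarrow> \<sigma> \<in> hom G (GL TYPE('f) n)"

definition invariant_subspace ::
  "('a, 'b) monoid_scheme \<Rightarrow> nat \<Rightarrow> ('a \<Rightarrow> 'f :: field mat) \<Rightarrow> 'f vec set \<Rightarrow> bool" where
  "invariant_subspace G n \<sigma> W \<longleftrightarrow> VectorSpace.subspace class_ring W (module_vec TYPE('f) n) \<and>
     (\<forall>g \<in> carrier G. \<forall>w \<in> W. \<sigma> g *\<^sub>v w \<in> W)"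

text \<open>The zero representation is not irreducible.\<close>
definition irreducible_representation ::
  "('a, 'b) monoid_scheme \<Rightarrow> nat \<Rightarrow> ('a \<Rightarrow> 'f :: field mat) \<Rightarrow> bool" where
  "irreducible_representation G n \<sigma> \<longleftrightarrow> representation G n \<sigma> \<and> 0 < n \<and>
     (\<forall>W. invariant_subspace G n \<sigma> W \<longrightarrow> W = {0\<^sub>v n} \<or> W = carrier_vec n)"

definition rep_center ::
  "('a, 'b) monoid_scheme \<Rightarrow> nat \<Rightarrow> ('a \<Rightarrow> 'f :: field mat) \<Rightarrow> 'a set" where
  "rep_center G n \<sigma> =
     {g \<in> carrier G. \<sigma> g \<in> center ((GL TYPE('f) n)\<lparr>carrier := \<sigma> ` carrier G\<rparr>)}"

end

theory Submission
  imports Defs "HOL-Library.Function_Algebras"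
begin

text \<open>
  Let \<open>\<sigma>\<close> be an irreducible representation with kernel \<open>N\<close>. Since \<open>\<sigma> g\<close> and \<open>\<sigma> h\<close> commute exactly
  when \<open>[g,h] \<in> N\<close>, the condition \<open>Z(\<sigma>) = Z(G)\<close> says that \<open>N\<close> is central and that \<open>[g,h] \<in> N\<close> for all
  \<open>h\<close> forces \<open>g \<in> Z(G)\<close>. By Schur's lemma \<open>\<sigma>(Z(G))\<close> lies in a field, the center of the commutant
  algebra, so it is cyclic; hence \<open>N\<close> is the kernel of a character \<open>\<chi>\<close> of \<open>Z(G)\<close>, and the condition on
  commutators becomes the injectivity of \<open>\<omega>\<^sub>\<chi>\<close> (\<open>omega_inj_iff\<close>). What remains is to decide which quotients
  \<open>G/ker \<chi>\<close> have a faithful irreducible representation, and for this the answer is Gaschuetz's theorem: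
  a finite group \<open>L\<close> whose order is invertible in \<open>F\<close> has one over \<open>F\<close> if and only if \<open>SocA(L)\<close> is generated
  by a single conjugacy class (\<open>faithful_irreducible_iff_single_class\<close>).

  The theorem is proved by translating it into a question about functions. For \<open>K\<close> normal in
  \<open>L\<close> consider the space \<open>V(K)\<close> of functions \<open>K \<rightarrow> F\<close> whose sums over the cosets of every minimal
  normal subgroup \<open>M \<subseteq> K\<close> vanish (\<open>null_functions\<close>). A faithful irreducible representation has
  no nonzero vectors fixed by \<open>M\<close>, so its matrix coefficients lie in \<open>V(L)\<close>; conversely, on a
  minimal nonzero translation invariant subspace of \<open>V(L)\<close> no minimal normal subgroup acts trivially. So the
  question is whether \<open>V(L) \<noteq> 0\<close>, and this is equivalent to \<open>V(SocA(L)) \<noteq> 0\<close>: a nonzero element of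
  \<open>V(SocA(L))\<close> is adapted to one nonabelian minimal normal subgroup after another by subtracting
  a right translate (\<open>null_functions_SocA\<close>).

  Finally \<open>SocA(L)\<close> is a direct product of abelian minimal normal subgroups, and both properties in question are
  tested one factor at a time. Let \<open>A = M \<times> B\<close> with \<open>M\<close> minimal normal and \<open>B\<close> such a product.
  Then \<open>V(A) \<noteq> 0\<close> iff \<open>V(B) \<noteq> 0\<close> and there are fewer than \<open>|M|\<close> normal complements of \<open>B\<close> in
  \<open>A\<close>, because \<open>dim V(A) = (|M| - k) dim V(B)\<close>, where \<open>k\<close> is the number of these complements
  (\<open>null_functions_step\<close>). On the other side, \<open>A\<close> is the normal closure of one element iff \<open>B\<close> is and
  there are fewer than \<open>|M|\<close> normal complements of \<open>M\<close> in \<open>A\<close>: for a fixed \<open>b\<close> with normal closure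
  \<open>B\<close>, these complements are the normal closures of the elements \<open>b m\<close> for the unsuitable \<open>m \<in> M\<close>
  (\<open>single_class_step\<close>). The two numbers agree. Complements are graphs of equivariant homomorphisms, so the claim
  is \<open>|Hom(M,B)| = |Hom(B,M)|\<close>; both sides are multiplicative in \<open>B\<close>, and for two distinct
  minimal normal subgroups \<open>M\<close>, \<open>N\<close> both are one less than the number of minimal normal
  subgroups of \<open>G\<close> inside \<open>MN\<close> (\<open>card_conj_hom_sym\<close>).

  If \<open>G\<close> is nilpotent, then all minimal normal subgroups of \<open>L = G/ker \<chi>\<close> are central; injectivity of
  \<open>\<omega>\<^sub>\<chi>\<close> gives \<open>Z(L) = Z(G)/ker \<chi>\<close>, which \<open>\<chi>\<close> embeds into \<open>\<rat>/\<int>\<close>. Hence \<open>SocA(L)\<close> is cyclic and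
  central, and a generator forms a conjugacy class by itself (\<open>nilpotent_single_class\<close>).
\<close>

section \<open>Normal subgroups and direct products\<close>

context group
begin

lemma normalD:
  assumes "N \<lhd> G"
  shows "N \<subseteq> carrier G" "\<one> \<in> N" "\<And>x. x \<in> N \<Longrightarrow> x \<in> carrier G"
    "\<And>x y. x \<in> N \<Longrightarrow> y \<in> N \<Longrightarrow> x \<otimes> y \<in> N" "\<And>x. x \<in> N \<Longrightarrow> inv x \<in> N"
    "\<And>g x. g \<in> carrier G \<Longrightarrow> x \<in> N \<Longrightarrow> g \<otimes> x \<otimes> inv g \<in> N"
proof -
  have s: "subgroup N G" using assms by (rule normal_imp_subgroup)
  then show "N \<subseteq> carrier G" "\<one> \<in> N" "\<And>x. x \<in> N \<Longrightarrow> x \<in> carrier G"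
    "\<And>x y. x \<in> N \<Longrightarrow> y \<in> N \<Longrightarrow> x \<otimes> y \<in> N" "\<And>x. x \<in> N \<Longrightarrow> inv x \<in> N"
    by (auto simp: subgroup_def)
  show "\<And>g x. g \<in> carrier G \<Longrightarrow> x \<in> N \<Longrightarrow> g \<otimes> x \<otimes> inv g \<in> N"
    using assms normal_inv_iff by blast
qed

text \<open>The commutator of an element of \<open>M\<close> and an element of \<open>N\<close> lies in \<open>M \<inter> N\<close>.\<close>
lemma normal_commute:
  assumes M: "M \<lhd> G" and N: "N \<lhd> G" and I: "M \<inter> N = {\<one>}" and x: "x \<in> M" and y: "y \<in> N"
  shows "x \<otimes> y = y \<otimes> x"
proof -
  note c[simp] = normalD(3)[OF M x] normalD(3)[OF N y]
  have "x \<otimes> (y \<otimes> inv x \<otimes> inv y) \<in> M"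
    using normalD[OF M] x c by auto
  moreover have "(x \<otimes> y \<otimes> inv x) \<otimes> inv y \<in> N"
    using normalD(4)[OF N normalD(6)[OF N c(1) y] normalD(5)[OF N y]] .
  ultimately have "x \<otimes> y \<otimes> inv x \<otimes> inv y \<in> M \<inter> N" by (simp add: m_assoc)
  then have "commutator G x y = \<one>" using I by (simp add: commutator_def)
  then show ?thesis using commutator_swap[of x y] by simp
qed

lemma set_multI: "x \<in> M \<Longrightarrow> y \<in> N \<Longrightarrow> x \<otimes> y \<in> M <#> N"
  by (auto simp: set_mult_def)

lemma set_multE: "z \<in> M <#> N \<Longrightarrow> (\<And>x y. x \<in> M \<Longrightarrow> y \<in> N \<Longrightarrow> z = x \<otimes> y \<Longrightarrow> P) \<Longrightarrow> P"
  by (auto simp: set_mult_def)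

lemma normal_set_mult:
  assumes M: "M \<lhd> G" and N: "N \<lhd> G"
  shows "M <#> N \<lhd> G"
  unfolding normal_inv_iff
proof (intro conjI ballI)
  show "subgroup (M <#> N) G"
    by (rule mult_norm_subgroup[OF M normal_imp_subgroup[OF N]])
  fix g z assume g: "g \<in> carrier G" and "z \<in> M <#> N"
  then obtain x y where xy: "x \<in> M" "y \<in> N" "z = x \<otimes> y" by (meson set_multE subsetD)
  have c: "x \<in> carrier G" "y \<in> carrier G" using xy normalD(3)[OF M] normalD(3)[OF N] by auto
  have "g \<otimes> z \<otimes> inv g = (g \<otimes> x \<otimes> inv g) \<otimes> (g \<otimes> y \<otimes> inv g)"
    using g c xy(3) by (simp add: m_assoc inv_cancel)
  then show "g \<otimes> z \<otimes> inv g \<in> M <#> N"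
    using normalD(6)[OF M g xy(1)] normalD(6)[OF N g xy(2)] by (simp add: set_multI)
qed

lemma subset_set_mult:
  assumes "M \<lhd> G" "N \<lhd> G"
  shows "M \<subseteq> M <#> N" "N \<subseteq> M <#> N"
proof -
  have "x \<in> M <#> N" if "x \<in> M" for x
    using set_multI[OF that normalD(2)[OF assms(2)]] normalD(3)[OF assms(1) that] by simp
  then show "M \<subseteq> M <#> N" by blast
  have "x \<in> M <#> N" if "x \<in> N" for x
    using set_multI[OF normalD(2)[OF assms(1)] that] normalD(3)[OF assms(2) that] by simp
  then show "N \<subseteq> M <#> N" by blast
qed

lemma set_mult_least:
  assumes "K \<lhd> G" "M \<subseteq> K" "N \<subseteq> K"
  shows "M <#> N \<subseteq> K"
  using normalD(4)[OF assms(1)] assms(2,3) by (auto simp: set_mult_def)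

lemma direct_unique:
  assumes M: "M \<lhd> G" and N: "N \<lhd> G" and I: "M \<inter> N = {\<one>}"
    and x: "x \<in> M" "x' \<in> M" and y: "y \<in> N" "y' \<in> N" and e: "x \<otimes> y = x' \<otimes> y'"
  shows "x = x' \<and> y = y'"
proof -
  have c[simp]: "x \<in> carrier G" "x' \<in> carrier G" "y \<in> carrier G" "y' \<in> carrier G"
    using x y normalD(3)[OF M] normalD(3)[OF N] by auto
  have "inv x' \<otimes> x = inv x' \<otimes> (x \<otimes> y) \<otimes> inv y" by (simp add: m_assoc)
  also have "\<dots> = y' \<otimes> inv y" unfolding e by (simp add: m_assoc[symmetric])
  finally have "inv x' \<otimes> x = y' \<otimes> inv y" .
  moreover have "inv x' \<otimes> x \<in> M" using x normalD[OF M] by auto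
  moreover have "y' \<otimes> inv y \<in> N" using y normalD[OF N] by auto
  ultimately have *: "inv x' \<otimes> x = \<one>" "y' \<otimes> inv y = \<one>" using I by auto
  have "x = x' \<otimes> (inv x' \<otimes> x)" by (simp add: inv_cancel)
  then have "x = x'" using * by simp
  moreover have "y' = y' \<otimes> inv y \<otimes> y" by (simp add: m_assoc)
  then have "y' = y" using * by simp
  ultimately show ?thesis by simp
qed

lemma card_direct:
  assumes M: "M \<lhd> G" and N: "N \<lhd> G" and I: "M \<inter> N = {\<one>}"
  shows "card (M <#> N) = card M * card N"
proof -
  have "bij_betw (\<lambda>(x, y). x \<otimes> y) (M \<times> N) (M <#> N)"
  proof (rule bij_betw_imageI)
    show "inj_on (\<lambda>(x, y). x \<otimes> y) (M \<times> N)"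
    proof (rule inj_onI)
      fix p q assume "p \<in> M \<times> N" "q \<in> M \<times> N" "(case p of (x, y) \<Rightarrow> x \<otimes> y) = (case q of (x, y) \<Rightarrow> x \<otimes> y)"
      then show "p = q"
        using direct_unique[OF M N I, of "fst p" "fst q" "snd p" "snd q"] by (simp add: case_prod_beta prod_eq_iff mem_Times_iff)
    qed
    show "(\<lambda>(x, y). x \<otimes> y) ` (M \<times> N) = M <#> N" by (auto simp: set_mult_def)
  qed
  from bij_betw_same_card[OF this] show ?thesis by (simp add: card_cartesian_product)
qed

lemma minimal_normal_Int:
  assumes M: "minimal_normal M G" and N: "N \<lhd> G" and n: "\<not> M \<subseteq> N"
  shows "M \<inter> N = {\<one>}"
proof -
  have "M \<inter> N \<lhd> G" using M N normal_subgroup_intersect by (auto simp: minimal_normal_def)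
  then have "M \<inter> N = {\<one>} \<or> M \<inter> N = M" using M by (auto simp: minimal_normal_def)
  then show ?thesis using n by auto
qed

lemma minimal_normal_exists:
  assumes N: "N \<lhd> G" and f: "finite N" and n: "N \<noteq> {\<one>}"
  shows "\<exists>M \<subseteq> N. minimal_normal M G"
  using assms
proof (induction "card N" arbitrary: N rule: less_induct)
  case less
  show ?case
  proof (cases "minimal_normal N G")
    case False
    then obtain K where K: "K \<lhd> G" "K \<subseteq> N" "K \<noteq> {\<one>}" "K \<noteq> N"
      using less.prems by (auto simp: minimal_normal_def)
    have "card K < card N" using K less.prems by (intro psubset_card_mono) auto
    then obtain M where "M \<subseteq> K" "minimal_normal M G"
      using less.hyps[of K] K finite_subset[OF K(2) less.prems(2)] by blast
    then show ?thesis using K by blast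
  qed auto
qed

end

section \<open>Equivariant homomorphisms and complements\<close>

text \<open>Homomorphisms commuting with conjugation by \<open>G\<close>. They are required to be extensional so that
  they can be counted.\<close>
definition conj_hom :: "('a, 'b) monoid_scheme \<Rightarrow> 'a set \<Rightarrow> 'a set \<Rightarrow> ('a \<Rightarrow> 'a) set" where
  "conj_hom G S T = {f \<in> PiE S (\<lambda>_. T). (\<forall>x\<in>S. \<forall>y\<in>S. f (x \<otimes>\<^bsub>G\<^esub> y) = f x \<otimes>\<^bsub>G\<^esub> f y) \<and>
     (\<forall>g\<in>carrier G. \<forall>x\<in>S. f (g \<otimes>\<^bsub>G\<^esub> x \<otimes>\<^bsub>G\<^esub> inv\<^bsub>G\<^esub> g) = g \<otimes>\<^bsub>G\<^esub> f x \<otimes>\<^bsub>G\<^esub> inv\<^bsub>G\<^esub> g)}"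

context group
begin

lemma conj_homD:
  assumes "f \<in> conj_hom G S T"
  shows "\<And>x. x \<in> S \<Longrightarrow> f x \<in> T" "\<And>x y. x \<in> S \<Longrightarrow> y \<in> S \<Longrightarrow> f (x \<otimes> y) = f x \<otimes> f y"
    "\<And>g x. g \<in> carrier G \<Longrightarrow> x \<in> S \<Longrightarrow> f (g \<otimes> x \<otimes> inv g) = g \<otimes> f x \<otimes> inv g"
    "f \<in> extensional S"
  using assms by (auto simp: conj_hom_def PiE_def)

lemma conj_homI:
  assumes "S \<lhd> G" "\<And>x. x \<in> S \<Longrightarrow> f x \<in> T" "\<And>x y. x \<in> S \<Longrightarrow> y \<in> S \<Longrightarrow> f (x \<otimes> y) = f x \<otimes> f y"
    "\<And>g x. g \<in> carrier G \<Longrightarrow> x \<in> S \<Longrightarrow> f (g \<otimes> x \<otimes> inv g) = g \<otimes> f x \<otimes> inv g"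
  shows "restrict f S \<in> conj_hom G S T"
  using assms(2-) normalD[OF assms(1)] by (auto simp: conj_hom_def)

lemma conj_hom_one:
  assumes f: "f \<in> conj_hom G S T" and S: "S \<lhd> G" and T: "T \<lhd> G"
  shows "f \<one> = \<one>"
proof -
  have "f \<one> = f \<one> \<otimes> f \<one>" using conj_homD(2)[OF f, of \<one> \<one>] normalD[OF S] by simp
  moreover have "f \<one> \<in> carrier G" using conj_homD(1)[OF f] normalD[OF S] normalD[OF T] by auto
  ultimately show ?thesis by (metis l_cancel_one)
qed

lemma conj_hom_inv:
  assumes f: "f \<in> conj_hom G S T" and S: "S \<lhd> G" and T: "T \<lhd> G" and x: "x \<in> S"
  shows "f (inv x) = inv (f x)"
proof -
  have c: "x \<in> carrier G" "f x \<in> carrier G" "f (inv x) \<in> carrier G"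
    using x conj_homD(1)[OF f] normalD[OF S] normalD[OF T] by auto
  have "f (inv x) \<otimes> f x = \<one>"
    using conj_homD(2)[OF f, of "inv x" x] normalD[OF S] x c conj_hom_one[OF f S T] by simp
  then show ?thesis using c by (metis inv_equality)
qed

text \<open>The graph \<open>{x f(x) | x \<in> S}\<close> is a subgroup because \<open>S\<close> and \<open>T\<close> commute elementwise, and it is
  normal because \<open>f\<close> is equivariant.\<close>
lemma graph_conj_hom:
  assumes S: "S \<lhd> G" and T: "T \<lhd> G" and I: "S \<inter> T = {\<one>}" and f: "f \<in> conj_hom G S T"
  defines "H \<equiv> (\<lambda>x. x \<otimes> f x) ` S"
  shows "H \<lhd> G" "H \<subseteq> S <#> T" "H \<inter> T = {\<one>}" "S \<subseteq> H <#> T"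
proof -
  note fD = conj_homD[OF f] and SD = normalD[OF S] and TD = normalD[OF T]
  note comm = normal_commute[OF S T I]
  have H1: "\<one> \<in> H"
    unfolding H_def using SD(2) conj_hom_one[OF f S T] by (intro image_eqI[of _ _ \<one>]) simp_all
  show HST: "H \<subseteq> S <#> T" using fD(1) by (auto simp: H_def intro: set_multI)
  have fc: "f x \<in> carrier G" "x \<in> carrier G" if "x \<in> S" for x using that fD(1) SD(3) TD(3) by auto
  show "H \<inter> T = {\<one>}"
  proof
    show "H \<inter> T \<subseteq> {\<one>}"
    proof
      fix h assume h: "h \<in> H \<inter> T"
      then obtain x where x: "x \<in> S" "h = x \<otimes> f x" by (auto simp: H_def)
      have e: "x \<otimes> f x = \<one> \<otimes> h" using x h fc by simp
      have "x = \<one>" using direct_unique[OF S T I x(1) SD(2) fD(1)[OF x(1)] _ e] h by blast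
      then show "h \<in> {\<one>}" using x conj_hom_one[OF f S T] by simp
    qed
    show "{\<one>} \<subseteq> H \<inter> T" using H1 TD(2) by simp
  qed
  show "S \<subseteq> H <#> T"
  proof
    fix x assume x: "x \<in> S"
    then have e: "(x \<otimes> f x) \<otimes> inv (f x) = x" using fc by (simp add: m_assoc)
    have "x \<otimes> f x \<in> H" "inv (f x) \<in> T" using x fD(1) TD(5) by (auto simp: H_def)
    then show "x \<in> H <#> T" using set_multI[of "x \<otimes> f x" H "inv (f x)" T] unfolding e by simp
  qed
  show "H \<lhd> G"
    unfolding normal_inv_iff
  proof (intro conjI ballI)
    show "subgroup H G"
    proof
      show "H \<subseteq> carrier G" using fc by (auto simp: H_def)
      show "\<one> \<in> H" by (rule H1)
      fix h k assume "h \<in> H" "k \<in> H"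
      then obtain x y where x: "x \<in> S" "h = x \<otimes> f x" and y: "y \<in> S" "k = y \<otimes> f y"
        by (auto simp: H_def)
      have "h \<otimes> k = x \<otimes> (f x \<otimes> y) \<otimes> f y" using x y fc by (simp add: m_assoc)
      also have "\<dots> = x \<otimes> (y \<otimes> f x) \<otimes> f y" using comm[of y "f x"] x y fD(1) by simp
      also have "\<dots> = (x \<otimes> y) \<otimes> f (x \<otimes> y)" using x y fc fD(2) by (simp add: m_assoc)
      finally show "h \<otimes> k \<in> H" using x y SD by (auto simp: H_def)
    next
      fix h assume "h \<in> H"
      then obtain x where x: "x \<in> S" "h = x \<otimes> f x" by (auto simp: H_def)
      have "inv h = inv (f x \<otimes> x)" using comm[of x "f x"] x fD(1) by simp
      also have "\<dots> = inv x \<otimes> f (inv x)" using x fc conj_hom_inv[OF f S T] by (simp add: inv_mult_group)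
      finally show "inv h \<in> H" using x SD by (auto simp: H_def)
    qed
    fix g h assume g: "g \<in> carrier G" and "h \<in> H"
    then obtain x where x: "x \<in> S" "h = x \<otimes> f x" by (auto simp: H_def)
    have "g \<otimes> h \<otimes> inv g = (g \<otimes> x \<otimes> inv g) \<otimes> (g \<otimes> f x \<otimes> inv g)"
      using g x fc by (simp add: m_assoc inv_cancel)
    also have "\<dots> = (g \<otimes> x \<otimes> inv g) \<otimes> f (g \<otimes> x \<otimes> inv g)" using fD(3) g x by simp
    finally show "g \<otimes> h \<otimes> inv g \<in> H" using SD g x by (auto simp: H_def)
  qed
qed

text \<open>Each \<open>x \<in> S\<close> has exactly one \<open>f(x) \<in> T\<close> with \<open>x f(x) \<in> H\<close>: existence is \<open>S \<subseteq> HT\<close>, uniqueness is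
  \<open>H \<inter> T = 1\<close>. Uniqueness also makes \<open>f\<close> an equivariant homomorphism.\<close>
lemma complement_is_graph:
  assumes S: "S \<lhd> G" and T: "T \<lhd> G" and I: "S \<inter> T = {\<one>}"
    and H: "H \<lhd> G" and HST: "H \<subseteq> S <#> T" and HT: "H \<inter> T = {\<one>}" and SH: "S \<subseteq> H <#> T"
  shows "\<exists>f \<in> conj_hom G S T. H = (\<lambda>x. x \<otimes> f x) ` S"
proof -
  note SD = normalD[OF S] and TD = normalD[OF T] and HD = normalD[OF H]
  note comm = normal_commute[OF S T I]
  have ex: "\<exists>y\<in>T. x \<otimes> y \<in> H" if x: "x \<in> S" for x
  proof -
    obtain h y where hy: "h \<in> H" "y \<in> T" "x = h \<otimes> y" using x SH by (meson set_multE subsetD)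
    then have "x \<otimes> inv y = h" using HD TD by (simp add: m_assoc)
    then show ?thesis using hy TD(5)[OF hy(2)] by (intro bexI[of _ "inv y"]) simp_all
  qed
  have uniq: "y = y'" if x: "x \<in> S" and y: "y \<in> T" "x \<otimes> y \<in> H" and y': "y' \<in> T" "x \<otimes> y' \<in> H" for x y y'
  proof -
    have "(x \<otimes> y) \<otimes> (inv y \<otimes> y') = (x \<otimes> y') \<otimes> \<one>"
      using x y y' SD TD by (simp add: m_assoc inv_cancel)
    then have "inv y \<otimes> y' = \<one>"
      using direct_unique[OF H T HT, of "x \<otimes> y" "x \<otimes> y'" "inv y \<otimes> y'" \<one>] y y' TD by simp
    moreover have "y \<otimes> (inv y \<otimes> y') = y'" using y y' TD by (simp add: inv_cancel)
    ultimately show ?thesis using y TD(3)[OF y(1)] by simp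
  qed
  define F where "F x = (SOME y. y \<in> T \<and> x \<otimes> y \<in> H)" for x
  have F: "F x \<in> T" "x \<otimes> F x \<in> H" if "x \<in> S" for x
    using someI_ex[of "\<lambda>y. y \<in> T \<and> x \<otimes> y \<in> H"] ex[OF that] unfolding F_def by auto
  have Fc: "F x \<in> carrier G" "x \<in> carrier G" if "x \<in> S" for x using F[OF that] TD SD that by auto
  have "restrict F S \<in> conj_hom G S T"
  proof (rule conj_homI[OF S F(1)])
    fix x y assume x: "x \<in> S" and y: "y \<in> S"
    have "(x \<otimes> y) \<otimes> (F x \<otimes> F y) = x \<otimes> (y \<otimes> F x) \<otimes> F y" using x y Fc by (simp add: m_assoc)
    also have "\<dots> = x \<otimes> (F x \<otimes> y) \<otimes> F y" using comm[of y "F x"] x y F by simp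
    also have "\<dots> = (x \<otimes> F x) \<otimes> (y \<otimes> F y)" using x y Fc by (simp add: m_assoc)
    finally have "(x \<otimes> y) \<otimes> (F x \<otimes> F y) \<in> H" using F x y HD by simp
    then show "F (x \<otimes> y) = F x \<otimes> F y"
      using uniq[of "x \<otimes> y" "F (x \<otimes> y)" "F x \<otimes> F y"] x y F SD(4) TD(4) by simp
  next
    fix g x assume g: "g \<in> carrier G" and x: "x \<in> S"
    have "(g \<otimes> x \<otimes> inv g) \<otimes> (g \<otimes> F x \<otimes> inv g) = g \<otimes> (x \<otimes> F x) \<otimes> inv g"
      using g x Fc by (simp add: m_assoc inv_cancel)
    then have "(g \<otimes> x \<otimes> inv g) \<otimes> (g \<otimes> F x \<otimes> inv g) \<in> H" using F x g HD by simp
    then show "F (g \<otimes> x \<otimes> inv g) = g \<otimes> F x \<otimes> inv g"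
      using uniq[of "g \<otimes> x \<otimes> inv g" "F (g \<otimes> x \<otimes> inv g)" "g \<otimes> F x \<otimes> inv g"] x g F SD(6) TD(6) by simp
  qed simp
  moreover have "H = (\<lambda>x. x \<otimes> restrict F S x) ` S"
  proof
    show "(\<lambda>x. x \<otimes> restrict F S x) ` S \<subseteq> H" using F by auto
    show "H \<subseteq> (\<lambda>x. x \<otimes> restrict F S x) ` S"
    proof
      fix h assume h: "h \<in> H"
      then obtain x y where xy: "x \<in> S" "y \<in> T" "h = x \<otimes> y" using HST by (meson set_multE subsetD)
      then have "y = F x" using uniq[of x y "F x"] F h by auto
      then show "h \<in> (\<lambda>x. x \<otimes> restrict F S x) ` S" using xy by auto
    qed
  qed
  ultimately show ?thesis by blast
qed

text \<open>The normal complements of \<open>T\<close> in \<open>ST\<close>; given the other conditions, \<open>S \<subseteq> HT\<close> amounts to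
  \<open>HT = ST\<close>.\<close>
definition complements :: "'a set \<Rightarrow> 'a set \<Rightarrow> 'a set set" where
  "complements S T = {H. H \<lhd> G \<and> H \<subseteq> S <#> T \<and> H \<inter> T = {\<one>} \<and> S \<subseteq> H <#> T}"

lemma card_complements:
  assumes S: "S \<lhd> G" and T: "T \<lhd> G" and I: "S \<inter> T = {\<one>}"
  shows "card (complements S T) = card (conj_hom G S T)"
proof -
  have "bij_betw (\<lambda>f. (\<lambda>x. x \<otimes> f x) ` S) (conj_hom G S T) (complements S T)"
    unfolding bij_betw_def
  proof
    show "inj_on (\<lambda>f. (\<lambda>x. x \<otimes> f x) ` S) (conj_hom G S T)"
    proof (rule inj_onI)
      fix f f' assume f: "f \<in> conj_hom G S T" and f': "f' \<in> conj_hom G S T"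
        and e: "(\<lambda>x. x \<otimes> f x) ` S = (\<lambda>x. x \<otimes> f' x) ` S"
      show "f = f'"
      proof (rule extensionalityI[OF conj_homD(4)[OF f] conj_homD(4)[OF f']])
        fix x assume x: "x \<in> S"
        then obtain x' where x': "x' \<in> S" "x \<otimes> f x = x' \<otimes> f' x'" using e by blast
        then have "x = x' \<and> f x = f' x'"
          using direct_unique[OF S T I, of x x' "f x" "f' x'"] conj_homD(1)[OF f] conj_homD(1)[OF f'] x by blast
        then show "f x = f' x" by auto
      qed
    qed
    show "(\<lambda>f. (\<lambda>x. x \<otimes> f x) ` S) ` conj_hom G S T = complements S T"
    proof
      show "(\<lambda>f. (\<lambda>x. x \<otimes> f x) ` S) ` conj_hom G S T \<subseteq> complements S T"
        unfolding complements_def using graph_conj_hom[OF S T I] by blast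
      show "complements S T \<subseteq> (\<lambda>f. (\<lambda>x. x \<otimes> f x) ` S) ` conj_hom G S T"
      proof
        fix H assume "H \<in> complements S T"
        then obtain f where "f \<in> conj_hom G S T" "H = (\<lambda>x. x \<otimes> f x) ` S"
          using complement_is_graph[OF S T I, of H] unfolding complements_def by blast
        then show "H \<in> (\<lambda>f. (\<lambda>x. x \<otimes> f x) ` S) ` conj_hom G S T" by blast
      qed
    qed
  qed
  then show ?thesis by (rule bij_betw_same_card[symmetric])
qed

text \<open>Complements of \<open>B\<close> in \<open>M \<times> B\<close> are isomorphic to \<open>M\<close> as groups with an action of \<open>G\<close>, hence minimal. For
  the converse, if \<open>N \<subseteq> MB\<close> and \<open>M \<inter> NB = 1\<close>, then \<open>N \<subseteq> B\<close> by comparing components; so \<open>N\<close> not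
  inside \<open>B\<close> forces \<open>M \<subseteq> NB\<close> by minimality of \<open>M\<close>.\<close>
lemma complements_minimal:
  assumes M: "minimal_normal M G" and B: "B \<lhd> G" and I: "M \<inter> B = {\<one>}"
  shows "complements M B = {N. minimal_normal N G \<and> N \<subseteq> M <#> B \<and> \<not> N \<subseteq> B}"
proof -
  have Mn: "M \<lhd> G" and M1: "M \<noteq> {\<one>}" using M by (auto simp: minimal_normal_def)
  note MD = normalD[OF Mn] and BD = normalD[OF B]
  \<comment> \<open>a normal subgroup inside \<open>MB\<close> but not inside \<open>B\<close> covers \<open>M\<close> modulo \<open>B\<close>\<close>
  have key: "M \<subseteq> N <#> B" if N: "N \<lhd> G" "N \<subseteq> M <#> B" "\<not> N \<subseteq> B" for N
  proof (rule ccontr)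
    assume "\<not> M \<subseteq> N <#> B"
    then have MI: "M \<inter> (N <#> B) = {\<one>}" using minimal_normal_Int[OF M normal_set_mult[OF N(1) B]] by simp
    have "n \<in> B" if n: "n \<in> N" for n
    proof -
      obtain m b where mb: "m \<in> M" "b \<in> B" "n = m \<otimes> b" using n N(2) by (meson set_multE subsetD)
      then have "m = n \<otimes> inv b" using MD BD by (simp add: m_assoc)
      then have "m \<in> N <#> B" using set_multI[of n N "inv b" B] n mb BD by simp
      then have "m = \<one>" using MI mb by blast
      then show "n \<in> B" using mb BD by simp
    qed
    then show False using N(3) by auto
  qed
  show ?thesis
  proof (intro equalityI subsetI)
    fix H assume "H \<in> complements M B"
    then have H: "H \<lhd> G" "H \<subseteq> M <#> B" "H \<inter> B = {\<one>}" "M \<subseteq> H <#> B" by (auto simp: complements_def)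
    note HD = normalD[OF H(1)]
    have H1: "\<not> H \<subseteq> B"
    proof
      assume "H \<subseteq> B"
      then have "H <#> B \<subseteq> B" using set_mult_least[OF B] by auto
      then show False using H(4) I M1 MD(2) by auto
    qed
    have "K = {\<one>} \<or> K = H" if K: "K \<lhd> G" "K \<subseteq> H" for K
    proof (cases "K \<subseteq> B")
      case True
      then show ?thesis using K H(3) normalD(2)[OF K(1)] by auto
    next
      case False
      then have MK: "M \<subseteq> K <#> B" using key[of K] K H by auto
      have "H \<subseteq> K"
      proof
        fix h assume h: "h \<in> H"
        have "h \<in> K <#> B"
          using h H(2) set_mult_least[OF normal_set_mult[OF K(1) B] MK subset_set_mult(2)[OF K(1) B]] by auto
        then obtain k b where kb: "k \<in> K" "b \<in> B" "h = k \<otimes> b" by (meson set_multE subsetD)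
        have "inv k \<otimes> h = b" using kb HD K BD by (auto simp: inv_cancel)
        moreover have "inv k \<otimes> h \<in> H" using h kb K HD by auto
        ultimately have "b = \<one>" using kb H(3) by auto
        then show "h \<in> K" using kb K HD by auto
      qed
      then show ?thesis using K by auto
    qed
    moreover have "H \<noteq> {\<one>}" using H1 BD by auto
    ultimately show "H \<in> {N. minimal_normal N G \<and> N \<subseteq> M <#> B \<and> \<not> N \<subseteq> B}"
      using H H1 by (auto simp: minimal_normal_def)
  next
    fix N assume "N \<in> {N. minimal_normal N G \<and> N \<subseteq> M <#> B \<and> \<not> N \<subseteq> B}"
    then have N: "minimal_normal N G" "N \<subseteq> M <#> B" "\<not> N \<subseteq> B" "N \<lhd> G" by (auto simp: minimal_normal_def)
    show "N \<in> complements M B"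
      using N key[of N] minimal_normal_Int[OF N(1) B N(3)] by (auto simp: complements_def)
  qed
qed

lemma conj_hom_comp:
  assumes S: "S \<lhd> G" and f: "f \<in> conj_hom G S T" and p: "p \<in> conj_hom G T U"
  shows "(\<lambda>x\<in>S. p (f x)) \<in> conj_hom G S U"
  by (rule conj_homI[OF S]) (simp_all add: conj_homD(1-3)[OF f] conj_homD(1-3)[OF p])

lemma conj_hom_mult:
  assumes S: "S \<lhd> G" and f: "f \<in> conj_hom G S T" and h: "h \<in> conj_hom G S U"
    and T: "T \<lhd> G" and U: "U \<lhd> G" and W: "W \<lhd> G" "T \<subseteq> W" "U \<subseteq> W"
    and c: "\<And>t u. t \<in> T \<Longrightarrow> u \<in> U \<Longrightarrow> t \<otimes> u = u \<otimes> t"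
  shows "(\<lambda>x\<in>S. f x \<otimes> h x) \<in> conj_hom G S W"
proof (rule conj_homI[OF S])
  note fT = conj_homD(1)[OF f] and hU = conj_homD(1)[OF h]
  have C: "f x \<in> carrier G" "h x \<in> carrier G" if "x \<in> S" for x
    using fT[OF that] hU[OF that] normalD(3)[OF T] normalD(3)[OF U] by auto
  show "f x \<otimes> h x \<in> W" if "x \<in> S" for x
    using fT[OF that] hU[OF that] normalD(4)[OF W(1)] W(2,3) by blast
  show "f (x \<otimes> y) \<otimes> h (x \<otimes> y) = f x \<otimes> h x \<otimes> (f y \<otimes> h y)" if x: "x \<in> S" and y: "y \<in> S" for x y
  proof -
    have "f (x \<otimes> y) \<otimes> h (x \<otimes> y) = f x \<otimes> (f y \<otimes> h x) \<otimes> h y"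
      using C[OF x] C[OF y] by (simp add: conj_homD(2)[OF f x y] conj_homD(2)[OF h x y] m_assoc)
    also have "f y \<otimes> h x = h x \<otimes> f y" using c fT[OF y] hU[OF x] by blast
    finally show ?thesis using C[OF x] C[OF y] by (simp add: m_assoc)
  qed
  show "f (g \<otimes> x \<otimes> inv g) \<otimes> h (g \<otimes> x \<otimes> inv g) = g \<otimes> (f x \<otimes> h x) \<otimes> inv g"
    if g: "g \<in> carrier G" and x: "x \<in> S" for g x
    unfolding conj_homD(3)[OF f g x] conj_homD(3)[OF h g x]
    using C[OF x] g by (simp add: m_assoc inv_cancel)
qed

lemma conj_hom_restrict:
  assumes S: "S \<lhd> G" and f: "f \<in> conj_hom G T U" and s: "S \<subseteq> T"
  shows "restrict f S \<in> conj_hom G S U"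
  using s by (intro conj_homI[OF S]) (auto simp: conj_homD(1-3)[OF f] subsetD)

lemma direct_projection:
  assumes B: "B \<lhd> G" and C: "C \<lhd> G" and I: "B \<inter> C = {\<one>}"
  obtains p where "p \<in> conj_hom G (B <#> C) B" "\<And>b c. b \<in> B \<Longrightarrow> c \<in> C \<Longrightarrow> p (b \<otimes> c) = b"
proof -
  define P where "P x = (THE b. b \<in> B \<and> (\<exists>c\<in>C. x = b \<otimes> c))" for x
  have P: "P (b \<otimes> c) = b" if bc: "b \<in> B" "c \<in> C" for b c
    unfolding P_def using direct_unique[OF B C I] bc by (intro the_equality) blast+
  have mult: "(b \<otimes> c) \<otimes> (b' \<otimes> c') = (b \<otimes> b') \<otimes> (c \<otimes> c')"
    if "b \<in> B" "c \<in> C" "b' \<in> B" "c' \<in> C" for b c b' c'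
  proof -
    have "b \<in> carrier G" "c \<in> carrier G" "b' \<in> carrier G" "c' \<in> carrier G"
      using that normalD(3)[OF B] normalD(3)[OF C] by auto
    moreover have "b' \<otimes> c = c \<otimes> b'" by (rule normal_commute[OF B C I that(3) that(2)])
    ultimately show ?thesis by (metis m_assoc m_closed)
  qed
  have conj: "g \<otimes> (b \<otimes> c) \<otimes> inv g = (g \<otimes> b \<otimes> inv g) \<otimes> (g \<otimes> c \<otimes> inv g)"
    if "g \<in> carrier G" "b \<in> B" "c \<in> C" for g b c
    using that(1) normalD(3)[OF B that(2)] normalD(3)[OF C that(3)] by (simp add: m_assoc inv_cancel)
  have "restrict P (B <#> C) \<in> conj_hom G (B <#> C) B"
  proof (rule conj_homI[OF normal_set_mult[OF B C]])
    fix x y assume "x \<in> B <#> C" "y \<in> B <#> C"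
    then obtain b c b' c' where "b \<in> B" "c \<in> C" "x = b \<otimes> c" "b' \<in> B" "c' \<in> C" "y = b' \<otimes> c'"
      by (meson set_multE)
    then show "P (x \<otimes> y) = P x \<otimes> P y"
      by (simp add: mult P normalD(4)[OF B] normalD(4)[OF C])
  next
    fix g x assume "x \<in> B <#> C" and g: "g \<in> carrier G"
    then obtain b c where bc: "b \<in> B" "c \<in> C" "x = b \<otimes> c" by (meson set_multE)
    show "P (g \<otimes> x \<otimes> inv g) = g \<otimes> P x \<otimes> inv g"
      unfolding bc(3) conj[OF g bc(1,2)] P[OF bc(1,2)]
      by (rule P[OF normalD(6)[OF B g bc(1)] normalD(6)[OF C g bc(2)]])
  qed (auto simp: P elim!: set_multE)
  then show thesis by (rule that) (simp add: P set_multI)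
qed

lemma direct_projections:
  assumes B: "B \<lhd> G" and C: "C \<lhd> G" and I: "B \<inter> C = {\<one>}"
  obtains p q where "p \<in> conj_hom G (B <#> C) B" "q \<in> conj_hom G (B <#> C) C"
    "\<And>x. x \<in> B <#> C \<Longrightarrow> p x \<otimes> q x = x"
    "\<And>b c. b \<in> B \<Longrightarrow> c \<in> C \<Longrightarrow> p (b \<otimes> c) = b" "\<And>b c. b \<in> B \<Longrightarrow> c \<in> C \<Longrightarrow> q (b \<otimes> c) = c"
proof -
  obtain p where p: "p \<in> conj_hom G (B <#> C) B" "\<And>b c. b \<in> B \<Longrightarrow> c \<in> C \<Longrightarrow> p (b \<otimes> c) = b"
    using direct_projection[OF B C I] by blast
  have "C \<inter> B = {\<one>}" using I by blast
  then obtain q where q: "q \<in> conj_hom G (C <#> B) C" "\<And>c b. c \<in> C \<Longrightarrow> b \<in> B \<Longrightarrow> q (c \<otimes> b) = c"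
    using direct_projection[OF C B] by blast
  have "C <#> B = B <#> C" by (rule commut_normal[OF normal_imp_subgroup[OF C] B])
  then have q1: "q \<in> conj_hom G (B <#> C) C" using q(1) by simp
  have q2: "q (b \<otimes> c) = c" if "b \<in> B" "c \<in> C" for b c
    unfolding normal_commute[OF B C I that] by (rule q(2)[OF that(2,1)])
  have "p x \<otimes> q x = x" if "x \<in> B <#> C" for x
    using that by (rule set_multE) (simp add: p(2) q2)
  then show thesis by (rule that[OF p(1) q1 _ p(2) q2])
qed

text \<open>A homomorphism into a direct product is the pair of its components.\<close>
lemma card_conj_hom_target:
  assumes S: "S \<lhd> G" and B: "B \<lhd> G" and C: "C \<lhd> G" and I: "B \<inter> C = {\<one>}"
  shows "card (conj_hom G S (B <#> C)) = card (conj_hom G S B) * card (conj_hom G S C)"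
proof -
  obtain p q where p: "p \<in> conj_hom G (B <#> C) B" and q: "q \<in> conj_hom G (B <#> C) C"
    and pq: "\<And>x. x \<in> B <#> C \<Longrightarrow> p x \<otimes> q x = x"
    and p1: "\<And>b c. b \<in> B \<Longrightarrow> c \<in> C \<Longrightarrow> p (b \<otimes> c) = b"
    and q1: "\<And>b c. b \<in> B \<Longrightarrow> c \<in> C \<Longrightarrow> q (b \<otimes> c) = c"
    using direct_projections[OF B C I] by blast
  have "bij_betw (\<lambda>(f, h). \<lambda>x\<in>S. f x \<otimes> h x) (conj_hom G S B \<times> conj_hom G S C) (conj_hom G S (B <#> C))"
  proof (rule bij_betw_byWitness[where f' = "\<lambda>f. (\<lambda>x\<in>S. p (f x), \<lambda>x\<in>S. q (f x))"])
    show "\<forall>a\<in>conj_hom G S B \<times> conj_hom G S C.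
       (\<lambda>f. (\<lambda>x\<in>S. p (f x), \<lambda>x\<in>S. q (f x))) ((\<lambda>(f, h). \<lambda>x\<in>S. f x \<otimes> h x) a) = a"
    proof
      fix a assume "a \<in> conj_hom G S B \<times> conj_hom G S C"
      then obtain f h where a: "a = (f, h)" and f: "f \<in> conj_hom G S B" and h: "h \<in> conj_hom G S C" by blast
      have e1: "(\<lambda>x\<in>S. p ((\<lambda>x\<in>S. f x \<otimes> h x) x)) = f"
        by (rule extensionalityI[OF restrict_extensional conj_homD(4)[OF f]])
          (simp add: p1 conj_homD(1)[OF f] conj_homD(1)[OF h])
      have e2: "(\<lambda>x\<in>S. q ((\<lambda>x\<in>S. f x \<otimes> h x) x)) = h"
        by (rule extensionalityI[OF restrict_extensional conj_homD(4)[OF h]])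
          (simp add: q1 conj_homD(1)[OF f] conj_homD(1)[OF h])
      show "(\<lambda>f. (\<lambda>x\<in>S. p (f x), \<lambda>x\<in>S. q (f x))) ((\<lambda>(f, h). \<lambda>x\<in>S. f x \<otimes> h x) a) = a"
        by (simp only: a prod.case e1 e2)
    qed
    show "\<forall>f\<in>conj_hom G S (B <#> C). (\<lambda>(f, h). \<lambda>x\<in>S. f x \<otimes> h x) (\<lambda>x\<in>S. p (f x), \<lambda>x\<in>S. q (f x)) = f"
    proof
      fix f assume f: "f \<in> conj_hom G S (B <#> C)"
      have "(\<lambda>x\<in>S. (\<lambda>x\<in>S. p (f x)) x \<otimes> (\<lambda>x\<in>S. q (f x)) x) = f"
        by (rule extensionalityI[OF restrict_extensional conj_homD(4)[OF f]])
          (simp add: pq conj_homD(1)[OF f])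
      then show "(\<lambda>(f, h). \<lambda>x\<in>S. f x \<otimes> h x) (\<lambda>x\<in>S. p (f x), \<lambda>x\<in>S. q (f x)) = f"
        by (simp only: prod.case)
    qed
    show "(\<lambda>(f, h). \<lambda>x\<in>S. f x \<otimes> h x) ` (conj_hom G S B \<times> conj_hom G S C) \<subseteq> conj_hom G S (B <#> C)"
      using conj_hom_mult[OF S _ _ B C normal_set_mult[OF B C] subset_set_mult[OF B C]] normal_commute[OF B C I]
      by auto
    show "(\<lambda>f. (\<lambda>x\<in>S. p (f x), \<lambda>x\<in>S. q (f x))) ` conj_hom G S (B <#> C) \<subseteq> conj_hom G S B \<times> conj_hom G S C"
      using conj_hom_comp[OF S _ p] conj_hom_comp[OF S _ q] by blast
  qed
  from bij_betw_same_card[OF this] show ?thesis by (simp add: card_cartesian_product)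
qed

text \<open>A homomorphism on a direct product is given by its restrictions to the factors, and any two
  homomorphisms on the factors combine because their values commute in the abelian group \<open>M\<close>.\<close>
lemma card_conj_hom_source:
  assumes B: "B \<lhd> G" and C: "C \<lhd> G" and I: "B \<inter> C = {\<one>}"
    and M: "M \<lhd> G" and ab: "\<And>x y. x \<in> M \<Longrightarrow> y \<in> M \<Longrightarrow> x \<otimes> y = y \<otimes> x"
  shows "card (conj_hom G (B <#> C) M) = card (conj_hom G B M) * card (conj_hom G C M)"
proof -
  obtain p q where p: "p \<in> conj_hom G (B <#> C) B" and q: "q \<in> conj_hom G (B <#> C) C"
    and pq: "\<And>x. x \<in> B <#> C \<Longrightarrow> p x \<otimes> q x = x"
    and p1: "\<And>b c. b \<in> B \<Longrightarrow> c \<in> C \<Longrightarrow> p (b \<otimes> c) = b"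
    and q1: "\<And>b c. b \<in> B \<Longrightarrow> c \<in> C \<Longrightarrow> q (b \<otimes> c) = c"
    using direct_projections[OF B C I] by blast
  note BC = normal_set_mult[OF B C]
  let ?S = "B <#> C"
  have sub: "b \<in> ?S" if "b \<in> B" for b using subset_set_mult(1)[OF B C] that by auto
  have sub': "c \<in> ?S" if "c \<in> C" for c using subset_set_mult(2)[OF B C] that by auto
  have "bij_betw (\<lambda>(f, h). \<lambda>x\<in>?S. (\<lambda>x\<in>?S. f (p x)) x \<otimes> (\<lambda>x\<in>?S. h (q x)) x)
    (conj_hom G B M \<times> conj_hom G C M) (conj_hom G ?S M)"
  proof (rule bij_betw_byWitness[where f' = "\<lambda>f. (restrict f B, restrict f C)"])
    show "\<forall>a\<in>conj_hom G B M \<times> conj_hom G C M. (\<lambda>f. (restrict f B, restrict f C))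
       ((\<lambda>(f, h). \<lambda>x\<in>?S. (\<lambda>x\<in>?S. f (p x)) x \<otimes> (\<lambda>x\<in>?S. h (q x)) x) a) = a"
    proof
      fix a assume "a \<in> conj_hom G B M \<times> conj_hom G C M"
      then obtain f h where a: "a = (f, h)" and f: "f \<in> conj_hom G B M" and h: "h \<in> conj_hom G C M" by blast
      have one: "f \<one> = \<one>" "h \<one> = \<one>" using conj_hom_one[OF f B M] conj_hom_one[OF h C M] by auto
      have fc: "f b \<in> carrier G" if "b \<in> B" for b using conj_homD(1)[OF f that] normalD(3)[OF M] by simp
      have hc: "h b \<in> carrier G" if "b \<in> C" for b using conj_homD(1)[OF h that] normalD(3)[OF M] by simp
      have b: "p b = b" "q b = \<one>" if "b \<in> B" for b
        using p1[OF that normalD(2)[OF C]] q1[OF that normalD(2)[OF C]] normalD(3)[OF B that] by auto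
      have c: "p c = \<one>" "q c = c" if "c \<in> C" for c
        using p1[OF normalD(2)[OF B] that] q1[OF normalD(2)[OF B] that] normalD(3)[OF C that] by auto
      let ?k = "\<lambda>x\<in>?S. (\<lambda>x\<in>?S. f (p x)) x \<otimes> (\<lambda>x\<in>?S. h (q x)) x"
      have e1: "restrict ?k B = f"
        by (rule extensionalityI[OF restrict_extensional conj_homD(4)[OF f]])
          (simp add: sub b one fc)
      have e2: "restrict ?k C = h"
        by (rule extensionalityI[OF restrict_extensional conj_homD(4)[OF h]])
          (simp add: sub' c one hc)
      show "(\<lambda>f. (restrict f B, restrict f C))
        ((\<lambda>(f, h). \<lambda>x\<in>?S. (\<lambda>x\<in>?S. f (p x)) x \<otimes> (\<lambda>x\<in>?S. h (q x)) x) a) = a"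
        by (simp only: a prod.case e1 e2)
    qed
    show "\<forall>f\<in>conj_hom G ?S M. (\<lambda>(f, h). \<lambda>x\<in>?S. (\<lambda>x\<in>?S. f (p x)) x \<otimes> (\<lambda>x\<in>?S. h (q x)) x)
       (restrict f B, restrict f C) = f"
    proof
      fix f assume f: "f \<in> conj_hom G ?S M"
      let ?k = "\<lambda>x\<in>?S. (\<lambda>x\<in>?S. restrict f B (p x)) x \<otimes> (\<lambda>x\<in>?S. restrict f C (q x)) x"
      have "?k = f"
      proof (rule extensionalityI[OF restrict_extensional conj_homD(4)[OF f]])
        fix x assume x: "x \<in> ?S"
        have "p x \<in> B" "q x \<in> C" using conj_homD(1)[OF p x] conj_homD(1)[OF q x] .
        then show "?k x = f x"
          using x conj_homD(2)[OF f sub sub', of "p x" "q x"] pq[OF x] by simp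
      qed
      then show "(\<lambda>(f, h). \<lambda>x\<in>?S. (\<lambda>x\<in>?S. f (p x)) x \<otimes> (\<lambda>x\<in>?S. h (q x)) x) (restrict f B, restrict f C) = f"
        by (simp only: prod.case)
    qed
    show "(\<lambda>(f, h). \<lambda>x\<in>?S. (\<lambda>x\<in>?S. f (p x)) x \<otimes> (\<lambda>x\<in>?S. h (q x)) x) ` (conj_hom G B M \<times> conj_hom G C M)
       \<subseteq> conj_hom G ?S M"
    proof clarify
      fix f h assume f: "f \<in> conj_hom G B M" and h: "h \<in> conj_hom G C M"
      show "(\<lambda>x\<in>?S. (\<lambda>x\<in>?S. f (p x)) x \<otimes> (\<lambda>x\<in>?S. h (q x)) x) \<in> conj_hom G ?S M"
        by (rule conj_hom_mult[OF BC conj_hom_comp[OF BC p f] conj_hom_comp[OF BC q h] M M M subset_refl subset_refl ab])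
    qed
    show "(\<lambda>f. (restrict f B, restrict f C)) ` conj_hom G ?S M \<subseteq> conj_hom G B M \<times> conj_hom G C M"
      using conj_hom_restrict[OF B _ subset_set_mult(1)[OF B C]] conj_hom_restrict[OF C _ subset_set_mult(2)[OF B C]]
      by blast
  qed
  from bij_betw_same_card[OF this] show ?thesis by (simp add: card_cartesian_product)
qed

text \<open>Both numbers count minimal normal subgroups inside \<open>MN\<close>: the complements of \<open>N\<close> are all of them
  except \<open>N\<close>, and the complements of \<open>M\<close> are all of them except \<open>M\<close>.\<close>
lemma card_conj_hom_minimal_sym:
  assumes M: "minimal_normal M G" and N: "minimal_normal N G" and I: "M \<inter> N = {\<one>}"
  shows "card (conj_hom G M N) = card (conj_hom G N M)"
proof -
  have n: "M \<lhd> G" "N \<lhd> G" using M N by (auto simp: minimal_normal_def)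
  let ?D = "{K. minimal_normal K G \<and> K \<subseteq> M <#> N}"
  have sub: "K = L" if "minimal_normal K G" "minimal_normal L G" "K \<subseteq> L" for K L
    using that unfolding minimal_normal_def by blast
  have comm: "M <#> N = N <#> M" by (rule commut_normal[OF normal_imp_subgroup[OF n(1)] n(2)])
  have "card (conj_hom G M N) = card (complements M N)" by (rule card_complements[OF n I, symmetric])
  also have "complements M N = ?D - {N}"
    unfolding complements_minimal[OF M n(2) I] using sub[OF _ N] by blast
  also have "card (?D - {N}) = card ?D - 1"
    using N subset_set_mult(2)[OF n] by (intro card_Diff_singleton) simp
  also have "card ?D - 1 = card (?D - {M})"
    using M subset_set_mult(1)[OF n] by (intro card_Diff_singleton[symmetric]) simp
  also have "?D - {M} = complements N M"
    unfolding complements_minimal[OF N n(1) I[unfolded Int_commute[of M]]] comm using sub[OF _ M] by blast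
  also have "card \<dots> = card (conj_hom G N M)" by (rule card_complements[OF n(2,1) I[unfolded Int_commute[of M]]])
  finally show ?thesis .
qed

end

section \<open>Direct products of abelian minimal normal subgroups\<close>

text \<open>Direct products of finitely many abelian minimal normal subgroups, built up one factor at a time; this
  is the form in which the socle enters all inductions below.\<close>
inductive direct_abelian :: "('a, 'b) monoid_scheme \<Rightarrow> 'a set \<Rightarrow> bool" for G where
  one: "direct_abelian G {\<one>\<^bsub>G\<^esub>}"
| step: "direct_abelian G B \<Longrightarrow> minimal_normal M G \<Longrightarrow>
    (\<And>x y. x \<in> M \<Longrightarrow> y \<in> M \<Longrightarrow> x \<otimes>\<^bsub>G\<^esub> y = y \<otimes>\<^bsub>G\<^esub> x) \<Longrightarrow> M \<inter> B = {\<one>\<^bsub>G\<^esub>} \<Longrightarrow>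
    direct_abelian G (M <#>\<^bsub>G\<^esub> B)"

context group
begin

lemma direct_abelian_normal: "direct_abelian G B \<Longrightarrow> B \<lhd> G"
  by (induction rule: direct_abelian.induct) (auto simp: one_is_normal normal_set_mult minimal_normal_def)

lemma direct_abelian_commute: "direct_abelian G B \<Longrightarrow> x \<in> B \<Longrightarrow> y \<in> B \<Longrightarrow> x \<otimes> y = y \<otimes> x"
proof (induction arbitrary: x y rule: direct_abelian.induct)
  case (step B M)
  have n: "M \<lhd> G" "B \<lhd> G" using step direct_abelian_normal by (auto simp: minimal_normal_def)
  obtain m b m' b' where mb: "m \<in> M" "b \<in> B" "x = m \<otimes> b" "m' \<in> M" "b' \<in> B" "y = m' \<otimes> b'"
    using step.prems by (meson set_multE)
  have c: "m \<in> carrier G" "b \<in> carrier G" "m' \<in> carrier G" "b' \<in> carrier G"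
    using mb normalD(3)[OF n(1)] normalD(3)[OF n(2)] by auto
  have e: "m \<otimes> m' = m' \<otimes> m" "b \<otimes> b' = b' \<otimes> b" "m' \<otimes> b = b \<otimes> m'" "m \<otimes> b' = b' \<otimes> m"
    using mb step.hyps step.IH normal_commute[OF n step.hyps(4)] by auto
  have "x \<otimes> y = m \<otimes> (b \<otimes> m') \<otimes> b'" using c mb by (simp add: m_assoc)
  also have "\<dots> = (m \<otimes> m') \<otimes> (b \<otimes> b')" using c by (simp add: m_assoc e(3)[symmetric])
  also have "\<dots> = m' \<otimes> (m \<otimes> b') \<otimes> b" unfolding e(1,2) using c by (simp add: m_assoc)
  also have "\<dots> = y \<otimes> x" unfolding e(4) using c mb by (simp add: m_assoc)
  finally show ?case .
qed simp

text \<open>Both numbers are multiplicative in \<open>B\<close>, which reduces the claim to two minimal normal subgroups.\<close>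
lemma card_conj_hom_sym:
  assumes "direct_abelian G B" and M: "minimal_normal M G"
    and ab: "\<And>x y. x \<in> M \<Longrightarrow> y \<in> M \<Longrightarrow> x \<otimes> y = y \<otimes> x" and I: "M \<inter> B = {\<one>}"
  shows "card (conj_hom G M B) = card (conj_hom G B M)"
  using assms(1) I
proof (induction rule: direct_abelian.induct)
  case one
  have Mn: "M \<lhd> G" using M by (simp add: minimal_normal_def)
  have "conj_hom G M {\<one>} = {\<lambda>x\<in>M. \<one>}"
    using normalD[OF Mn] by (auto simp: conj_hom_def PiE_def extensional_def fun_eq_iff)
  moreover have "conj_hom G {\<one>} M = {\<lambda>x\<in>{\<one>}. \<one>}"
  proof
    show "conj_hom G {\<one>} M \<subseteq> {\<lambda>x\<in>{\<one>}. \<one>}"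
    proof
      fix f assume f: "f \<in> conj_hom G {\<one>} M"
      have "f = (\<lambda>x\<in>{\<one>}. \<one>)"
        by (rule extensionalityI[OF conj_homD(4)[OF f] restrict_extensional])
          (simp add: conj_hom_one[OF f one_is_normal Mn])
      then show "f \<in> {\<lambda>x\<in>{\<one>}. \<one>}" by simp
    qed
    show "{\<lambda>x\<in>{\<one>}. \<one>} \<subseteq> conj_hom G {\<one>} M"
      using normalD(2)[OF Mn] by (auto simp: conj_hom_def)
  qed
  ultimately show ?case by simp
next
  case (step B N)
  have n: "M \<lhd> G" "N \<lhd> G" "B \<lhd> G"
    using M step.hyps direct_abelian_normal by (auto simp: minimal_normal_def)
  have I: "M \<inter> N = {\<one>}" "M \<inter> B = {\<one>}"
    using step.prems subset_set_mult[OF n(2,3)] normalD(2)[OF n(1)] normalD(2)[OF n(2)] normalD(2)[OF n(3)]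
    by blast+
  show ?case
    using card_conj_hom_target[OF n step.hyps(4)] card_conj_hom_source[OF n(2,3) step.hyps(4) n(1) ab]
      card_conj_hom_minimal_sym[OF M step.hyps(2) I(1)] step.IH[OF I(2)] by simp
qed

section \<open>Normal closures of single elements\<close>

definition normal_closure :: "'a \<Rightarrow> 'a set" where
  "normal_closure x = generate G (conjugacy_class G x)"

lemma normal_closure_normal:
  assumes x: "x \<in> carrier G"
  shows "normal_closure x \<lhd> G"
  unfolding normal_closure_def
proof (rule normal_generateI)
  show "conjugacy_class G x \<subseteq> carrier G" using x by (auto simp: conjugacy_class_def)
  fix h g assume "h \<in> conjugacy_class G x" and g: "g \<in> carrier G"
  then obtain k where k: "k \<in> carrier G" "h = k \<otimes> x \<otimes> inv k" by (auto simp: conjugacy_class_def)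
  have "g \<otimes> h \<otimes> inv g = (g \<otimes> k) \<otimes> x \<otimes> inv (g \<otimes> k)"
    using g k x by (simp add: m_assoc inv_mult_group)
  then show "g \<otimes> h \<otimes> inv g \<in> conjugacy_class G x"
    using g k by (auto simp: conjugacy_class_def)
qed

lemma normal_closure_self:
  assumes x: "x \<in> carrier G"
  shows "x \<in> normal_closure x"
  unfolding normal_closure_def
proof (rule generate.incl)
  have "x = \<one> \<otimes> x \<otimes> inv \<one>" using x by simp
  then show "x \<in> conjugacy_class G x" unfolding conjugacy_class_def by blast
qed

lemma normal_closure_least:
  assumes K: "K \<lhd> G" and x: "x \<in> K"
  shows "normal_closure x \<subseteq> K"
  unfolding normal_closure_def
proof (rule generate_subgroup_incl[OF _ normal_imp_subgroup[OF K]])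
  show "conjugacy_class G x \<subseteq> K" using normalD(6)[OF K _ x] by (auto simp: conjugacy_class_def)
qed

text \<open>The normal closure \<open>K\<close> of \<open>b m\<close> satisfies \<open>KM = BM\<close>, and if it is not all of \<open>BM\<close>, then
  \<open>K \<inter> M = 1\<close> by minimality of \<open>M\<close>. So \<open>K\<close> is a complement of \<open>M\<close>. Conversely a complement \<open>H\<close>
  contains \<open>b m\<close> for exactly one \<open>m \<in> M\<close>, and the normal closure of that element is \<open>H\<close>, being itself a
  complement of \<open>M\<close>.\<close>
lemma card_translates_with_smaller_closure:
  assumes M: "minimal_normal M G" and B: "B \<lhd> G" and I: "M \<inter> B = {\<one>}"
    and b: "b \<in> carrier G" "B = normal_closure b"
  shows "card {m \<in> M. normal_closure (b \<otimes> m) \<noteq> M <#> B} = card (complements B M)"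
proof -
  have Mn: "M \<lhd> G" and M1: "M \<noteq> {\<one>}" using M by (auto simp: minimal_normal_def)
  have bB: "b \<in> B" using normal_closure_self b by simp
  have MB: "M <#> B = B <#> M" by (rule commut_normal[OF normal_imp_subgroup[OF Mn] B])
  have bmc: "b \<otimes> m \<in> carrier G" if "m \<in> M" for m using that normalD(3)[OF Mn] b by simp
  have sub: "normal_closure (b \<otimes> m) \<subseteq> B <#> M" if "m \<in> M" for m
    using normal_closure_least[OF normal_set_mult[OF B Mn] set_multI[OF bB that]] .
  have cover: "B \<subseteq> normal_closure (b \<otimes> m) <#> M" if m: "m \<in> M" for m
  proof -
    note K = normal_closure_normal[OF bmc[OF m]]
    have "(b \<otimes> m) \<otimes> inv m \<in> normal_closure (b \<otimes> m) <#> M"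
      by (rule set_multI[OF normal_closure_self[OF bmc[OF m]] normalD(5)[OF Mn m]])
    then have "b \<in> normal_closure (b \<otimes> m) <#> M" using b normalD(3)[OF Mn m] by (simp add: m_assoc)
    then show ?thesis using normal_closure_least[OF normal_set_mult[OF K Mn]] b(2) by simp
  qed
  have compl: "normal_closure (b \<otimes> m) \<in> complements B M"
    if m: "m \<in> M" and ne: "normal_closure (b \<otimes> m) \<noteq> M <#> B" for m
  proof -
    let ?K = "normal_closure (b \<otimes> m)"
    note K = normal_closure_normal[OF bmc[OF m]]
    have "\<not> M \<subseteq> ?K"
    proof
      assume MK: "M \<subseteq> ?K"
      then have "B \<subseteq> ?K" using cover[OF m] set_mult_least[OF K subset_refl MK] by blast
      then have "M <#> B \<subseteq> ?K" using set_mult_least[OF K MK] by blast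
      then show False using ne sub[OF m] MB by auto
    qed
    then have "?K \<inter> M = {\<one>}" using minimal_normal_Int[OF M K] by auto
    then show ?thesis using K sub[OF m] cover[OF m] by (simp add: complements_def)
  qed
  have "bij_betw (\<lambda>m. normal_closure (b \<otimes> m)) {m \<in> M. normal_closure (b \<otimes> m) \<noteq> M <#> B} (complements B M)"
  proof (rule bij_betw_imageI)
    show "inj_on (\<lambda>m. normal_closure (b \<otimes> m)) {m \<in> M. normal_closure (b \<otimes> m) \<noteq> M <#> B}"
    proof (rule inj_onI)
      fix m m' assume m: "m \<in> {m \<in> M. normal_closure (b \<otimes> m) \<noteq> M <#> B}"
        and m': "m' \<in> {m \<in> M. normal_closure (b \<otimes> m) \<noteq> M <#> B}"
        and e: "normal_closure (b \<otimes> m) = normal_closure (b \<otimes> m')"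
      let ?K = "normal_closure (b \<otimes> m)"
      have mM: "m \<in> M" "m' \<in> M" using m m' by auto
      note mc = normalD(3)[OF Mn mM(1)] normalD(3)[OF Mn mM(2)]
      have K: "?K \<lhd> G" "?K \<inter> M = {\<one>}" using compl m by (auto simp: complements_def)
      have in': "b \<otimes> m \<in> ?K" "b \<otimes> m' \<in> ?K"
        using normal_closure_self[OF bmc[OF mM(1)]] normal_closure_self[OF bmc[OF mM(2)]] e by auto
      have e2: "inv (b \<otimes> m) \<otimes> (b \<otimes> m') = inv m \<otimes> m'"
        using mc b by (simp add: inv_mult_group m_assoc inv_cancel)
      have "inv m \<otimes> m' \<in> ?K"
        using normalD(4)[OF K(1) normalD(5)[OF K(1) in'(1)] in'(2)] e2 by simp
      moreover have "inv m \<otimes> m' \<in> M" using normalD(4)[OF Mn normalD(5)[OF Mn mM(1)] mM(2)] .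
      ultimately have "inv m \<otimes> m' = \<one>" using K(2) by blast
      then have "m \<otimes> (inv m \<otimes> m') = m" using mc by simp
      then show "m = m'" using mc by (simp add: inv_cancel)
    qed
    show "(\<lambda>m. normal_closure (b \<otimes> m)) ` {m \<in> M. normal_closure (b \<otimes> m) \<noteq> M <#> B} = complements B M"
    proof
      show "(\<lambda>m. normal_closure (b \<otimes> m)) ` {m \<in> M. normal_closure (b \<otimes> m) \<noteq> M <#> B} \<subseteq> complements B M"
        using compl by auto
      show "complements B M \<subseteq> (\<lambda>m. normal_closure (b \<otimes> m)) ` {m \<in> M. normal_closure (b \<otimes> m) \<noteq> M <#> B}"
      proof
        fix H assume "H \<in> complements B M"
        then have H: "H \<lhd> G" "H \<subseteq> B <#> M" "H \<inter> M = {\<one>}" "B \<subseteq> H <#> M" by (auto simp: complements_def)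
        obtain h n where hn: "h \<in> H" "n \<in> M" "b = h \<otimes> n" using bB H(4) by (meson set_multE subsetD)
        note nc = normalD(3)[OF Mn hn(2)] and hc = normalD(3)[OF H(1) hn(1)]
        define m where "m = inv n"
        have m: "m \<in> M" unfolding m_def by (rule normalD(5)[OF Mn hn(2)])
        have "b \<otimes> m = h" unfolding m_def hn(3) using nc hc by (simp add: m_assoc)
        then have KH: "normal_closure (b \<otimes> m) \<subseteq> H" using normal_closure_least[OF H(1)] hn(1) by simp
        have ne: "normal_closure (b \<otimes> m) \<noteq> M <#> B"
        proof
          assume "normal_closure (b \<otimes> m) = M <#> B"
          then have "M \<subseteq> H" using KH subset_set_mult(1)[OF Mn B] by auto
          then show False using H(3) M1 normalD(2)[OF Mn] by auto
        qed
        note Kn = normal_closure_normal[OF bmc[OF m]]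
        have "H \<subseteq> normal_closure (b \<otimes> m)"
        proof
          fix x assume x: "x \<in> H"
          have "B <#> M \<subseteq> normal_closure (b \<otimes> m) <#> M"
            using set_mult_least[OF normal_set_mult[OF Kn Mn] cover[OF m] subset_set_mult(2)[OF Kn Mn]] .
          then have "x \<in> normal_closure (b \<otimes> m) <#> M" using x H(2) by blast
          then obtain k m' where km: "k \<in> normal_closure (b \<otimes> m)" "m' \<in> M" "x = k \<otimes> m'"
            by (rule set_multE)
          have kH: "k \<in> H" using km(1) KH by auto
          have "inv k \<otimes> x = m'" using km(3) normalD(3)[OF H(1) kH] normalD(3)[OF Mn km(2)] by (simp add: inv_cancel)
          then have "m' \<in> H" using normalD(4)[OF H(1) normalD(5)[OF H(1) kH] x] by simp
          then have "m' = \<one>" using km(2) H(3) by blast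
          then have "x = k" using km(3) normalD(3)[OF H(1) kH] by simp
          then show "x \<in> normal_closure (b \<otimes> m)" using km(1) by simp
        qed
        then show "H \<in> (\<lambda>m. normal_closure (b \<otimes> m)) ` {m \<in> M. normal_closure (b \<otimes> m) \<noteq> M <#> B}"
          using KH m ne by blast
      qed
    qed
  qed
  then show ?thesis by (rule bij_betw_same_card)
qed

text \<open>If \<open>MB\<close> is the normal closure of \<open>b m\<close>, then \<open>B\<close>, as the image of \<open>MB\<close> under projection, is the normal
  closure of \<open>b\<close>; a suitable \<open>m\<close> exists for a given \<open>b\<close> iff the unsuitable ones do not exhaust \<open>M\<close>.\<close>
lemma single_class_step:
  assumes M: "minimal_normal M G" and fin: "finite M" and B: "B \<lhd> G" and I: "M \<inter> B = {\<one>}"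
  shows "(\<exists>x\<in>carrier G. M <#> B = normal_closure x) \<longleftrightarrow>
    (\<exists>b\<in>carrier G. B = normal_closure b) \<and> card (complements B M) < card M"
proof
  have Mn: "M \<lhd> G" using M by (auto simp: minimal_normal_def)
  have MB: "M <#> B = B <#> M" by (rule commut_normal[OF normal_imp_subgroup[OF Mn] B])
  {
    assume "\<exists>x\<in>carrier G. M <#> B = normal_closure x"
    then obtain x where x: "x \<in> carrier G" "M <#> B = normal_closure x" by blast
    then have "x \<in> B <#> M" using normal_closure_self MB by auto
    then obtain b m where bm: "b \<in> B" "m \<in> M" "x = b \<otimes> m" by (meson set_multE)
    have bc: "b \<in> carrier G" using bm normalD(3)[OF B] by simp
    note K = normal_closure_normal[OF bc]
    have KB: "normal_closure b \<subseteq> B" by (rule normal_closure_least[OF B bm(1)])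
    have "B \<subseteq> normal_closure b"
    proof
      fix y assume y: "y \<in> B"
      have "x \<in> normal_closure b <#> M"
        unfolding bm(3) by (rule set_multI[OF normal_closure_self[OF bc] bm(2)])
      then have "M <#> B \<subseteq> normal_closure b <#> M"
        using normal_closure_least[OF normal_set_mult[OF K Mn]] x(2) by simp
      then have "y \<in> normal_closure b <#> M" using subset_set_mult(2)[OF Mn B] y by auto
      then obtain k m' where km: "k \<in> normal_closure b" "m' \<in> M" "y = k \<otimes> m'" by (meson set_multE)
      have kB: "k \<in> B" using km(1) KB by auto
      have "inv k \<otimes> y = m'" using km(3) normalD(3)[OF B kB] normalD(3)[OF Mn km(2)] by (simp add: inv_cancel)
      then have "m' \<in> B" using normalD(4)[OF B normalD(5)[OF B kB] y] by simp
      then have "m' = \<one>" using km(2) I by blast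
      then show "y \<in> normal_closure b" using km normalD(3)[OF B kB] by simp
    qed
    then have b: "B = normal_closure b" using KB by auto
    have "{m \<in> M. normal_closure (b \<otimes> m) \<noteq> M <#> B} \<subset> M" using bm x by auto
    from psubset_card_mono[OF fin this] have "card (complements B M) < card M"
      unfolding card_translates_with_smaller_closure[OF M B I bc b] .
    then show "(\<exists>b\<in>carrier G. B = normal_closure b) \<and> card (complements B M) < card M"
      using b bc by blast
  }
  assume "(\<exists>b\<in>carrier G. B = normal_closure b) \<and> card (complements B M) < card M"
  then obtain b where b: "b \<in> carrier G" "B = normal_closure b" and lt: "card (complements B M) < card M" by blast
  have "{m \<in> M. normal_closure (b \<otimes> m) \<noteq> M <#> B} \<noteq> M"
    using card_translates_with_smaller_closure[OF M B I b] lt by auto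
  then obtain m where "m \<in> M" "normal_closure (b \<otimes> m) = M <#> B" by blast
  then show "\<exists>x\<in>carrier G. M <#> B = normal_closure x"
    using b normalD(3)[OF Mn] by (intro bexI[of _ "b \<otimes> m"]) auto
qed

text \<open>A minimal normal subgroup either lies in the product of the previous ones or meets it trivially, so
  adding the abelian minimal normal subgroups one after another keeps the product direct.\<close>
lemma SocA_direct_abelian:
  assumes fin: "finite (carrier G)"
  shows "direct_abelian G (SocA G)"
proof -
  let ?F = "{N. minimal_normal N G \<and> comm_group (G\<lparr>carrier := N\<rparr>)}"
  have "?F \<subseteq> Pow (carrier G)" using normalD(1) by (auto simp: minimal_normal_def)
  then have "finite ?F" using fin finite_subset by blast
  moreover have "direct_abelian G (generate G (\<Union>F))" if "finite F" "F \<subseteq> ?F" for F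
    using that
  proof (induction F rule: finite_induct)
    case empty
    show ?case using direct_abelian.one[of G] by (simp add: generate_empty)
  next
    case (insert M F)
    let ?B = "generate G (\<Union>F)"
    have B: "direct_abelian G ?B" using insert by simp
    have Bn: "?B \<lhd> G" by (rule direct_abelian_normal[OF B])
    have M: "minimal_normal M G" "M \<lhd> G" using insert by (auto simp: minimal_normal_def)
    have cg: "comm_group (G\<lparr>carrier := M\<rparr>)" using insert by auto
    have ab: "x \<otimes> y = y \<otimes> x" if "x \<in> M" "y \<in> M" for x y
      using comm_monoid.m_comm[OF comm_group.axioms(1)[OF cg], of x y] that by simp
    have FB: "\<Union>F \<subseteq> ?B" by (intro subsetI generate.incl)
    have FC: "\<Union>F \<subseteq> carrier G" using FB normalD(1)[OF Bn] by blast
    have UC: "\<Union>(insert M F) \<subseteq> carrier G" using FC normalD(1)[OF M(2)] by auto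
    have mono: "?B \<subseteq> generate G (\<Union>(insert M F))" by (rule mono_generate) auto
    show ?case
    proof (cases "M \<subseteq> ?B")
      case True
      have "generate G (\<Union>(insert M F)) \<subseteq> ?B"
        using True FB by (intro generate_subgroup_incl normal_imp_subgroup[OF Bn]) auto
      then show ?thesis using mono B by (metis subset_antisym)
    next
      case False
      have I: "M \<inter> ?B = {\<one>}" by (rule minimal_normal_Int[OF M(1) Bn False])
      have "generate G (\<Union>(insert M F)) = M <#> ?B"
      proof
        show "generate G (\<Union>(insert M F)) \<subseteq> M <#> ?B"
          using subset_set_mult[OF M(2) Bn] FB
          by (intro generate_subgroup_incl normal_imp_subgroup[OF normal_set_mult[OF M(2) Bn]]) auto
        have "M \<subseteq> generate G (\<Union>(insert M F))" by (intro subsetI generate.incl) simp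
        then show "M <#> ?B \<subseteq> generate G (\<Union>(insert M F))"
          using mono unfolding set_mult_def by (blast intro: generate.eng)
      qed
      then show ?thesis using direct_abelian.step[OF B M(1) ab I] by simp
    qed
  qed
  ultimately show ?thesis unfolding SocA_def by blast
qed

end

section \<open>Direct sums of images of a subspace\<close>

context vector_space
begin

lemma independent_direct_family:
  assumes B: "finite B" "independent B" and J: "finite J"
    and lin: "\<And>j. j \<in> J \<Longrightarrow> Vector_Spaces.linear scale scale (T j)"
    and dir: "\<And>w. (\<And>j. j \<in> J \<Longrightarrow> w j \<in> span B) \<Longrightarrow> (\<Sum>j\<in>J. T j (w j)) = 0 \<Longrightarrow> (\<forall>j\<in>J. w j = 0)"
  shows "independent (\<Union>j\<in>J. T j ` B) \<and> card (\<Union>j\<in>J. T j ` B) = card J * card B"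
proof -
  let ?f = "\<lambda>(j, b). T j b"
  have eq: "(\<Union>j\<in>J. T j ` B) = ?f ` (J \<times> B)" by auto
  have fin: "finite (J \<times> B)" using B J by simp
  have key: "\<forall>p\<in>J \<times> B. u p = 0" if s: "(\<Sum>p\<in>J \<times> B. u p *s ?f p) = 0" for u
  proof -
    have "(\<Sum>j\<in>J. T j (\<Sum>b\<in>B. u (j, b) *s b)) = (\<Sum>j\<in>J. \<Sum>b\<in>B. u (j, b) *s T j b)"
    proof (rule sum.cong[OF refl])
      fix j assume "j \<in> J"
      then interpret l: Vector_Spaces.linear scale scale "T j" by (rule lin)
      show "T j (\<Sum>b\<in>B. u (j, b) *s b) = (\<Sum>b\<in>B. u (j, b) *s T j b)"
        by (simp add: l.sum l.scale)
    qed
    also have "\<dots> = 0" using s by (simp add: sum.cartesian_product case_prod_beta)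
    finally have "\<forall>j\<in>J. (\<Sum>b\<in>B. u (j, b) *s b) = 0"
      by (intro dir) (auto intro: span_sum span_scale span_base)
    then have "u (j, b) = 0" if "j \<in> J" "b \<in> B" for j b
      using independentD[OF B(2) B(1) subset_refl, of "\<lambda>b. u (j, b)" b] that by blast
    then show ?thesis by auto
  qed
  have inj: "inj_on ?f (J \<times> B)"
  proof (rule inj_onI, rule ccontr)
    fix p q assume p: "p \<in> J \<times> B" and q: "q \<in> J \<times> B" and e: "?f p = ?f q" and n: "p \<noteq> q"
    define u where "u = (\<lambda>r. if r = p then 1 else if r = q then - 1 else (0::'a))"
    have "(\<Sum>r\<in>J \<times> B. u r *s ?f r) = (\<Sum>r\<in>{p, q}. u r *s ?f r)"
      by (rule sum.mono_neutral_right[OF fin]) (use p q in \<open>auto simp: u_def\<close>)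
    also have "\<dots> = 0" using n e by (simp add: u_def)
    finally have "u p = 0" using key p by blast
    then show False by (simp add: u_def)
  qed
  have "independent (?f ` (J \<times> B))"
  proof (rule independent_if_scalars_zero)
    show "finite (?f ` (J \<times> B))" using fin by simp
    fix h v assume s: "(\<Sum>v\<in>?f ` (J \<times> B). h v *s v) = 0" and v: "v \<in> ?f ` (J \<times> B)"
    have "(\<Sum>p\<in>J \<times> B. h (?f p) *s ?f p) = 0"
      using s by (simp add: sum.reindex[OF inj] o_def)
    then show "h v = 0" using key[of "\<lambda>p. h (?f p)"] v by blast
  qed
  then show ?thesis unfolding eq by (simp add: card_image[OF inj] card_cartesian_product)
qed

text \<open>A dimension count: \<open>card J * card B\<close> is the dimension of the first sum of images, since it is direct, while
  \<open>card I * card B\<close> bounds the dimension of the second.\<close>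
lemma card_le_of_direct_images:
  assumes B: "finite B" "independent B" and J: "finite J" and I: "finite I"
    and lin: "\<And>j. j \<in> J \<Longrightarrow> Vector_Spaces.linear scale scale (T j)"
    and dir: "\<And>w. (\<And>j. j \<in> J \<Longrightarrow> w j \<in> span B) \<Longrightarrow> (\<Sum>j\<in>J. T j (w j)) = 0 \<Longrightarrow> (\<forall>j\<in>J. w j = 0)"
    and sub: "(\<Union>j\<in>J. T j ` B) \<subseteq> span (\<Union>i\<in>I. T' i ` B)"
  shows "card J * card B \<le> card I * card B"
    and "\<phi> \<in> span (\<Union>i\<in>I. T' i ` B) \<Longrightarrow> \<phi> \<notin> span (\<Union>j\<in>J. T j ` B) \<Longrightarrow> card J * card B < card I * card B"
proof -
  have ind: "independent (\<Union>j\<in>J. T j ` B)" "card (\<Union>j\<in>J. T j ` B) = card J * card B"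
  proof -
    have "independent (\<Union>j\<in>J. T j ` B) \<and> card (\<Union>j\<in>J. T j ` B) = card J * card B"
      by (rule independent_direct_family[OF B J]) (fact lin, fact dir)
    then show "independent (\<Union>j\<in>J. T j ` B)" "card (\<Union>j\<in>J. T j ` B) = card J * card B" by auto
  qed
  have fin: "finite (\<Union>i\<in>I. T' i ` B)" using I B by simp
  have finJ: "finite (\<Union>j\<in>J. T j ` B)" using J B by simp
  have "(\<Union>i\<in>I. T' i ` B) = (\<lambda>(i, b). T' i b) ` (I \<times> B)" by auto
  then have le: "card (\<Union>i\<in>I. T' i ` B) \<le> card I * card B"
    using card_image_le[of "I \<times> B"] I B by (simp add: card_cartesian_product)
  show "card J * card B \<le> card I * card B"
    using independent_span_bound[OF fin ind(1) sub] le unfolding ind(2) by linarith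
  assume p: "\<phi> \<in> span (\<Union>i\<in>I. T' i ` B)" and n: "\<phi> \<notin> span (\<Union>j\<in>J. T j ` B)"
  have "independent (insert \<phi> (\<Union>j\<in>J. T j ` B))" by (rule independent_insertI[OF n ind(1)])
  then have "card (insert \<phi> (\<Union>j\<in>J. T j ` B)) \<le> card (\<Union>i\<in>I. T' i ` B)"
    using independent_span_bound[OF fin] p sub by blast
  moreover have "card (insert \<phi> (\<Union>j\<in>J. T j ` B)) = Suc (card J * card B)"
    using card_insert_disjoint[OF finJ] n span_base[of \<phi>] ind(2) by metis
  ultimately show "card J * card B < card I * card B" using le by linarith
qed

end

definition fscale :: "'f::field \<Rightarrow> ('x \<Rightarrow> 'f) \<Rightarrow> 'x \<Rightarrow> 'f" where
  "fscale c \<phi> = (\<lambda>x. c * \<phi> x)"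

interpretation fun_space: vector_space "fscale :: 'f::field \<Rightarrow> ('x \<Rightarrow> 'f) \<Rightarrow> 'x \<Rightarrow> 'f"
  by unfold_locales (auto simp: fscale_def fun_eq_iff algebra_simps)

lemma sum_fun_apply: "(\<Sum>i\<in>I. f i) x = (\<Sum>i\<in>I. f i x)" for f :: "'i \<Rightarrow> 'x \<Rightarrow> 'f::comm_monoid_add"
  by (induction I rule: infinite_finite_induct) simp_all

text \<open>The functions supported on \<open>K\<close> are spanned by the finitely many indicator functions of points of \<open>K\<close>.\<close>
lemma finite_support_subspace_basis:
  fixes U :: "('x \<Rightarrow> 'f::field) set"
  assumes U: "fun_space.subspace U" and K: "finite K" and s: "\<And>\<phi> x. \<phi> \<in> U \<Longrightarrow> x \<notin> K \<Longrightarrow> \<phi> x = 0"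
  obtains B where "finite B" "fun_space.independent B" "fun_space.span B = U"
proof -
  let ?D = "(\<lambda>k x. if x = k then 1 else 0 :: 'f) ` K"
  have D: "U \<subseteq> fun_space.span ?D"
  proof
    fix \<phi> assume p: "\<phi> \<in> U"
    have "\<phi> = (\<Sum>k\<in>K. fscale (\<phi> k) (\<lambda>x. if x = k then 1 else 0))"
    proof
      fix x
      have "(\<Sum>k\<in>K. fscale (\<phi> k) (\<lambda>x. if x = k then 1 else 0)) x = (\<Sum>k\<in>K. if x = k then \<phi> k else 0)"
        unfolding sum_fun_apply fscale_def by (rule sum.cong) simp_all
      also have "\<dots> = \<phi> x" using K s[OF p, of x] by (simp add: sum.delta')
      finally show "\<phi> x = (\<Sum>k\<in>K. fscale (\<phi> k) (\<lambda>x. if x = k then 1 else 0)) x" ..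
    qed
    also have "\<dots> \<in> fun_space.span ?D"
      by (intro fun_space.span_sum fun_space.span_scale fun_space.span_base) auto
    finally show "\<phi> \<in> fun_space.span ?D" .
  qed
  obtain B where B: "B \<subseteq> U" "fun_space.independent B" "U \<subseteq> fun_space.span B"
    by (rule fun_space.basis_exists[of U])
  have "finite B" using fun_space.independent_span_bound[OF finite_imageI[OF K] B(2) subset_trans[OF B(1) D]] by simp
  moreover have "fun_space.span B = U"
    using fun_space.span_minimal[OF B(1) U] B(3) by auto
  ultimately show thesis using that B by blast
qed

section \<open>Functions with vanishing coset sums\<close>

text \<open>Identify \<open>\<phi>\<close> with \<open>\<Sum>\<^sub>x \<phi>(x) x\<close> in the group algebra. For normal \<open>N\<close>, this is then
  multiplication by the central element \<open>\<Sum>\<^sub>n\<^sub>\<in>\<^sub>N n\<close>; if \<open>|N|\<close> is invertible, this is \<open>|N|\<close> times the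
  projection onto the part on which \<open>N\<close> acts trivially.\<close>
definition coset_sum :: "('a, 'b) monoid_scheme \<Rightarrow> 'a set \<Rightarrow> ('a \<Rightarrow> 'f::field) \<Rightarrow> 'a \<Rightarrow> 'f" where
  "coset_sum G N \<phi> = (\<lambda>x. if x \<in> carrier G then (\<Sum>n\<in>N. \<phi> (n \<otimes>\<^bsub>G\<^esub> x)) else 0)"

definition left_translate :: "('a, 'b) monoid_scheme \<Rightarrow> 'a \<Rightarrow> ('a \<Rightarrow> 'f::field) \<Rightarrow> 'a \<Rightarrow> 'f" where
  "left_translate G g \<phi> = (\<lambda>x. if x \<in> carrier G then \<phi> (inv\<^bsub>G\<^esub> g \<otimes>\<^bsub>G\<^esub> x) else 0)"

text \<open>For normal \<open>K\<close> of invertible order this is, inside the group algebra of \<open>K\<close>, the largest left ideal in which no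
  minimal normal subgroup of \<open>G\<close> contained in \<open>K\<close> has a nonzero fixed vector.\<close>
definition null_functions :: "('a, 'b) monoid_scheme \<Rightarrow> 'a set \<Rightarrow> ('a \<Rightarrow> 'f::field) set" where
  "null_functions G K = {\<phi>. (\<forall>x. x \<notin> K \<longrightarrow> \<phi> x = 0) \<and>
     (\<forall>M. minimal_normal M G \<and> M \<subseteq> K \<longrightarrow> coset_sum G M \<phi> = 0)}"

lemma linear_coset_sum: "Vector_Spaces.linear fscale fscale (coset_sum G N)"
  by (intro Vector_Spaces.linear.intro module_hom.intro module_hom_axioms.intro fun_space.vector_space_axioms fun_space.module_axioms)
    (auto simp: coset_sum_def fscale_def fun_eq_iff sum.distrib sum_distrib_left)

lemma linear_left_translate: "Vector_Spaces.linear fscale fscale (left_translate G g)"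
  by (intro Vector_Spaces.linear.intro module_hom.intro module_hom_axioms.intro fun_space.vector_space_axioms fun_space.module_axioms)
    (auto simp: left_translate_def fscale_def fun_eq_iff)

lemma coset_sum_zero: "coset_sum G N 0 = 0"
  by (simp add: coset_sum_def fun_eq_iff)

lemma coset_sum_diff: "coset_sum G N (\<phi> - \<psi>) = coset_sum G N \<phi> - coset_sum G N \<psi>"
  by (simp add: coset_sum_def fun_eq_iff sum_subtractf)

lemma coset_sum_scale: "coset_sum G N (fscale c \<phi>) = fscale c (coset_sum G N \<phi>)"
  by (simp add: coset_sum_def fun_eq_iff fscale_def sum_distrib_left)

lemma coset_sum_sum: "coset_sum G N (\<Sum>i\<in>I. f i) = (\<Sum>i\<in>I. coset_sum G N (f i))"
  by (auto simp: coset_sum_def fun_eq_iff sum_fun_apply intro: sum.swap)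

lemma subspace_null_functions: "fun_space.subspace (null_functions G K)"
  unfolding fun_space.subspace_def null_functions_def
  by (auto simp: coset_sum_def fscale_def fun_eq_iff sum.distrib simp flip: sum_distrib_left)

context group
begin

lemma coset_sum_invariant:
  assumes K: "K \<lhd> G" and p: "p \<in> K" and x: "x \<in> carrier G"
  shows "coset_sum G K \<phi> (p \<otimes> x) = coset_sum G K \<phi> x"
proof -
  note pc = normalD(3)[OF K p]
  have "(\<Sum>k\<in>K. \<phi> (k \<otimes> (p \<otimes> x))) = (\<Sum>k\<in>K. \<phi> (k \<otimes> x))"
  proof (rule sum.reindex_bij_witness[of _ "\<lambda>k. k \<otimes> inv p" "\<lambda>k. k \<otimes> p"])
    fix k assume k: "k \<in> K"
    note kc = normalD(3)[OF K k]
    show "(k \<otimes> p) \<otimes> inv p = k" "(k \<otimes> inv p) \<otimes> p = k" using pc kc by (simp_all add: m_assoc)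
    show "k \<otimes> p \<in> K" "k \<otimes> inv p \<in> K" using k p normalD(4,5)[OF K] by auto
    show "\<phi> ((k \<otimes> p) \<otimes> x) = \<phi> (k \<otimes> (p \<otimes> x))" using pc kc x by (simp add: m_assoc)
  qed
  then show ?thesis using x pc by (simp add: coset_sum_def)
qed

lemma coset_sum_subgroup:
  assumes P: "P \<lhd> G" and K: "K \<lhd> G" and PK: "P \<subseteq> K"
  shows "coset_sum G P (coset_sum G K \<phi>) = fscale (of_nat (card P)) (coset_sum G K \<phi>)"
proof
  fix x
  show "coset_sum G P (coset_sum G K \<phi>) x = fscale (of_nat (card P)) (coset_sum G K \<phi>) x"
  proof (cases "x \<in> carrier G")
    case True
    have "coset_sum G K \<phi> (p \<otimes> x) = coset_sum G K \<phi> x" if "p \<in> P" for p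
      using coset_sum_invariant[OF K subsetD[OF PK that] True] .
    then show ?thesis using True by (simp add: coset_sum_def[of G P] fscale_def)
  qed (simp add: coset_sum_def fscale_def)
qed

lemma coset_sum_commute:
  assumes M: "M \<lhd> G" and N: "N \<lhd> G"
  shows "coset_sum G M (coset_sum G N \<phi>) = coset_sum G N (coset_sum G M \<phi>)"
proof
  fix x
  show "coset_sum G M (coset_sum G N \<phi>) x = coset_sum G N (coset_sum G M \<phi>) x"
  proof (cases "x \<in> carrier G")
    case True
    have c: "m \<in> M \<Longrightarrow> m \<otimes> x \<in> carrier G" "m \<in> N \<Longrightarrow> m \<otimes> x \<in> carrier G" for m
      using True normalD(3)[OF M] normalD(3)[OF N] by auto
    have "(\<Sum>m\<in>M. \<Sum>n\<in>N. \<phi> (n \<otimes> (m \<otimes> x))) = (\<Sum>m\<in>M. \<Sum>n\<in>N. \<phi> (m \<otimes> (n \<otimes> x)))"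
    proof (rule sum.cong[OF refl])
      fix m assume m: "m \<in> M"
      note mc = normalD(3)[OF M m]
      show "(\<Sum>n\<in>N. \<phi> (n \<otimes> (m \<otimes> x))) = (\<Sum>n\<in>N. \<phi> (m \<otimes> (n \<otimes> x)))"
      proof (rule sum.reindex_bij_witness[of _ "\<lambda>n. m \<otimes> n \<otimes> inv m" "\<lambda>n. inv m \<otimes> n \<otimes> inv (inv m)"])
        fix n assume n: "n \<in> N"
        note nc = normalD(3)[OF N n]
        show "m \<otimes> (inv m \<otimes> n \<otimes> inv (inv m)) \<otimes> inv m = n" "inv m \<otimes> (m \<otimes> n \<otimes> inv m) \<otimes> inv (inv m) = n"
          using mc nc by (simp_all add: m_assoc inv_cancel)
        show "inv m \<otimes> n \<otimes> inv (inv m) \<in> N" "m \<otimes> n \<otimes> inv m \<in> N"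
          using normalD(6)[OF N] n mc inv_closed[OF mc] by blast+
        show "\<phi> (m \<otimes> ((inv m \<otimes> n \<otimes> inv (inv m)) \<otimes> x)) = \<phi> (n \<otimes> (m \<otimes> x))"
          using mc nc True by (simp add: m_assoc inv_cancel)
      qed
    qed
    also have "\<dots> = (\<Sum>n\<in>N. \<Sum>m\<in>M. \<phi> (m \<otimes> (n \<otimes> x)))" by (rule sum.swap)
    finally show ?thesis using True c by (simp add: coset_sum_def)
  qed (simp add: coset_sum_def)
qed

lemma coset_sum_direct:
  assumes M: "M \<lhd> G" and N: "N \<lhd> G" and I: "M \<inter> N = {\<one>}"
  shows "coset_sum G N (coset_sum G M \<phi>) = coset_sum G (M <#> N) \<phi>"
proof
  fix x
  show "coset_sum G N (coset_sum G M \<phi>) x = coset_sum G (M <#> N) \<phi> x"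
  proof (cases "x \<in> carrier G")
    case True
    have mc: "m \<in> carrier G" if "m \<in> M" for m using normalD(3)[OF M that] .
    have nc: "n \<in> carrier G" if "n \<in> N" for n using normalD(3)[OF N that] .
    have inj: "inj_on (\<lambda>(m, n). m \<otimes> n) (M \<times> N)"
      by (rule inj_onI) (use direct_unique[OF M N I] in \<open>auto simp: mem_Times_iff split: prod.splits\<close>)
    have im: "M <#> N = (\<lambda>(m, n). m \<otimes> n) ` (M \<times> N)" by (auto simp: set_mult_def)
    have "(\<Sum>y\<in>M <#> N. \<phi> (y \<otimes> x)) = (\<Sum>(m, n)\<in>M \<times> N. \<phi> (m \<otimes> n \<otimes> x))"
      unfolding im sum.reindex[OF inj] by (simp add: o_def case_prod_beta)
    also have "\<dots> = (\<Sum>m\<in>M. \<Sum>n\<in>N. \<phi> (m \<otimes> n \<otimes> x))" by (rule sum.cartesian_product[symmetric])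
    also have "\<dots> = (\<Sum>n\<in>N. \<Sum>m\<in>M. \<phi> (m \<otimes> n \<otimes> x))" by (rule sum.swap)
    also have "\<dots> = (\<Sum>n\<in>N. \<Sum>m\<in>M. \<phi> (m \<otimes> (n \<otimes> x)))"
      using True mc nc by (intro sum.cong refl) (simp add: m_assoc)
    finally show ?thesis using True nc by (simp add: coset_sum_def)
  qed (simp add: coset_sum_def)
qed

lemma coset_sum_left_translate:
  assumes N: "N \<lhd> G" and g: "g \<in> carrier G"
  shows "coset_sum G N (left_translate G g \<phi>) = left_translate G g (coset_sum G N \<phi>)"
proof
  fix x
  show "coset_sum G N (left_translate G g \<phi>) x = left_translate G g (coset_sum G N \<phi>) x"
  proof (cases "x \<in> carrier G")
    case True
    have nx: "n \<otimes> x \<in> carrier G" if "n \<in> N" for n using normalD(3)[OF N that] True by simp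
    have "(\<Sum>n\<in>N. \<phi> (inv g \<otimes> (n \<otimes> x))) = (\<Sum>n\<in>N. \<phi> (n \<otimes> (inv g \<otimes> x)))"
    proof (rule sum.reindex_bij_witness[of _ "\<lambda>n. g \<otimes> n \<otimes> inv g" "\<lambda>n. inv g \<otimes> n \<otimes> inv (inv g)"])
      fix n assume n: "n \<in> N"
      note nc = normalD(3)[OF N n]
      show "g \<otimes> (inv g \<otimes> n \<otimes> inv (inv g)) \<otimes> inv g = n" "inv g \<otimes> (g \<otimes> n \<otimes> inv g) \<otimes> inv (inv g) = n"
        using g nc by (simp_all add: m_assoc inv_cancel)
      show "inv g \<otimes> n \<otimes> inv (inv g) \<in> N" "g \<otimes> n \<otimes> inv g \<in> N"
        using normalD(6)[OF N] n g inv_closed[OF g] by blast+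
      show "\<phi> ((inv g \<otimes> n \<otimes> inv (inv g)) \<otimes> (inv g \<otimes> x)) = \<phi> (inv g \<otimes> (n \<otimes> x))"
        using g nc True by (simp add: m_assoc inv_cancel)
    qed
    then show ?thesis using True nx g by (simp add: coset_sum_def left_translate_def)
  qed (simp add: coset_sum_def left_translate_def)
qed

lemma coset_sum_restrict:
  assumes B: "B \<lhd> G" and N: "N \<lhd> G" "N \<subseteq> B"
  shows "coset_sum G N (\<lambda>x. if x \<in> B then \<phi> x else 0) = (\<lambda>x. if x \<in> B then coset_sum G N \<phi> x else 0)"
proof
  fix x
  have iff: "n \<otimes> x \<in> B \<longleftrightarrow> x \<in> B" if n: "n \<in> N" and x: "x \<in> carrier G" for n
  proof
    have nB: "n \<in> B" using n N by auto
    note nc = normalD(3)[OF B nB]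
    show "x \<in> B \<Longrightarrow> n \<otimes> x \<in> B" by (rule normalD(4)[OF B nB])
    assume "n \<otimes> x \<in> B"
    then have "inv n \<otimes> (n \<otimes> x) \<in> B" by (rule normalD(4)[OF B normalD(5)[OF B nB]])
    then show "x \<in> B" using nc x by (simp add: inv_cancel)
  qed
  show "coset_sum G N (\<lambda>x. if x \<in> B then \<phi> x else 0) x = (if x \<in> B then coset_sum G N \<phi> x else 0)"
    using normalD(3)[OF B] by (auto simp: coset_sum_def iff)
qed

lemma coset_sum_support:
  assumes K: "K \<lhd> G" and N: "N \<subseteq> K" and s: "\<And>x. x \<notin> K \<Longrightarrow> \<phi> x = 0" and x: "x \<notin> K"
  shows "coset_sum G N \<phi> x = 0"
proof (cases "x \<in> carrier G")
  case True
  have "n \<otimes> x \<notin> K" if n: "n \<in> N" for n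
  proof
    have nK: "n \<in> K" using n N by auto
    assume "n \<otimes> x \<in> K"
    then have "inv n \<otimes> (n \<otimes> x) \<in> K" by (rule normalD(4)[OF K normalD(5)[OF K nK]])
    then show False using normalD(3)[OF K nK] True x by (simp add: inv_cancel)
  qed
  then show ?thesis using s by (simp add: coset_sum_def)
qed (simp add: coset_sum_def)

lemma direct_translate_mem_iff:
  assumes M: "M \<lhd> G" and B: "B \<lhd> G" and I: "M \<inter> B = {\<one>}"
    and m: "m \<in> M" "m' \<in> M" and x: "x \<in> B"
  shows "inv m \<otimes> (m' \<otimes> x) \<in> B \<longleftrightarrow> m = m'"
proof
  note c = normalD(3)[OF M m(1)] normalD(3)[OF M m(2)] normalD(3)[OF B x]
  show "m = m' \<Longrightarrow> inv m \<otimes> (m' \<otimes> x) \<in> B" using c x by (simp add: inv_cancel)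
  assume "inv m \<otimes> (m' \<otimes> x) \<in> B"
  then have "(inv m \<otimes> (m' \<otimes> x)) \<otimes> inv x \<in> B" by (rule normalD(4)[OF B _ normalD(5)[OF B x]])
  moreover have "(inv m \<otimes> (m' \<otimes> x)) \<otimes> inv x = inv m \<otimes> m'" using c by (simp add: m_assoc)
  moreover have "inv m \<otimes> m' \<in> M" by (rule normalD(4)[OF M normalD(5)[OF M m(1)] m(2)])
  ultimately have "inv m \<otimes> m' = \<one>" using I by auto
  then have "m \<otimes> (inv m \<otimes> m') = m" using c by simp
  then show "m = m'" using c by (simp add: inv_cancel)
qed

lemma sum_translates_apply:
  assumes M: "M \<lhd> G" and fin: "finite M" and B: "B \<lhd> G" and I: "M \<inter> B = {\<one>}"
    and s: "\<And>m x. m \<in> M \<Longrightarrow> x \<notin> B \<Longrightarrow> w m x = 0" and m: "m \<in> M" and x: "x \<in> B"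
  shows "(\<Sum>m'\<in>M. left_translate G m' (w m')) (m \<otimes> x) = w m x"
proof -
  note c = normalD(3)[OF M m] normalD(3)[OF B x]
  have "(\<Sum>m'\<in>M. left_translate G m' (w m') (m \<otimes> x)) = (\<Sum>m'\<in>M. if m' = m then w m x else 0)"
  proof (rule sum.cong[OF refl])
    fix m' assume m': "m' \<in> M"
    show "left_translate G m' (w m') (m \<otimes> x) = (if m' = m then w m x else 0)"
      using s[OF m'] direct_translate_mem_iff[OF M B I m' m x] c
      by (auto simp: left_translate_def inv_cancel)
  qed
  then show ?thesis using m fin by (simp add: sum_fun_apply)
qed

text \<open>The coset of \<open>N\<close> through \<open>n x\<close> meets \<open>B\<close> only in \<open>x\<close>, so the sum has a single nonzero term.\<close>
lemma coset_sum_direct_apply: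
  assumes N: "N \<lhd> G" and fin: "finite N" and B: "B \<lhd> G" and I: "N \<inter> B = {\<one>}"
    and s: "\<And>x. x \<notin> B \<Longrightarrow> u x = 0" and n: "n \<in> N" and x: "x \<in> B"
  shows "coset_sum G N u (n \<otimes> x) = u x"
proof -
  note c = normalD(3)[OF N n] normalD(3)[OF B x]
  have "(\<Sum>k\<in>N. u (k \<otimes> (n \<otimes> x))) = (\<Sum>k\<in>N. if k = inv n then u x else 0)"
  proof (rule sum.cong[OF refl])
    fix k assume k: "k \<in> N"
    note kc = normalD(3)[OF N k]
    have "k \<otimes> (n \<otimes> x) \<in> B \<longleftrightarrow> inv k = n"
      using direct_translate_mem_iff[OF N B I normalD(5)[OF N k] n x] kc by simp
    moreover have "inv k = n \<longleftrightarrow> k = inv n" using kc c by auto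
    ultimately show "u (k \<otimes> (n \<otimes> x)) = (if k = inv n then u x else 0)"
      using s c by (auto simp: inv_cancel)
  qed
  then show ?thesis using c fin normalD(5)[OF N n] by (simp add: coset_sum_def)
qed

lemma card_normal_ne_zero:
  assumes fin: "finite (carrier G)" and char: "\<not> CHAR('f::field) dvd Coset.order G" and N: "N \<lhd> G"
  shows "(of_nat (card N) :: 'f) \<noteq> 0"
proof
  assume "(of_nat (card N) :: 'f) = 0"
  then have "CHAR('f) dvd card N" by (simp add: of_nat_eq_0_iff_char_dvd)
  moreover have "card N dvd Coset.order G" using lagrange[OF normal_imp_subgroup[OF N]] by (metis dvd_triv_right)
  ultimately show False using char dvd_trans by blast
qed

text \<open>Let \<open>U\<close> be the space of null functions on \<open>B\<close>, and let \<open>Y\<close> consist of the functions on \<open>MB\<close> whose sums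
  over the cosets of the minimal normal subgroups inside \<open>B\<close> vanish. Splitting \<open>MB\<close> into the cosets
  \<open>m B\<close> exhibits \<open>Y\<close> as the direct sum of \<open>|M|\<close> translates of \<open>U\<close>. The other minimal normal subgroups inside
  \<open>MB\<close> are the complements \<open>N\<close> of \<open>B\<close>, and a null function on \<open>MB\<close> is an element of \<open>Y\<close>
  annihilated by all coset sums \<open>S\<^sub>N\<close>. On \<open>Y\<close> the operators \<open>S\<^sub>N / |N|\<close> are orthogonal idempotents, and each has an
  image isomorphic to \<open>U\<close>. So \<open>Y\<close> is the direct sum of the null functions and one copy of \<open>U\<close> for each
  complement, and the null functions have dimension \<open>(|M| - k) dim U\<close> for \<open>k\<close> complements.\<close>
lemma null_functions_step:
  fixes B :: "'a set"
  assumes fin: "finite (carrier G)" and char: "\<not> CHAR('f::field) dvd Coset.order G"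
    and M: "minimal_normal M G" and B: "B \<lhd> G" and I: "M \<inter> B = {\<one>}"
  shows "(\<exists>\<phi> \<in> null_functions G (M <#> B). \<phi> \<noteq> (0 :: 'a \<Rightarrow> 'f)) \<longleftrightarrow>
    (\<exists>\<phi> \<in> null_functions G B. \<phi> \<noteq> (0 :: 'a \<Rightarrow> 'f)) \<and> card (complements M B) < card M"
proof -
  have Mn: "M \<lhd> G" using M by (simp add: minimal_normal_def)
  let ?K = "M <#> B"
  note K = normal_set_mult[OF Mn B]
  have BK: "B \<subseteq> ?K" and MK: "M \<subseteq> ?K" using subset_set_mult[OF Mn B] by auto
  have finite_normal: "finite N" if "N \<lhd> G" for N using normalD(1)[OF that] fin finite_subset by blast
  note nz = card_normal_ne_zero[OF fin char]
  \<comment> \<open>by \<open>complements_minimal\<close>, also the minimal normal subgroups inside \<open>MB\<close> but not inside \<open>B\<close>\<close>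
  define D where "D = complements M B"
  have D: "D = {N. minimal_normal N G \<and> N \<subseteq> ?K \<and> \<not> N \<subseteq> B}"
    unfolding D_def by (rule complements_minimal[OF M B I])
  have D2: "N \<lhd> G" "N \<inter> B = {\<one>}" "M \<subseteq> N <#> B" "N \<subseteq> ?K" "minimal_normal N G" if "N \<in> D" for N
    using that D unfolding D_def complements_def by auto
  have finD: "finite D"
    by (rule finite_subset[of _ "Pow (carrier G)"]) (use D2(1) normalD(1) fin in auto)
  have cardD: "card N = card M" if N: "N \<in> D" for N
  proof -
    note N' = D2[OF N]
    have "N <#> B = M <#> B"
      using set_mult_least[OF K N'(4) BK] set_mult_least[OF normal_set_mult[OF N'(1) B] N'(3) subset_set_mult(2)[OF N'(1) B]]
      by auto
    then have "card N * card B = card M * card B"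
      using card_direct[OF N'(1) B N'(2)] card_direct[OF Mn B I] by metis
    moreover have "card B \<noteq> 0" using finite_normal[OF B] normalD(2)[OF B] by auto
    ultimately show ?thesis by simp
  qed
  define Y where "Y = {\<phi> :: 'a \<Rightarrow> 'f. (\<forall>x. x \<notin> ?K \<longrightarrow> \<phi> x = 0) \<and>
     (\<forall>P. minimal_normal P G \<and> P \<subseteq> B \<longrightarrow> coset_sum G P \<phi> = 0)}"
  let ?U = "null_functions G B :: ('a \<Rightarrow> 'f) set"
  let ?V = "null_functions G ?K :: ('a \<Rightarrow> 'f) set"
  have V_iff: "\<phi> \<in> ?V \<longleftrightarrow> \<phi> \<in> Y \<and> (\<forall>N\<in>D. coset_sum G N \<phi> = 0)" for \<phi>
    using BK unfolding null_functions_def Y_def D by blast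
  have UY: "\<phi> \<in> Y" if "\<phi> \<in> ?U" for \<phi>
    using that BK unfolding null_functions_def Y_def by blast
  have Usupp: "\<phi> x = 0" if "\<phi> \<in> ?U" "x \<notin> B" for \<phi> x using that unfolding null_functions_def by blast
  have Unull: "coset_sum G P \<phi> = 0" if "\<phi> \<in> ?U" "minimal_normal P G" "P \<subseteq> B" for \<phi> P
    using that unfolding null_functions_def by blast
  have SY: "coset_sum G N \<phi> \<in> Y" if p: "\<phi> \<in> Y" and N: "N \<lhd> G" "N \<subseteq> ?K" for \<phi> N
  proof -
    have "coset_sum G N \<phi> x = 0" if "x \<notin> ?K" for x
      using coset_sum_support[OF K N(2) _ that] p unfolding Y_def by blast
    moreover have "coset_sum G P (coset_sum G N \<phi>) = 0" if P: "minimal_normal P G" "P \<subseteq> B" for P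
    proof -
      have Pn: "P \<lhd> G" using P by (simp add: minimal_normal_def)
      have "coset_sum G P \<phi> = 0" using p P unfolding Y_def by blast
      then show ?thesis unfolding coset_sum_commute[OF Pn N(1)] by (simp add: coset_sum_zero)
    qed
    ultimately show ?thesis unfolding Y_def by blast
  qed
  have SS: "coset_sum G N (coset_sum G N \<phi>) = fscale (of_nat (card M)) (coset_sum G N \<phi>)" if "N \<in> D" for N and \<phi> :: "'a \<Rightarrow> 'f"
    using coset_sum_subgroup[OF D2(1)[OF that] D2(1)[OF that] subset_refl, of \<phi>] cardD[OF that] by simp
  \<comment> \<open>for distinct complements \<open>N\<close>, \<open>N'\<close> the product \<open>NN'\<close> is too large to avoid \<open>B\<close>: it contains a minimal normal
    \<open>P \<subseteq> B\<close>, and summing over \<open>NN'\<close> involves summing over the cosets of \<open>P\<close>, which gives zero on \<open>Y\<close>\<close>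
  have orth: "coset_sum G N' (coset_sum G N \<phi>) = 0" if p: "\<phi> \<in> Y" and N: "N \<in> D" and N': "N' \<in> D" and ne: "N \<noteq> N'" for \<phi> N N'
  proof -
    note n = D2[OF N] and n' = D2[OF N']
    have nn: "\<not> N' \<subseteq> N" using n(5) n'(5) ne unfolding minimal_normal_def by blast
    have I': "N \<inter> N' = {\<one>}" using minimal_normal_Int[OF n'(5) n(1) nn] by blast
    note NN = normal_set_mult[OF n(1) n'(1)]
    have "(N <#> N') \<inter> B \<noteq> {\<one>}"
    proof
      assume e: "(N <#> N') \<inter> B = {\<one>}"
      have "N' \<subseteq> N"
      proof
        fix x assume x: "x \<in> N'"
        have "?K \<subseteq> N <#> B"
          using set_mult_least[OF normal_set_mult[OF n(1) B] n(3) subset_set_mult(2)[OF n(1) B]] .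
        then have "x \<in> N <#> B" using x n'(4) by auto
        then obtain y b where yb: "y \<in> N" "b \<in> B" "x = y \<otimes> b" by (rule set_multE)
        note yc = normalD(3)[OF n(1) yb(1)] and bc = normalD(3)[OF B yb(2)]
        have "inv y \<otimes> x = b" unfolding yb(3) using yc bc by (simp add: inv_cancel)
        then have "b \<in> N <#> N'" using set_multI[OF normalD(5)[OF n(1) yb(1)] x] by simp
        then have "b = \<one>" using e yb(2) by blast
        then show "x \<in> N" using yb yc by simp
      qed
      then show False using nn by simp
    qed
    then obtain P where P: "P \<subseteq> (N <#> N') \<inter> B" "minimal_normal P G"
      using minimal_normal_exists[OF normal_subgroup_intersect[OF NN B]] finite_normal[OF normal_subgroup_intersect[OF NN B]] by blast
    have Pn: "P \<lhd> G" using P by (simp add: minimal_normal_def)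
    have "fscale (of_nat (card P)) (coset_sum G (N <#> N') \<phi>) = coset_sum G P (coset_sum G (N <#> N') \<phi>)"
      by (rule coset_sum_subgroup[OF Pn NN, symmetric]) (use P in blast)
    also have "\<dots> = coset_sum G (N <#> N') (coset_sum G P \<phi>)" by (rule coset_sum_commute[OF Pn NN])
    also have "coset_sum G P \<phi> = 0" using p P unfolding Y_def by blast
    finally have "fscale (of_nat (card P)) (coset_sum G (N <#> N') \<phi>) = 0" unfolding coset_sum_zero .
    then have "coset_sum G (N <#> N') \<phi> = 0" using nz[OF Pn] by simp
    then show ?thesis unfolding coset_sum_direct[OF n(1) n'(1) I'] .
  qed
  obtain Bs where Bs: "finite Bs" "fun_space.independent Bs" "fun_space.span Bs = ?U"
    by (rule finite_support_subspace_basis[where U = ?U and K = B, OF subspace_null_functions[of G B] finite_normal[OF B]])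
      (erule Usupp, assumption, blast)
  have BsU: "b \<in> ?U" if "b \<in> Bs" for b using that Bs(3) fun_space.span_base by blast
  let ?L = "\<Union>m\<in>M. left_translate G m ` Bs"
  let ?Q = "\<Union>N\<in>D. coset_sum G N ` Bs"
  have LY: "left_translate G m \<phi> \<in> Y" if m: "m \<in> M" and p: "\<phi> \<in> ?U" for m \<phi>
  proof -
    note mc = normalD(3)[OF Mn m]
    have "left_translate G m \<phi> x = 0" if x: "x \<notin> ?K" for x
    proof (cases "x \<in> carrier G")
      case True
      have "inv m \<otimes> x \<notin> B"
      proof
        assume "inv m \<otimes> x \<in> B"
        then have "m \<otimes> (inv m \<otimes> x) \<in> ?K" by (rule set_multI[OF m])
        then show False using x mc True by (simp add: inv_cancel)
      qed
      then show ?thesis using Usupp[OF p] by (simp add: left_translate_def)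
    qed (simp add: left_translate_def)
    moreover have "coset_sum G P (left_translate G m \<phi>) = 0" if P: "minimal_normal P G" "P \<subseteq> B" for P
    proof -
      have Pn: "P \<lhd> G" using P by (simp add: minimal_normal_def)
      show ?thesis unfolding coset_sum_left_translate[OF Pn mc] Unull[OF p P]
        by (simp add: left_translate_def fun_eq_iff)
    qed
    ultimately show ?thesis unfolding Y_def by blast
  qed
  \<comment> \<open>\<open>Y\<close> is the sum of the translates of \<open>U\<close>\<close>
  have YL: "\<phi> \<in> fun_space.span ?L" if p: "\<phi> \<in> Y" for \<phi>
  proof -
    define u where "u m = (\<lambda>x. if x \<in> B then left_translate G (inv m) \<phi> x else 0)" for m
    have uU: "u m \<in> ?U" if m: "m \<in> M" for m
    proof -
      have "coset_sum G P (u m) = 0" if P: "minimal_normal P G" "P \<subseteq> B" for P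
      proof -
        have Pn: "P \<lhd> G" using P by (simp add: minimal_normal_def)
        have "coset_sum G P \<phi> = 0" using p P unfolding Y_def by blast
        then show ?thesis
          unfolding u_def coset_sum_restrict[OF B Pn P(2)]
            coset_sum_left_translate[OF Pn inv_closed[OF normalD(3)[OF Mn m]]]
          by (simp add: left_translate_def fun_eq_iff)
      qed
      moreover have "u m x = 0" if "x \<notin> B" for x using that by (simp add: u_def)
      ultimately show ?thesis unfolding null_functions_def by blast
    qed
    have "\<phi> = (\<Sum>m\<in>M. left_translate G m (u m))"
    proof
      fix x
      show "\<phi> x = (\<Sum>m\<in>M. left_translate G m (u m)) x"
      proof (cases "x \<in> ?K")
        case True
        then obtain m b where mb: "m \<in> M" "b \<in> B" "x = m \<otimes> b" by (rule set_multE)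
        note c = normalD(3)[OF Mn mb(1)] normalD(3)[OF B mb(2)]
        have "(\<Sum>m\<in>M. left_translate G m (u m)) (m \<otimes> b) = u m b"
          by (rule sum_translates_apply[OF Mn finite_normal[OF Mn] B I _ mb(1,2)]) (simp add: u_def)
        also have "\<dots> = \<phi> x" using mb c by (simp add: u_def left_translate_def)
        finally show ?thesis unfolding mb(3) by (rule sym)
      next
        case False
        then have "\<phi> x = 0" using p unfolding Y_def by blast
        moreover have "left_translate G m (u m) x = 0" if "m \<in> M" for m
          using LY[OF that uU[OF that]] False unfolding Y_def by blast
        ultimately show ?thesis by (simp add: sum_fun_apply)
      qed
    qed
    also have "\<dots> \<in> fun_space.span ?L"
    proof (rule fun_space.span_sum)
      fix m assume m: "m \<in> M"
      interpret l: Vector_Spaces.linear fscale fscale "left_translate G m" by (rule linear_left_translate)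
      have "left_translate G m (u m) \<in> left_translate G m ` fun_space.span Bs" using uU[OF m] Bs(3) by blast
      also have "\<dots> = fun_space.span (left_translate G m ` Bs)" by (rule l.span_image[symmetric])
      also have "\<dots> \<subseteq> fun_space.span ?L" using m by (intro fun_space.span_mono) blast
      finally show "left_translate G m (u m) \<in> fun_space.span ?L" .
    qed
    finally show ?thesis .
  qed
  \<comment> \<open>a function \<open>S\<^sub>N \<phi>\<close> is constant on the cosets of \<open>N\<close>, so it is determined by its restriction \<open>u \<in> U\<close> to \<open>B\<close>,
    and \<open>S\<^sub>N \<phi> = S\<^sub>N u\<close>\<close>
  have SQ: "coset_sum G N \<phi> \<in> fun_space.span ?Q" if p: "\<phi> \<in> Y" and N: "N \<in> D" for \<phi> N
  proof -
    note n = D2[OF N]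
    define u where "u = (\<lambda>x. if x \<in> B then coset_sum G N \<phi> x else 0)"
    have SN: "coset_sum G N \<phi> \<in> Y" by (rule SY[OF p n(1,4)])
    have uU: "u \<in> ?U"
    proof -
      have "coset_sum G P u = 0" if P: "minimal_normal P G" "P \<subseteq> B" for P
      proof -
        have Pn: "P \<lhd> G" using P by (simp add: minimal_normal_def)
        have "coset_sum G P (coset_sum G N \<phi>) = 0" using SN P unfolding Y_def by blast
        then show ?thesis unfolding u_def coset_sum_restrict[OF B Pn P(2)] by (simp add: fun_eq_iff)
      qed
      moreover have "u x = 0" if "x \<notin> B" for x using that by (simp add: u_def)
      ultimately show ?thesis unfolding null_functions_def by blast
    qed
    have KN: "?K \<subseteq> N <#> B"
      using set_mult_least[OF normal_set_mult[OF n(1) B] n(3) subset_set_mult(2)[OF n(1) B]] .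
    have "coset_sum G N u = coset_sum G N \<phi>"
    proof
      fix x
      show "coset_sum G N u x = coset_sum G N \<phi> x"
      proof (cases "x \<in> ?K")
        case True
        then have "x \<in> N <#> B" using KN by auto
        then obtain y b where yb: "y \<in> N" "b \<in> B" "x = y \<otimes> b" by (rule set_multE)
        have "coset_sum G N u x = u b"
          unfolding yb(3)
          by (rule coset_sum_direct_apply[OF n(1) finite_normal[OF n(1)] B n(2) _ yb(1,2)]) (simp add: u_def)
        also have "\<dots> = coset_sum G N \<phi> x"
          unfolding yb(3) coset_sum_invariant[OF n(1) yb(1) normalD(3)[OF B yb(2)]] using yb(2) by (simp add: u_def)
        finally show ?thesis .
      next
        case False
        have "coset_sum G N \<phi> x = 0" using SN False unfolding Y_def by blast
        moreover have "coset_sum G N u x = 0" using SY[OF UY[OF uU] n(1,4)] False unfolding Y_def by blast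
        ultimately show ?thesis by simp
      qed
    qed
    interpret l: Vector_Spaces.linear fscale fscale "coset_sum G N" by (rule linear_coset_sum)
    have "coset_sum G N u \<in> coset_sum G N ` fun_space.span Bs" using uU Bs(3) by blast
    also have "\<dots> = fun_space.span (coset_sum G N ` Bs)" by (rule l.span_image[symmetric])
    also have "\<dots> \<subseteq> fun_space.span ?Q" using N by (intro fun_space.span_mono) blast
    finally show ?thesis unfolding \<open>coset_sum G N u = coset_sum G N \<phi>\<close> .
  qed
  \<comment> \<open>the translates of \<open>U\<close> have disjoint supports\<close>
  have dirL: "\<forall>m\<in>M. w m = 0"
    if w: "\<And>m. m \<in> M \<Longrightarrow> w m \<in> fun_space.span Bs" and s: "(\<Sum>m\<in>M. left_translate G m (w m)) = 0" for w
  proof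
    fix m assume m: "m \<in> M"
    show "w m = 0"
    proof
      fix x
      show "w m x = 0 x"
      proof (cases "x \<in> B")
        case True
        have "(\<Sum>m'\<in>M. left_translate G m' (w m')) (m \<otimes> x) = w m x"
          by (rule sum_translates_apply[OF Mn finite_normal[OF Mn] B I _ m True]) (use Usupp w Bs(3) in blast)
        then show ?thesis unfolding s by simp
      next
        case False
        then show ?thesis using Usupp w[OF m] Bs(3) by simp
      qed
    qed
  qed
  \<comment> \<open>applying one \<open>S\<^sub>N\<close> to the sum isolates its component at \<open>N\<close>\<close>
  have dirQ: "\<forall>N\<in>D. w N = 0"
    if w: "\<And>N. N \<in> D \<Longrightarrow> w N \<in> fun_space.span Bs" and s: "(\<Sum>N\<in>D. coset_sum G N (w N)) = 0" for w
  proof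
    fix N assume N: "N \<in> D"
    note n = D2[OF N]
    have wU: "w N' \<in> ?U" if "N' \<in> D" for N' using w[OF that] Bs(3) by simp
    have "coset_sum G N (\<Sum>N\<in>D. coset_sum G N (w N)) = (\<Sum>N'\<in>D. coset_sum G N (coset_sum G N' (w N')))"
      by (rule coset_sum_sum)
    also have "\<dots> = (\<Sum>N'\<in>D. if N' = N then fscale (of_nat (card M)) (coset_sum G N (w N)) else 0)"
      by (rule sum.cong[OF refl]) (use orth[OF UY[OF wU]] N SS in auto)
    also have "\<dots> = fscale (of_nat (card M)) (coset_sum G N (w N))" using N finD by simp
    finally have "fscale (of_nat (card M)) (coset_sum G N (w N)) = 0" unfolding s coset_sum_zero by simp
    then have z: "coset_sum G N (w N) = 0" using nz[OF Mn] by simp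
    show "w N = 0"
    proof
      fix x
      show "w N x = 0 x"
      proof (cases "x \<in> B")
        case True
        have "coset_sum G N (w N) (\<one> \<otimes> x) = w N x"
          by (rule coset_sum_direct_apply[OF n(1) finite_normal[OF n(1)] B n(2) Usupp[OF wU[OF N]] normalD(2)[OF n(1)] True])
        then show ?thesis unfolding z by simp
      next
        case False
        then show ?thesis using Usupp[OF wU[OF N]] by simp
      qed
    qed
  qed
  \<comment> \<open>the projection onto the sum of the images of all \<open>S\<^sub>N\<close> is \<open>|M|\<inverse> \<Sum>\<^sub>N S\<^sub>N\<close>\<close>
  have Qproj: "\<psi> = fscale (inverse (of_nat (card M))) (\<Sum>N\<in>D. coset_sum G N \<psi>)" if "\<psi> \<in> fun_space.span ?Q" for \<psi>
    using that
  proof (induction rule: fun_space.span_induct_alt)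
    case base
    show ?case unfolding coset_sum_zero by (simp add: fscale_def)
  next
    case (step c \<phi> \<psi>)
    then obtain N b where N: "N \<in> D" and b: "b \<in> Bs" "\<phi> = coset_sum G N b" by blast
    have "(\<Sum>N'\<in>D. coset_sum G N' \<phi>) = (\<Sum>N'\<in>D. if N' = N then fscale (of_nat (card M)) \<phi> else 0)"
      by (rule sum.cong[OF refl]) (use orth[OF UY[OF BsU[OF b(1)]] N] SS[OF N] b(2) in auto)
    also have "\<dots> = fscale (of_nat (card M)) \<phi>" using N finD by simp
    finally have e: "(\<Sum>N'\<in>D. coset_sum G N' \<phi>) = fscale (of_nat (card M)) \<phi>" .
    have "coset_sum G N' (fscale c \<phi> + \<psi>) = fscale c (coset_sum G N' \<phi>) + coset_sum G N' \<psi>" for N'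
      by (auto simp: coset_sum_def fun_eq_iff fscale_def sum.distrib sum_distrib_left)
    then have "(\<Sum>N'\<in>D. coset_sum G N' (fscale c \<phi> + \<psi>)) = fscale c (\<Sum>N'\<in>D. coset_sum G N' \<phi>) + (\<Sum>N'\<in>D. coset_sum G N' \<psi>)"
      by (simp add: sum.distrib fun_space.scale_sum_right)
    then have "fscale (inverse (of_nat (card M))) (\<Sum>N'\<in>D. coset_sum G N' (fscale c \<phi> + \<psi>)) =
      fscale (inverse (of_nat (card M))) (fscale c (fscale (of_nat (card M)) \<phi>)) +
      fscale (inverse (of_nat (card M))) (\<Sum>N'\<in>D. coset_sum G N' \<psi>)"
      unfolding e by (simp only: fun_space.scale_right_distrib)
    also have "fscale (inverse (of_nat (card M))) (\<Sum>N'\<in>D. coset_sum G N' \<psi>) = \<psi>"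
      by (rule step(2)[symmetric])
    also have "fscale (inverse (of_nat (card M))) (fscale c (fscale (of_nat (card M)) \<phi>)) = fscale c \<phi>"
      using nz[OF Mn] by (simp add: mult.commute)
    finally show ?case by (rule sym)
  qed
  show ?thesis
  proof
    assume "\<exists>\<phi>\<in>?V. \<phi> \<noteq> 0"
    then obtain \<phi> where p: "\<phi> \<in> ?V" "\<phi> \<noteq> 0" by blast
    \<comment> \<open>the projection annihilates \<open>\<phi> \<noteq> 0\<close>, so \<open>\<phi>\<close> shows that the \<open>S\<^sub>N U\<close> span a proper subspace of \<open>Y\<close>\<close>
    have nQ: "\<phi> \<notin> fun_space.span ?Q"
    proof
      assume "\<phi> \<in> fun_space.span ?Q"
      from Qproj[OF this] have "\<phi> = fscale (inverse (of_nat (card M))) (\<Sum>N\<in>D. coset_sum G N \<phi>)" .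
      also have "(\<Sum>N\<in>D. coset_sum G N \<phi>) = 0" using p(1) V_iff by (intro sum.neutral) blast
      finally show False using p(2) unfolding fun_space.scale_zero_right by contradiction
    qed
    have lt: "card D * card Bs < card M * card Bs"
    proof (rule fun_space.card_le_of_direct_images(2)[OF Bs(1,2) finD finite_normal[OF Mn],
          where T = "coset_sum G" and T' = "left_translate G" and \<phi> = \<phi>])
      show "Vector_Spaces.linear fscale fscale (coset_sum G N)" for N by (rule linear_coset_sum)
      show "\<forall>N\<in>D. w N = 0" if "\<And>N. N \<in> D \<Longrightarrow> w N \<in> fun_space.span Bs" "(\<Sum>N\<in>D. coset_sum G N (w N)) = 0" for w
        by (rule dirQ[OF that])
      show "?Q \<subseteq> fun_space.span ?L" using YL[OF SY[OF UY[OF BsU] D2(1,4)]] by blast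
      show "\<phi> \<in> fun_space.span ?L" using YL p(1) V_iff by blast
      show "\<phi> \<notin> fun_space.span ?Q" by (rule nQ)
    qed
    then have "Bs \<noteq> {}" by auto
    then obtain b where "b \<in> Bs" by blast
    moreover have "b \<noteq> 0" using \<open>b \<in> Bs\<close> Bs(2) fun_space.dependent_zero by blast
    ultimately show "(\<exists>\<phi>\<in>?U. \<phi> \<noteq> 0) \<and> card (complements M B) < card M"
      using BsU lt unfolding D_def by auto
  next
    assume a: "(\<exists>\<phi>\<in>?U. \<phi> \<noteq> 0) \<and> card (complements M B) < card M"
    then obtain \<phi> where p: "\<phi> \<in> ?U" "\<phi> \<noteq> 0" by blast
    have "Bs \<noteq> {}" using p Bs(3) fun_space.span_empty by auto
    then have pos: "card Bs > 0" using Bs(1) by (simp add: card_gt_0_iff)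
    \<comment> \<open>now the \<open>S\<^sub>N U\<close> cannot fill \<open>Y\<close>, and the complementary projection of any missed function is a null function\<close>
    have "\<not> ?L \<subseteq> fun_space.span ?Q"
    proof
      assume "?L \<subseteq> fun_space.span ?Q"
      then have "card M * card Bs \<le> card D * card Bs"
        by (rule fun_space.card_le_of_direct_images(1)[OF Bs(1,2) finite_normal[OF Mn] finD linear_left_translate, rotated])
          (rule dirL)
      then show False using a pos unfolding D_def by simp
    qed
    then obtain m b where m: "m \<in> M" "b \<in> Bs" and nQ: "left_translate G m b \<notin> fun_space.span ?Q" by blast
    define y where "y = left_translate G m b"
    have yY: "y \<in> Y" unfolding y_def by (rule LY[OF m(1) BsU[OF m(2)]])
    define \<psi> where "\<psi> = y - fscale (inverse (of_nat (card M))) (\<Sum>N\<in>D. coset_sum G N y)"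
    have Sq: "fscale (inverse (of_nat (card M))) (\<Sum>N\<in>D. coset_sum G N y) \<in> fun_space.span ?Q"
      by (intro fun_space.span_scale fun_space.span_sum SQ yY)
    have "\<psi> \<noteq> 0" using Sq nQ unfolding \<psi>_def y_def by auto
    moreover have "\<psi> \<in> ?V"
      unfolding V_iff
    proof
      have subY: "fun_space.subspace Y"
        unfolding fun_space.subspace_def Y_def
        by (auto simp: coset_sum_def fscale_def fun_eq_iff sum.distrib simp flip: sum_distrib_left)
      show "\<psi> \<in> Y"
        unfolding \<psi>_def
        by (intro fun_space.subspace_diff[OF subY] yY fun_space.subspace_scale[OF subY] fun_space.subspace_sum[OF subY]
            SY D2(1,4))
      show "\<forall>N\<in>D. coset_sum G N \<psi> = 0"
      proof
        fix N assume N: "N \<in> D"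
        have "(\<Sum>N'\<in>D. coset_sum G N (coset_sum G N' y)) =
          (\<Sum>N'\<in>D. if N' = N then fscale (of_nat (card M)) (coset_sum G N y) else 0)"
          by (rule sum.cong[OF refl]) (use orth[OF yY] N SS in auto)
        also have "\<dots> = fscale (of_nat (card M)) (coset_sum G N y)" using N finD by simp
        finally show "coset_sum G N \<psi> = 0"
          unfolding \<psi>_def coset_sum_diff coset_sum_scale coset_sum_sum using nz[OF Mn] by simp
      qed
    qed
    ultimately show "\<exists>\<phi>\<in>?V. \<phi> \<noteq> 0" by blast
  qed
qed

end

lemma function_nonzeroI: "\<phi> x \<noteq> 0 \<Longrightarrow> \<phi> \<noteq> 0" for \<phi> :: "'x \<Rightarrow> 'f::zero"
  by auto

lemma function_nonzeroE: "\<phi> \<noteq> 0 \<Longrightarrow> (\<And>x. \<phi> x \<noteq> 0 \<Longrightarrow> P) \<Longrightarrow> P" for \<phi> :: "'x \<Rightarrow> 'f::zero"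
  by (auto simp: fun_eq_iff)

context group
begin

lemma minimal_normal_subset_eq:
  "minimal_normal M G \<Longrightarrow> minimal_normal N G \<Longrightarrow> M \<subseteq> N \<Longrightarrow> M = N"
  unfolding minimal_normal_def by blast

text \<open>Both sides obey the same recursion, since \<open>B\<close> and \<open>M\<close> have equally many complements in \<open>MB\<close>.\<close>
lemma null_functions_direct_abelian:
  assumes fin: "finite (carrier G)" and char: "\<not> CHAR('f::field) dvd Coset.order G"
    and "direct_abelian G B"
  shows "(\<exists>\<phi>\<in>null_functions G B. \<phi> \<noteq> (0 :: 'a \<Rightarrow> 'f)) \<longleftrightarrow> (\<exists>x\<in>carrier G. B = normal_closure x)"
  using assms(3)
proof (induction rule: direct_abelian.induct)
  case one
  let ?d = "\<lambda>x. if x = \<one> then 1 else 0 :: 'f"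
  have "\<not> P \<subseteq> {\<one>}" if "minimal_normal P G" for P
    using that normalD(2)[of P] unfolding minimal_normal_def by blast
  then have "?d \<in> null_functions G {\<one>}" unfolding null_functions_def by auto
  moreover have "?d \<noteq> 0" by (rule function_nonzeroI[of _ \<one>]) simp
  moreover have "{\<one>} = normal_closure \<one>"
    using normal_closure_least[OF one_is_normal, of \<one>] normal_closure_self[OF one_closed] by auto
  ultimately show ?case by blast
next
  case (step B M)
  have n: "M \<lhd> G" "B \<lhd> G" using step.hyps direct_abelian_normal by (auto simp: minimal_normal_def)
  have finM: "finite M" using normalD(1)[OF n(1)] fin finite_subset by blast
  have "card (complements M B) = card (complements B M)"
    using card_complements[OF n step.hyps(4)] card_complements[OF n(2,1)]
      card_conj_hom_sym[OF step.hyps] step.hyps(4) by (simp add: Int_commute)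
  then show ?case
    unfolding null_functions_step[OF fin char step.hyps(2) n(2) step.hyps(4)]
      single_class_step[OF step.hyps(2) finM n(2) step.hyps(4)] step.IH by simp
qed

section \<open>Nonabelian minimal normal subgroups\<close>

text \<open>Subtract from \<open>\<phi>\<close> its right translate by some \<open>m \<noteq> 1\<close> in \<open>M\<close>. The two functions live on the
  disjoint cosets \<open>K\<close> and \<open>K m\<close>, so the difference is not zero; \<open>x\<close> and \<open>x m\<inverse>\<close> lie in
  the same coset of \<open>M\<close>, so its coset sums over \<open>M\<close> vanish; and right translation preserves the vanishing of
  coset sums over any other normal subgroup.\<close>
lemma extend_null_function:
  fixes \<phi> :: "'a \<Rightarrow> 'f::field"
  assumes K: "K \<lhd> G" and M: "M \<lhd> G" and I: "M \<inter> K = {\<one>}" and M1: "M \<noteq> {\<one>}"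
    and s: "\<And>x. x \<notin> K \<Longrightarrow> \<phi> x = 0" and nz: "\<phi> \<noteq> 0"
  obtains \<psi> :: "'a \<Rightarrow> 'f" where "\<psi> \<noteq> 0" "\<And>x. x \<notin> M <#> K \<Longrightarrow> \<psi> x = 0" "coset_sum G M \<psi> = 0"
    "\<And>N. N \<lhd> G \<Longrightarrow> coset_sum G N \<phi> = 0 \<Longrightarrow> coset_sum G N \<psi> = 0"
proof -
  obtain m where m: "m \<in> M" "m \<noteq> \<one>" using M1 normalD(2)[OF M] by blast
  note mc = normalD(3)[OF M m(1)]
  define \<psi> where "\<psi> x = (if x \<in> carrier G then \<phi> x - \<phi> (x \<otimes> inv m) else 0)" for x
  have MK: "M <#> K = K <#> M" by (rule commut_normal[OF normal_imp_subgroup[OF M] K])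
  obtain k where k: "\<phi> k \<noteq> 0" using nz by (rule function_nonzeroE)
  have kK: "k \<in> K" using k s by blast
  note kc = normalD(3)[OF K kK]
  have "k \<otimes> inv m \<notin> K"
  proof
    assume "k \<otimes> inv m \<in> K"
    then have "inv k \<otimes> (k \<otimes> inv m) \<in> K" by (rule normalD(4)[OF K normalD(5)[OF K kK]])
    then have "inv m \<in> K" using kc mc by (simp add: inv_cancel)
    then have "m \<in> K" using normalD(5)[OF K, of "inv m"] mc by simp
    then show False using m I by blast
  qed
  then have "\<psi> k \<noteq> 0" using s k kc by (simp add: \<psi>_def)
  then have "\<psi> \<noteq> 0" by (rule function_nonzeroI)
  moreover have "\<psi> x = 0" if x: "x \<notin> M <#> K" for x
  proof (cases "x \<in> carrier G")
    case True
    have "x \<notin> K" using x subset_set_mult(2)[OF M K] by auto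
    moreover have "x \<otimes> inv m \<notin> K"
    proof
      assume "x \<otimes> inv m \<in> K"
      then have "(x \<otimes> inv m) \<otimes> m \<in> M <#> K" unfolding MK by (rule set_multI[OF _ m(1)])
      then show False using x True mc by (simp add: m_assoc)
    qed
    ultimately show ?thesis using s by (simp add: \<psi>_def)
  qed (simp add: \<psi>_def)
  moreover have "coset_sum G M \<psi> = 0"
  proof
    fix x
    show "coset_sum G M \<psi> x = 0 x"
    proof (cases "x \<in> carrier G")
      case True
      \<comment> \<open>\<open>n x m\<inverse> = (n q) x\<close>: right translation by \<open>m\<close> permutes each coset of \<open>M\<close>\<close>
      define q where "q = x \<otimes> inv m \<otimes> inv x"
      have q: "q \<in> M" unfolding q_def by (rule normalD(6)[OF M True normalD(5)[OF M m(1)]])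
      note qc = normalD(3)[OF M q]
      have nc: "n \<in> carrier G" if "n \<in> M" for n using normalD(3)[OF M that] .
      have "(\<Sum>n\<in>M. \<phi> (n \<otimes> x \<otimes> inv m)) = (\<Sum>n\<in>M. \<phi> (n \<otimes> x))"
      proof (rule sum.reindex_bij_witness[of _ "\<lambda>n. n \<otimes> inv q" "\<lambda>n. n \<otimes> q"])
        fix n assume n: "n \<in> M"
        show "(n \<otimes> q) \<otimes> inv q = n" "(n \<otimes> inv q) \<otimes> q = n" using qc nc[OF n] by (simp_all add: m_assoc)
        show "n \<otimes> q \<in> M" "n \<otimes> inv q \<in> M" using n q normalD(4,5)[OF M] by auto
        show "\<phi> ((n \<otimes> q) \<otimes> x) = \<phi> (n \<otimes> x \<otimes> inv m)"
          unfolding q_def using nc[OF n] True mc by (simp add: m_assoc)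
      qed
      moreover have "(\<Sum>n\<in>M. \<psi> (n \<otimes> x)) = (\<Sum>n\<in>M. \<phi> (n \<otimes> x) - \<phi> (n \<otimes> x \<otimes> inv m))"
        by (rule sum.cong[OF refl]) (use nc True in \<open>simp add: \<psi>_def\<close>)
      ultimately show ?thesis using True by (simp add: coset_sum_def sum_subtractf)
    qed (simp add: coset_sum_def)
  qed
  moreover have "coset_sum G N \<psi> = 0" if N: "N \<lhd> G" and z: "coset_sum G N \<phi> = 0" for N
  proof
    fix x
    show "coset_sum G N \<psi> x = 0 x"
    proof (cases "x \<in> carrier G")
      case True
      have nc: "n \<in> carrier G" if "n \<in> N" for n using normalD(3)[OF N that] .
      have e: "(\<Sum>n\<in>N. \<phi> (n \<otimes> y)) = 0" if "y \<in> carrier G" for y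
        using fun_cong[OF z, of y] that by (simp add: coset_sum_def)
      have "(\<Sum>n\<in>N. \<psi> (n \<otimes> x)) = (\<Sum>n\<in>N. \<phi> (n \<otimes> x) - \<phi> (n \<otimes> (x \<otimes> inv m)))"
        by (rule sum.cong[OF refl]) (use nc True mc in \<open>simp add: \<psi>_def m_assoc\<close>)
      also have "\<dots> = 0" using e[OF True] e[of "x \<otimes> inv m"] True mc by (simp add: sum_subtractf)
      finally show ?thesis using True by (simp add: coset_sum_def)
    qed (simp add: coset_sum_def)
  qed
  ultimately show thesis using that by blast
qed

text \<open>From the group to the socle: right translate so that the value at \<open>1\<close> is not zero, and restrict. From the
  socle to the group: treat the nonabelian minimal normal subgroups one by one, enlarging the support \<open>K\<close> each time. A
  remaining nonabelian \<open>N\<close> still meets the enlarged support \<open>MK\<close> trivially: otherwise \<open>N \<subseteq> MK\<close>, but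
  \<open>N\<close> centralizes \<open>M\<close> and \<open>K\<close> and would be abelian.\<close>
lemma null_functions_SocA:
  assumes fin: "finite (carrier G)"
  shows "(\<exists>\<phi>\<in>null_functions G (carrier G). \<phi> \<noteq> (0 :: 'a \<Rightarrow> 'f::field)) \<longleftrightarrow>
    (\<exists>\<phi>\<in>null_functions G (SocA G). \<phi> \<noteq> (0 :: 'a \<Rightarrow> 'f))"
proof
  let ?A = "SocA G"
  have A: "direct_abelian G ?A" by (rule SocA_direct_abelian[OF fin])
  have An: "?A \<lhd> G" by (rule direct_abelian_normal[OF A])
  {
    assume "\<exists>\<phi>\<in>null_functions G (carrier G). \<phi> \<noteq> (0 :: 'a \<Rightarrow> 'f)"
    then obtain \<phi> :: "'a \<Rightarrow> 'f" where p: "\<phi> \<in> null_functions G (carrier G)" "\<phi> \<noteq> 0" by blast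
    obtain a where a: "\<phi> a \<noteq> 0" using p(2) by (rule function_nonzeroE)
    have ac: "a \<in> carrier G" using a p(1) unfolding null_functions_def by blast
    define \<psi> where "\<psi> x = (if x \<in> ?A then \<phi> (x \<otimes> a) else 0)" for x
    have "\<psi> \<one> = \<phi> a" using normalD(2)[OF An] ac by (simp add: \<psi>_def)
    then have "\<psi> \<noteq> 0" using a by (intro function_nonzeroI[of _ \<one>]) simp
    moreover have "\<psi> \<in> null_functions G ?A"
    proof -
      have "coset_sum G M \<psi> = 0" if M: "minimal_normal M G" "M \<subseteq> ?A" for M
      proof
        fix x
        have Mn: "M \<lhd> G" using M by (simp add: minimal_normal_def)
        have z: "coset_sum G M \<phi> = 0" using p(1) M(1) normalD(1)[OF Mn] unfolding null_functions_def by blast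
        show "coset_sum G M \<psi> x = 0 x"
        proof (cases "x \<in> ?A")
          case True
          note xc = normalD(3)[OF An True]
          have "(\<Sum>m\<in>M. \<psi> (m \<otimes> x)) = (\<Sum>m\<in>M. \<phi> (m \<otimes> (x \<otimes> a)))"
          proof (rule sum.cong[OF refl])
            fix m assume "m \<in> M"
            then have "m \<in> ?A" using M(2) by auto
            then show "\<psi> (m \<otimes> x) = \<phi> (m \<otimes> (x \<otimes> a))"
              using normalD(4)[OF An _ True] normalD(3)[OF An] xc ac by (simp add: \<psi>_def m_assoc)
          qed
          also have "\<dots> = 0" using fun_cong[OF z, of "x \<otimes> a"] xc ac by (simp add: coset_sum_def)
          finally show ?thesis using xc by (simp add: coset_sum_def)
        next
          case False
          have "coset_sum G M \<psi> x = 0"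
            by (rule coset_sum_support[OF An M(2) _ False]) (simp add: \<psi>_def)
          then show ?thesis by simp
        qed
      qed
      moreover have "\<psi> x = 0" if "x \<notin> ?A" for x using that by (simp add: \<psi>_def)
      ultimately show ?thesis unfolding null_functions_def by blast
    qed
    ultimately show "\<exists>\<phi>\<in>null_functions G ?A. \<phi> \<noteq> (0 :: 'a \<Rightarrow> 'f)" by blast
  }
  assume "\<exists>\<phi>\<in>null_functions G ?A. \<phi> \<noteq> (0 :: 'a \<Rightarrow> 'f)"
  then obtain \<phi> :: "'a \<Rightarrow> 'f" where p: "\<phi> \<in> null_functions G ?A" "\<phi> \<noteq> 0" by blast
  let ?ab = "\<lambda>M. \<forall>x\<in>M. \<forall>y\<in>M. x \<otimes> y = y \<otimes> x"
  define F where "F = {M. minimal_normal M G \<and> \<not> ?ab M}"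
  have "F \<subseteq> Pow (carrier G)" using normalD(1) unfolding F_def minimal_normal_def by blast
  then have finF: "finite F" using fin finite_subset by blast
  have SocA_ab: "M \<subseteq> ?A" if M: "minimal_normal M G" "?ab M" for M
  proof -
    have Mn: "M \<lhd> G" using M by (simp add: minimal_normal_def)
    have "group (G\<lparr>carrier := M\<rparr>)" by (rule subgroup_imp_group[OF normal_imp_subgroup[OF Mn]])
    then have "comm_group (G\<lparr>carrier := M\<rparr>)" using M(2) by (intro group.group_comm_groupI) auto
    then have "M \<subseteq> \<Union>{N. minimal_normal N G \<and> comm_group (G\<lparr>carrier := N\<rparr>)}" using M(1) by blast
    then show ?thesis unfolding SocA_def by (intro subsetI generate.incl) (rule subsetD)
  qed
  \<comment> \<open>\<open>E\<close> collects the nonabelian minimal normal subgroups already treated; the last conjunct lets the next one be added\<close>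
  have "\<exists>\<psi> K. \<psi> \<noteq> (0 :: 'a \<Rightarrow> 'f) \<and> K \<lhd> G \<and> (\<forall>x. x \<notin> K \<longrightarrow> \<psi> x = 0) \<and>
      (\<forall>M. minimal_normal M G \<and> ?ab M \<longrightarrow> coset_sum G M \<psi> = 0) \<and>
      (\<forall>M\<in>E. coset_sum G M \<psi> = 0) \<and> (\<forall>M\<in>F - E. M \<inter> K = {\<one>})" if "finite E" "E \<subseteq> F" for E
    using that
  proof (induction E rule: finite_induct)
    case empty
    have "M \<inter> ?A = {\<one>}" if M: "M \<in> F" for M
    proof -
      have "\<not> M \<subseteq> ?A" using M direct_abelian_commute[OF A] unfolding F_def by blast
      then show ?thesis using M minimal_normal_Int[OF _ An] unfolding F_def by blast
    qed
    moreover have "coset_sum G M \<phi> = 0" if "minimal_normal M G \<and> ?ab M" for M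
      using that SocA_ab p(1) unfolding null_functions_def by blast
    moreover have "\<phi> x = 0" if "x \<notin> ?A" for x using p(1) that unfolding null_functions_def by blast
    ultimately show ?case using p(2) An by (intro exI[of _ \<phi>] exI[of _ ?A]) blast
  next
    case (insert M E)
    then obtain \<psi> :: "'a \<Rightarrow> 'f" and K where q: "\<psi> \<noteq> 0" "K \<lhd> G" "\<And>x. x \<notin> K \<Longrightarrow> \<psi> x = 0"
      "\<And>M. minimal_normal M G \<Longrightarrow> ?ab M \<Longrightarrow> coset_sum G M \<psi> = 0"
      "\<And>M. M \<in> E \<Longrightarrow> coset_sum G M \<psi> = 0" "\<And>M. M \<in> F - E \<Longrightarrow> M \<inter> K = {\<one>}"
      by (auto simp del: zero_fun_apply)
    have MF: "minimal_normal M G" "M \<lhd> G" "M \<noteq> {\<one>}" "M \<in> F" using insert.prems unfolding F_def minimal_normal_def by auto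
    have MK: "M \<inter> K = {\<one>}" using q(6) insert by blast
    obtain \<psi>' :: "'a \<Rightarrow> 'f" where r: "\<psi>' \<noteq> 0" "\<And>x. x \<notin> M <#> K \<Longrightarrow> \<psi>' x = 0" "coset_sum G M \<psi>' = 0"
      "\<And>N. N \<lhd> G \<Longrightarrow> coset_sum G N \<psi> = 0 \<Longrightarrow> coset_sum G N \<psi>' = 0"
      using extend_null_function[OF q(2) MF(2) MK MF(3) q(3) q(1)] by blast
    note MKn = normal_set_mult[OF MF(2) q(2)]
    have "N \<inter> (M <#> K) = {\<one>}" if N: "N \<in> F - insert M E" for N
    proof (rule minimal_normal_Int[OF _ MKn])
      show Nm: "minimal_normal N G" using N unfolding F_def by blast
      then have Nn: "N \<lhd> G" by (simp add: minimal_normal_def)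
      have NK: "N \<inter> K = {\<one>}" using q(6) N by blast
      have NM: "N \<inter> M = {\<one>}"
        using minimal_normal_Int[OF Nm MF(2)] minimal_normal_subset_eq[OF Nm MF(1)] N by blast
      show "\<not> N \<subseteq> M <#> K"
      proof
        assume sub: "N \<subseteq> M <#> K"
        have "x \<otimes> y = y \<otimes> x" if x: "x \<in> N" and y: "y \<in> N" for x y
        proof -
          obtain a b where ab: "a \<in> M" "b \<in> K" "y = a \<otimes> b" using y sub by (meson set_multE subsetD)
          note c = normalD(3)[OF Nn x] normalD(3)[OF MF(2) ab(1)] normalD(3)[OF q(2) ab(2)]
          have e: "x \<otimes> a = a \<otimes> x" "x \<otimes> b = b \<otimes> x"
            using normal_commute[OF Nn MF(2) NM x ab(1)] normal_commute[OF Nn q(2) NK x ab(2)] .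
          have "x \<otimes> y = (x \<otimes> a) \<otimes> b" unfolding ab(3) using c by (simp add: m_assoc)
          also have "\<dots> = a \<otimes> (x \<otimes> b)" unfolding e(1) using c by (simp add: m_assoc)
          also have "\<dots> = a \<otimes> (b \<otimes> x)" by (simp only: e(2))
          also have "\<dots> = y \<otimes> x" unfolding ab(3) using c by (simp add: m_assoc)
          finally show ?thesis .
        qed
        then show False using N unfolding F_def by blast
      qed
    qed
    moreover have "coset_sum G N \<psi>' = 0" if N: "minimal_normal N G \<and> ?ab N" for N
    proof (rule r(4))
      show "N \<lhd> G" using N by (simp add: minimal_normal_def)
      show "coset_sum G N \<psi> = 0" using N by (intro q(4)) simp_all
    qed
    moreover have "coset_sum G N \<psi>' = 0" if "N \<in> insert M E" for N
    proof (cases "N = M")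
      case True
      show ?thesis unfolding True by (rule r(3))
    next
      case False
      then have NE: "N \<in> E" using that by blast
      then have "N \<lhd> G" using insert.prems unfolding F_def minimal_normal_def by blast
      then show ?thesis by (rule r(4)[OF _ q(5)[OF NE]])
    qed
    ultimately show ?case using r(1,2) MKn
      by (intro exI[of _ \<psi>'] exI[of _ "M <#> K"] conjI allI ballI impI) blast+
  qed
  from this[OF finF subset_refl] obtain \<psi> :: "'a \<Rightarrow> 'f" and K where q: "\<psi> \<noteq> 0" "K \<lhd> G"
    "\<And>x. x \<notin> K \<Longrightarrow> \<psi> x = 0" "\<And>M. minimal_normal M G \<Longrightarrow> ?ab M \<Longrightarrow> coset_sum G M \<psi> = 0"
    "\<And>M. M \<in> F \<Longrightarrow> coset_sum G M \<psi> = 0"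
    by (auto simp del: zero_fun_apply)
  have "\<psi> \<in> null_functions G (carrier G)"
    using q normalD(1)[OF q(2)] unfolding null_functions_def F_def by blast
  then show "\<exists>\<phi>\<in>null_functions G (carrier G). \<phi> \<noteq> (0 :: 'a \<Rightarrow> 'f)" using q(1) by blast
qed

theorem null_functions_iff_single_class:
  assumes fin: "finite (carrier G)" and char: "\<not> CHAR('f::field) dvd Coset.order G"
  shows "(\<exists>\<phi>\<in>null_functions G (carrier G). \<phi> \<noteq> (0 :: 'a \<Rightarrow> 'f)) \<longleftrightarrow> generated_by_single_class (SocA G) G"
  unfolding null_functions_SocA[OF fin]
    null_functions_direct_abelian[OF fin char SocA_direct_abelian[OF fin]]
  by (simp add: generated_by_single_class_def normal_closure_def)

end

section \<open>Faithful irreducible representations\<close>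

lemma subspace_vec_iff:
  "VectorSpace.subspace class_ring W (module_vec TYPE('f::field) n) \<longleftrightarrow>
   W \<subseteq> carrier_vec n \<and> 0\<^sub>v n \<in> W \<and> (\<forall>v\<in>W. \<forall>w\<in>W. v + w \<in> W) \<and> (\<forall>c. \<forall>v\<in>W. c \<cdot>\<^sub>v v \<in> W)"
proof -
  interpret vec_space "TYPE('f)" n .
  show ?thesis
    unfolding VectorSpace.subspace_def submodule_def
    using vectorspace_axioms module_axioms by (auto simp: module_vec_simps class_ring_simps)
qed

lemma mat_eq_by_vec:
  assumes A: "A \<in> carrier_mat n n" and B: "B \<in> carrier_mat n n"
    and e: "\<And>v. v \<in> carrier_vec n \<Longrightarrow> A *\<^sub>v v = B *\<^sub>v v"
  shows "A = (B :: 'f::field mat)"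
proof (rule eq_matI)
  fix i j assume "i < dim_row B" "j < dim_col B"
  then have ij: "i < n" "j < n" using B by auto
  have "A $$ (i, j) = (A *\<^sub>v unit_vec n j) $ i" using A ij by simp
  also have "\<dots> = (B *\<^sub>v unit_vec n j) $ i" using e by simp
  also have "\<dots> = B $$ (i, j)" using B ij by simp
  finally show "A $$ (i, j) = B $$ (i, j)" .
qed (use A B in auto)

lemma mult_mat_zero_vec: "A \<in> carrier_mat n n \<Longrightarrow> A *\<^sub>v 0\<^sub>v n = (0\<^sub>v n :: 'f::field vec)"
  by (intro eq_vecI) (auto intro!: scalar_prod_right_zero)

lemma GL_simps:
  "carrier (GL TYPE('f::field) n) = {A \<in> carrier_mat n n. \<exists>B\<in>carrier_mat n n. B * A = 1\<^sub>m n \<and> A * B = 1\<^sub>m n}"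
  "monoid.mult (GL TYPE('f::field) n) = (*)" "one (GL TYPE('f::field) n) = 1\<^sub>m n"
  by (auto simp: units_of_def Units_def ring_mat_simps)

lemma GL_group: "group (GL TYPE('f::field) n)"
proof -
  interpret ring "ring_mat TYPE('f) n ()" by (rule ring_mat)
  show ?thesis by (rule units_group)
qed

context group
begin

lemma representationD:
  fixes \<sigma> :: "'a \<Rightarrow> 'f::field mat"
  assumes "representation G n \<sigma>"
  shows "g \<in> carrier G \<Longrightarrow> \<sigma> g \<in> carrier_mat n n"
    "g \<in> carrier G \<Longrightarrow> h \<in> carrier G \<Longrightarrow> \<sigma> (g \<otimes> h) = \<sigma> g * \<sigma> h"
    "\<sigma> \<one> = 1\<^sub>m n"
    "group_hom G (GL TYPE('f) n) \<sigma>"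
proof -
  have h: "\<sigma> \<in> hom G (GL TYPE('f) n)" using assms by (simp add: representation_def)
  then show "group_hom G (GL TYPE('f) n) \<sigma>"
    using is_group GL_group by (simp add: group_hom_def group_hom_axioms_def)
  from group_hom.hom_one[OF this] show "\<sigma> \<one> = 1\<^sub>m n" by (simp add: GL_simps)
  show "g \<in> carrier G \<Longrightarrow> \<sigma> g \<in> carrier_mat n n"
    using h unfolding hom_def GL_simps by blast
  show "g \<in> carrier G \<Longrightarrow> h \<in> carrier G \<Longrightarrow> \<sigma> (g \<otimes> h) = \<sigma> g * \<sigma> h"
    using h unfolding hom_def GL_simps by blast
qed

lemma representation_mult_vec:
  fixes \<sigma> :: "'a \<Rightarrow> 'f::field mat"
  assumes "representation G n \<sigma>" "g \<in> carrier G" "h \<in> carrier G" "v \<in> carrier_vec n"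
  shows "\<sigma> (g \<otimes> h) *\<^sub>v v = \<sigma> g *\<^sub>v (\<sigma> h *\<^sub>v v)"
  unfolding representationD(2)[OF assms(1-3)]
  by (rule assoc_mult_mat_vec[OF representationD(1)[OF assms(1,2)] representationD(1)[OF assms(1,3)] assms(4)])

lemma representationI:
  fixes \<sigma> :: "'a \<Rightarrow> 'f::field mat"
  assumes c: "\<And>g. g \<in> carrier G \<Longrightarrow> \<sigma> g \<in> carrier_mat n n"
    and m: "\<And>g h. g \<in> carrier G \<Longrightarrow> h \<in> carrier G \<Longrightarrow> \<sigma> (g \<otimes> h) = \<sigma> g * \<sigma> h"
    and o: "\<sigma> \<one> = 1\<^sub>m n"
  shows "representation G n \<sigma>"
  unfolding representation_def
proof (rule homI)
  fix g assume g: "g \<in> carrier G"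
  have "\<sigma> (inv g) * \<sigma> g = 1\<^sub>m n" "\<sigma> g * \<sigma> (inv g) = 1\<^sub>m n"
    using m[of "inv g" g] m[of g "inv g"] g o by simp_all
  then show "\<sigma> g \<in> carrier (GL TYPE('f) n)" unfolding GL_simps using c[OF g] c[of "inv g"] g by blast
qed (simp add: GL_simps m)

text \<open>The vectors fixed by a minimal normal \<open>M\<close> form an invariant subspace, which is zero as \<open>\<sigma>\<close> is faithful. The
  columns of \<open>\<Sum>\<^sub>m\<^sub>\<in>\<^sub>M \<sigma>(m)\<close> are such vectors, so this matrix is zero, and with it the coset sums of every
  matrix coefficient.\<close>
lemma null_function_of_faithful_irreducible:
  fixes \<sigma> :: "'a \<Rightarrow> 'f::field mat"
  assumes fin: "finite (carrier G)" and irr: "irreducible_representation G n \<sigma>"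
    and faith: "\<And>g. g \<in> carrier G \<Longrightarrow> \<sigma> g = 1\<^sub>m n \<Longrightarrow> g = \<one>"
  shows "\<exists>\<phi>\<in>null_functions G (carrier G). \<phi> \<noteq> (0 :: 'a \<Rightarrow> 'f)"
proof -
  have rep: "representation G n \<sigma>" and n: "0 < n"
    and inv: "\<And>W. invariant_subspace G n \<sigma> W \<Longrightarrow> W = {0\<^sub>v n} \<or> W = carrier_vec n"
    using irr by (auto simp: irreducible_representation_def)
  note r = representationD[OF rep]
  define \<phi> where "\<phi> x = (if x \<in> carrier G then \<sigma> x $$ (0, 0) else 0)" for x
  have "\<phi> \<one> \<noteq> 0" using n r(3) by (simp add: \<phi>_def)
  then have nz: "\<phi> \<noteq> 0" by (rule function_nonzeroI)
  have "coset_sum G M \<phi> = 0" if M: "minimal_normal M G" for M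
  proof -
    have Mn: "M \<lhd> G" and M1: "M \<noteq> {\<one>}" using M by (auto simp: minimal_normal_def)
    have Mc: "m \<in> carrier G" if "m \<in> M" for m using normalD(3)[OF Mn that] .
    define V where "V = {v \<in> carrier_vec n. \<forall>m\<in>M. \<sigma> m *\<^sub>v v = v}"
    have "invariant_subspace G n \<sigma> V"
      unfolding invariant_subspace_def subspace_vec_iff
    proof (intro conjI ballI allI)
      show "V \<subseteq> carrier_vec n" by (auto simp: V_def)
      show "0\<^sub>v n \<in> V" using mult_mat_zero_vec[OF r(1)] Mc by (simp add: V_def)
      show "v + w \<in> V" if "v \<in> V" "w \<in> V" for v w
        using that r(1) Mc by (auto simp: V_def mult_add_distrib_mat_vec[of _ n n])
      show "c \<cdot>\<^sub>v v \<in> V" if "v \<in> V" for c v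
        using that r(1) Mc by (auto simp: V_def mult_mat_vec[of _ n n])
      fix g v assume g: "g \<in> carrier G" and v: "v \<in> V"
      have vc: "v \<in> carrier_vec n" using v by (simp add: V_def)
      have "\<sigma> m *\<^sub>v (\<sigma> g *\<^sub>v v) = \<sigma> g *\<^sub>v v" if m: "m \<in> M" for m
      proof -
        define m' where "m' = inv g \<otimes> m \<otimes> inv (inv g)"
        have m': "m' \<in> M" unfolding m'_def by (rule normalD(6)[OF Mn inv_closed[OF g] m])
        have "\<sigma> m *\<^sub>v (\<sigma> g *\<^sub>v v) = \<sigma> (m \<otimes> g) *\<^sub>v v"
          by (rule representation_mult_vec[OF rep Mc[OF m] g vc, symmetric])
        also have "m \<otimes> g = g \<otimes> m'" unfolding m'_def using g Mc[OF m] by (simp add: m_assoc inv_cancel)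
        also have "\<sigma> (g \<otimes> m') *\<^sub>v v = \<sigma> g *\<^sub>v (\<sigma> m' *\<^sub>v v)"
          by (rule representation_mult_vec[OF rep g Mc[OF m'] vc])
        also have "\<sigma> m' *\<^sub>v v = v" using v m' by (simp add: V_def)
        finally show ?thesis .
      qed
      then show "\<sigma> g *\<^sub>v v \<in> V" using mult_mat_vec_carrier[OF r(1)[OF g] vc] by (simp add: V_def)
    qed
    then have "V = {0\<^sub>v n} \<or> V = carrier_vec n" by (rule inv)
    moreover have "V \<noteq> carrier_vec n"
    proof
      assume e: "V = carrier_vec n"
      have "m = \<one>" if m: "m \<in> M" for m
      proof (rule faith[OF Mc[OF m]], rule mat_eq_by_vec[OF r(1)[OF Mc[OF m]]])
        fix v :: "'f vec" assume v: "v \<in> carrier_vec n"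
        then have "v \<in> V" using e by simp
        then have "\<sigma> m *\<^sub>v v = v" using m unfolding V_def by blast
        then show "\<sigma> m *\<^sub>v v = 1\<^sub>m n *\<^sub>v v" using v by simp
      qed simp
      then show False using M1 normalD(2)[OF Mn] by blast
    qed
    ultimately have V0: "V = {0\<^sub>v n}" by blast
    have col: "(\<Sum>m\<in>M. \<sigma> m $$ (i, j)) = 0" if ij: "i < n" "j < n" for i j
    proof -
      define w where "w = vec n (\<lambda>i. \<Sum>m\<in>M. \<sigma> m $$ (i, j))"
      have "\<sigma> k *\<^sub>v w = w" if k: "k \<in> M" for k
      proof (rule eq_vecI)
        fix i assume "i < dim_vec w"
        then have i: "i < n" by (simp add: w_def)
        note kc = Mc[OF k]
        have "(\<sigma> k *\<^sub>v w) $ i = (\<Sum>l<n. \<sigma> k $$ (i, l) * (\<Sum>m\<in>M. \<sigma> m $$ (l, j)))"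
          using i r(1)[OF kc] by (simp add: w_def scalar_prod_def lessThan_atLeast0)
        also have "\<dots> = (\<Sum>l<n. \<Sum>m\<in>M. \<sigma> k $$ (i, l) * \<sigma> m $$ (l, j))"
          by (simp add: sum_distrib_left)
        also have "\<dots> = (\<Sum>m\<in>M. \<Sum>l<n. \<sigma> k $$ (i, l) * \<sigma> m $$ (l, j))"
          by (rule sum.swap)
        also have "\<dots> = (\<Sum>m\<in>M. \<sigma> (k \<otimes> m) $$ (i, j))"
        proof (rule sum.cong[OF refl])
          fix m assume m: "m \<in> M"
          show "(\<Sum>l<n. \<sigma> k $$ (i, l) * \<sigma> m $$ (l, j)) = \<sigma> (k \<otimes> m) $$ (i, j)"
            unfolding r(2)[OF kc Mc[OF m]]
            using i ij r(1)[OF kc] r(1)[OF Mc[OF m]] by (simp add: scalar_prod_def lessThan_atLeast0)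
        qed
        also have "\<dots> = (\<Sum>m\<in>M. \<sigma> m $$ (i, j))"
        proof (rule sum.reindex_bij_witness[of _ "\<lambda>m. inv k \<otimes> m" "\<lambda>m. k \<otimes> m"])
          fix m assume m: "m \<in> M"
          show "inv k \<otimes> (k \<otimes> m) = m" "k \<otimes> (inv k \<otimes> m) = m" using kc Mc[OF m] by (simp_all add: inv_cancel)
          show "k \<otimes> m \<in> M" "inv k \<otimes> m \<in> M" using k m normalD(4,5)[OF Mn] by auto
        qed simp
        finally show "(\<sigma> k *\<^sub>v w) $ i = w $ i" using i by (simp add: w_def)
      qed (use r(1)[OF Mc[OF k]] in \<open>simp add: w_def\<close>)
      then have "w \<in> V" unfolding V_def by (simp add: w_def)
      then have "w $ i = 0\<^sub>v n $ i" using V0 by auto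
      then show ?thesis using ij by (simp add: w_def)
    qed
    show ?thesis
    proof
      fix x
      show "coset_sum G M \<phi> x = 0 x"
      proof (cases "x \<in> carrier G")
        case True
        have "(\<Sum>m\<in>M. \<phi> (m \<otimes> x)) = (\<Sum>m\<in>M. \<Sum>l<n. \<sigma> m $$ (0, l) * \<sigma> x $$ (l, 0))"
        proof (rule sum.cong[OF refl])
          fix m assume m: "m \<in> M"
          have "\<phi> (m \<otimes> x) = (\<sigma> m * \<sigma> x) $$ (0, 0)" using r(2)[OF Mc[OF m] True] Mc[OF m] True by (simp add: \<phi>_def)
          then show "\<phi> (m \<otimes> x) = (\<Sum>l<n. \<sigma> m $$ (0, l) * \<sigma> x $$ (l, 0))"
            using n r(1)[OF Mc[OF m]] r(1)[OF True] by (simp add: scalar_prod_def lessThan_atLeast0)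
        qed
        also have "\<dots> = (\<Sum>l<n. \<Sum>m\<in>M. \<sigma> m $$ (0, l) * \<sigma> x $$ (l, 0))" by (rule sum.swap)
        also have "\<dots> = (\<Sum>l<n. (\<Sum>m\<in>M. \<sigma> m $$ (0, l)) * \<sigma> x $$ (l, 0))" by (simp add: sum_distrib_right)
        also have "\<dots> = 0" using col n by simp
        finally show ?thesis using True by (simp add: coset_sum_def)
      qed (simp add: coset_sum_def)
    qed
  qed
  then have "\<phi> \<in> null_functions G (carrier G)" unfolding null_functions_def by (simp add: \<phi>_def)
  then show ?thesis using nz by blast
qed

lemma left_translate_mult:
  assumes "g \<in> carrier G" "h \<in> carrier G"
  shows "left_translate G (g \<otimes> h) \<phi> = left_translate G g (left_translate G h \<phi>)"
  using assms by (auto simp: left_translate_def fun_eq_iff inv_mult_group m_assoc)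

lemma left_translate_one:
  assumes "\<And>x. x \<notin> carrier G \<Longrightarrow> \<phi> x = 0"
  shows "left_translate G \<one> \<phi> = \<phi>"
  using assms by (auto simp: left_translate_def fun_eq_iff)

definition translation_invariant :: "('a \<Rightarrow> 'f::field) set \<Rightarrow> bool" where
  "translation_invariant W \<longleftrightarrow> fun_space.subspace W \<and>
     (\<forall>g\<in>carrier G. \<forall>w\<in>W. left_translate G g w \<in> W)"

text \<open>The matrices of the translations with respect to a basis of \<open>W\<close>.\<close>
lemma representation_on_functions:
  fixes W :: "('a \<Rightarrow> 'f::field) set"
  assumes fin: "finite (carrier G)" and W: "translation_invariant W" and W0: "W \<noteq> {0}"
    and supp: "\<And>w x. w \<in> W \<Longrightarrow> x \<notin> carrier G \<Longrightarrow> w x = 0"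
    and min: "\<And>W'. translation_invariant W' \<Longrightarrow> W' \<subseteq> W \<Longrightarrow> W' = {0} \<or> W' = W"
  obtains n and \<sigma> :: "'a \<Rightarrow> 'f mat" where "irreducible_representation G n \<sigma>"
    "\<And>g w. g \<in> carrier G \<Longrightarrow> \<sigma> g = 1\<^sub>m n \<Longrightarrow> w \<in> W \<Longrightarrow> left_translate G g w = w"
proof -
  have Ws: "fun_space.subspace W" using W by (simp add: translation_invariant_def)
  have Wt: "left_translate G g w \<in> W" if "g \<in> carrier G" "w \<in> W" for g w
    using W that by (simp add: translation_invariant_def)
  obtain B where B: "finite B" "fun_space.independent B" "fun_space.span B = W"
    by (rule finite_support_subspace_basis[OF Ws fin]) (erule supp, assumption, blast)
  define n where "n = card B"
  obtain b where b: "bij_betw b {..<n} B"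
    using ex_bij_betw_nat_finite[OF B(1)] unfolding n_def lessThan_atLeast0 by blast
  have bB: "b i \<in> B" if "i < n" for i using b that unfolding bij_betw_def by blast
  have bW: "b i \<in> W" if "i < n" for i using bB[OF that] B(3) fun_space.span_base by blast
  have binj: "b i = b j \<longleftrightarrow> i = j" if "i < n" "j < n" for i j
    using b that unfolding bij_betw_def inj_on_def by blast
  \<comment> \<open>the coordinate isomorphism from column vectors to \<open>W\<close>, with inverse \<open>cf\<close>\<close>
  define \<Lambda> where "\<Lambda> v = (\<Sum>i<n. fscale (v $ i) (b i))" for v :: "'f vec"
  define cf where "cf w i = fun_space.representation B w (b i)" for w i
  have \<Lambda>W: "\<Lambda> v \<in> W" for v
    unfolding \<Lambda>_def using Ws bW by (intro fun_space.subspace_sum fun_space.subspace_scale) auto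
  have cf_\<Lambda>: "cf (\<Lambda> v) i = v $ i" if i: "i < n" for v i
  proof -
    have "fun_space.representation B (\<Lambda> v) = (\<lambda>c. \<Sum>j<n. fun_space.representation B (fscale (v $ j) (b j)) c)"
      unfolding \<Lambda>_def using bB by (intro fun_space.representation_sum[OF B(2)] fun_space.span_scale fun_space.span_base) auto
    then have "cf (\<Lambda> v) i = (\<Sum>j<n. fun_space.representation B (fscale (v $ j) (b j)) (b i))"
      by (simp add: cf_def)
    also have "\<dots> = (\<Sum>j<n. if j = i then v $ j else 0)"
    proof (rule sum.cong[OF refl])
      fix j assume "j \<in> {..<n}"
      then have j: "j < n" by simp
      show "fun_space.representation B (fscale (v $ j) (b j)) (b i) = (if j = i then v $ j else 0)"
        using binj[OF i j] fun_space.span_base[OF bB[OF j]]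
        by (auto simp: fun_space.representation_scale[OF B(2)] fun_space.representation_basis[OF B(2) bB[OF j]])
    qed
    finally show ?thesis using i by simp
  qed
  have \<Lambda>_cf: "\<Lambda> (vec n (cf w)) = w" if w: "w \<in> W" for w
  proof -
    have "\<Lambda> (vec n (cf w)) = (\<Sum>i<n. fscale (fun_space.representation B w (b i)) (b i))"
      unfolding \<Lambda>_def cf_def by (rule sum.cong) auto
    also have "\<dots> = (\<Sum>c\<in>B. fscale (fun_space.representation B w c) c)"
      by (rule sum.reindex_bij_betw[OF b])
    also have "\<dots> = w"
      using w B by (intro fun_space.sum_representation_eq) auto
    finally show ?thesis .
  qed
  have \<Lambda>_inj: "v = v'" if "v \<in> carrier_vec n" "v' \<in> carrier_vec n" "\<Lambda> v = \<Lambda> v'" for v v'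
  proof (rule eq_vecI)
    show "v $ i = v' $ i" if "i < dim_vec v'" for i
      using cf_\<Lambda>[of i v] cf_\<Lambda>[of i v'] that \<open>v' \<in> carrier_vec n\<close> \<open>\<Lambda> v = \<Lambda> v'\<close> by auto
  qed (use that in auto)
  have \<Lambda>_add: "\<Lambda> (v + w) = \<Lambda> v + \<Lambda> w" if "v \<in> carrier_vec n" "w \<in> carrier_vec n" for v w
    unfolding \<Lambda>_def sum.distrib[symmetric] using that
    by (intro sum.cong refl) (auto simp: fun_space.scale_left_distrib)
  have \<Lambda>_smult: "\<Lambda> (c \<cdot>\<^sub>v v) = fscale c (\<Lambda> v)" if "v \<in> carrier_vec n" for c v
    unfolding \<Lambda>_def fun_space.scale_sum_right using that
    by (intro sum.cong refl) auto
  have \<Lambda>_zero: "\<Lambda> (0\<^sub>v n) = 0"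
    unfolding \<Lambda>_def by (intro sum.neutral) (auto simp: fscale_def)
  define \<sigma> where "\<sigma> g = mat n n (\<lambda>(i, j). cf (left_translate G g (b j)) i)" for g
  have \<sigma>c: "\<sigma> g \<in> carrier_mat n n" for g by (simp add: \<sigma>_def)
  have act: "\<Lambda> (\<sigma> g *\<^sub>v v) = left_translate G g (\<Lambda> v)" if g: "g \<in> carrier G" and v: "v \<in> carrier_vec n" for g v
  proof -
    interpret l: Vector_Spaces.linear fscale fscale "left_translate G g" by (rule linear_left_translate)
    have "\<Lambda> (\<sigma> g *\<^sub>v v) = (\<Sum>i<n. fscale (\<Sum>j<n. cf (left_translate G g (b j)) i * v $ j) (b i))"
      unfolding \<Lambda>_def
    proof (rule sum.cong[OF refl])
      fix i assume "i \<in> {..<n}"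
      then have "(\<sigma> g *\<^sub>v v) $ i = (\<Sum>j<n. cf (left_translate G g (b j)) i * v $ j)"
        using v by (simp add: \<sigma>_def scalar_prod_def lessThan_atLeast0)
      then show "fscale ((\<sigma> g *\<^sub>v v) $ i) (b i) = fscale (\<Sum>j<n. cf (left_translate G g (b j)) i * v $ j) (b i)" by simp
    qed
    also have "\<dots> = (\<Sum>i<n. \<Sum>j<n. fscale (v $ j) (fscale (cf (left_translate G g (b j)) i) (b i)))"
      by (simp add: fun_space.scale_sum_left mult.commute)
    also have "\<dots> = (\<Sum>j<n. \<Sum>i<n. fscale (v $ j) (fscale (cf (left_translate G g (b j)) i) (b i)))"
      by (rule sum.swap)
    also have "\<dots> = (\<Sum>j<n. fscale (v $ j) (\<Lambda> (vec n (cf (left_translate G g (b j))))))"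
      unfolding \<Lambda>_def by (intro sum.cong refl) (simp add: fun_space.scale_sum_right)
    also have "\<dots> = (\<Sum>j<n. fscale (v $ j) (left_translate G g (b j)))"
      by (intro sum.cong refl) (simp add: \<Lambda>_cf Wt[OF g bW])
    also have "\<dots> = left_translate G g (\<Lambda> v)" unfolding \<Lambda>_def by (simp add: l.sum l.scale)
    finally show ?thesis .
  qed
  have one: "left_translate G \<one> w = w" if "w \<in> W" for w
    by (rule left_translate_one) (rule supp[OF that])
  have rep: "representation G n \<sigma>"
  proof (rule representationI[OF \<sigma>c])
    fix g h assume g: "g \<in> carrier G" and h: "h \<in> carrier G"
    show "\<sigma> (g \<otimes> h) = \<sigma> g * \<sigma> h"
    proof (rule mat_eq_by_vec[OF \<sigma>c mult_carrier_mat[OF \<sigma>c \<sigma>c]])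
      fix v :: "'f vec" assume v: "v \<in> carrier_vec n"
      have hv: "\<sigma> h *\<^sub>v v \<in> carrier_vec n" by (rule mult_mat_vec_carrier[OF \<sigma>c v])
      have "\<Lambda> (\<sigma> (g \<otimes> h) *\<^sub>v v) = \<Lambda> (\<sigma> g *\<^sub>v (\<sigma> h *\<^sub>v v))"
        using act[OF m_closed[OF g h] v] act[OF g hv] act[OF h v] left_translate_mult[OF g h] by simp
      then have "\<sigma> (g \<otimes> h) *\<^sub>v v = \<sigma> g *\<^sub>v (\<sigma> h *\<^sub>v v)"
        by (rule \<Lambda>_inj[OF mult_mat_vec_carrier[OF \<sigma>c v] mult_mat_vec_carrier[OF \<sigma>c hv]])
      then show "\<sigma> (g \<otimes> h) *\<^sub>v v = (\<sigma> g * \<sigma> h) *\<^sub>v v" using assoc_mult_mat_vec[OF \<sigma>c \<sigma>c v] by simp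
    qed
  next
    show "\<sigma> \<one> = 1\<^sub>m n"
    proof (rule mat_eq_by_vec[OF \<sigma>c one_carrier_mat])
      fix v :: "'f vec" assume v: "v \<in> carrier_vec n"
      have "\<Lambda> (\<sigma> \<one> *\<^sub>v v) = \<Lambda> v" using act[OF one_closed v] one[OF \<Lambda>W] by simp
      then have "\<sigma> \<one> *\<^sub>v v = v" by (rule \<Lambda>_inj[OF mult_mat_vec_carrier[OF \<sigma>c v] v])
      then show "\<sigma> \<one> *\<^sub>v v = 1\<^sub>m n *\<^sub>v v" using v by simp
    qed
  qed
  have pos: "0 < n"
  proof (rule ccontr)
    assume "\<not> 0 < n"
    then have "B = {}" using B(1) by (simp add: n_def)
    then show False using B(3) W0 by simp
  qed
  have "V = {0\<^sub>v n} \<or> V = carrier_vec n" if V: "invariant_subspace G n \<sigma> V" for V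
  proof -
    have Vc: "V \<subseteq> carrier_vec n" "0\<^sub>v n \<in> V" "\<And>v w. v \<in> V \<Longrightarrow> w \<in> V \<Longrightarrow> v + w \<in> V"
      "\<And>c v. v \<in> V \<Longrightarrow> c \<cdot>\<^sub>v v \<in> V" "\<And>g v. g \<in> carrier G \<Longrightarrow> v \<in> V \<Longrightarrow> \<sigma> g *\<^sub>v v \<in> V"
      using V unfolding invariant_subspace_def subspace_vec_iff by blast+
    have Vc': "v \<in> V \<Longrightarrow> v \<in> carrier_vec n" for v using Vc(1) by blast
    have "translation_invariant (\<Lambda> ` V)"
      unfolding translation_invariant_def fun_space.subspace_def
    proof (intro conjI ballI allI)
      show "0 \<in> \<Lambda> ` V" using Vc(2) \<Lambda>_zero by (metis image_eqI)
      show "x + y \<in> \<Lambda> ` V" if "x \<in> \<Lambda> ` V" "y \<in> \<Lambda> ` V" for x y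
        using that
      proof (elim imageE)
        fix v w assume vw: "x = \<Lambda> v" "v \<in> V" "y = \<Lambda> w" "w \<in> V"
        then have "x + y = \<Lambda> (v + w)" using \<Lambda>_add[OF Vc' Vc', of v w] by simp
        then show "x + y \<in> \<Lambda> ` V" using Vc(3)[OF vw(2,4)] by (rule image_eqI)
      qed
      show "fscale c x \<in> \<Lambda> ` V" if "x \<in> \<Lambda> ` V" for c x
        using that
      proof (elim imageE)
        fix v assume v: "x = \<Lambda> v" "v \<in> V"
        then have "fscale c x = \<Lambda> (c \<cdot>\<^sub>v v)" using \<Lambda>_smult[OF Vc', of v c] by simp
        then show "fscale c x \<in> \<Lambda> ` V" using Vc(4)[OF v(2)] by (rule image_eqI)
      qed
      fix g x assume g: "g \<in> carrier G" and "x \<in> \<Lambda> ` V"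
      then obtain v where v: "v \<in> V" "x = \<Lambda> v" by blast
      have "left_translate G g x = \<Lambda> (\<sigma> g *\<^sub>v v)" using act[OF g Vc'[OF v(1)]] v(2) by simp
      then show "left_translate G g x \<in> \<Lambda> ` V" using Vc(5)[OF g v(1)] by (rule image_eqI)
    qed
    then have "\<Lambda> ` V = {0} \<or> \<Lambda> ` V = W"
      by (rule min) (rule image_subsetI, rule \<Lambda>W)
    then consider "\<Lambda> ` V = {0}" | "\<Lambda> ` V = W" by auto
    then show ?thesis
    proof cases
      case 1
      have "v = 0\<^sub>v n" if v: "v \<in> V" for v
      proof -
        have "\<Lambda> v \<in> {0}" unfolding 1[symmetric] using v by (rule imageI)
        then have "\<Lambda> v = \<Lambda> (0\<^sub>v n)" using \<Lambda>_zero by (simp only: singleton_iff)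
        then show ?thesis by (rule \<Lambda>_inj[OF Vc'[OF v] zero_carrier_vec])
      qed
      then show ?thesis using Vc(2) by blast
    next
      case 2
      have "v \<in> V" if v: "v \<in> carrier_vec n" for v
      proof -
        have "\<Lambda> v \<in> \<Lambda> ` V" unfolding 2 by (rule \<Lambda>W)
        then obtain u where u: "u \<in> V" "\<Lambda> v = \<Lambda> u" by (elim imageE)
        then have "v = u" by (intro \<Lambda>_inj[OF v Vc'])
        then show ?thesis using u(1) by simp
      qed
      then show ?thesis using Vc(1) by blast
    qed
  qed
  then have "irreducible_representation G n \<sigma>"
    using rep pos by (simp add: irreducible_representation_def)
  moreover have "left_translate G g w = w" if g: "g \<in> carrier G" "\<sigma> g = 1\<^sub>m n" and w: "w \<in> W" for g w
    using act[OF g(1), of "vec n (cf w)"] \<Lambda>_cf[OF w] g(2) by simp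
  ultimately show thesis using that by blast
qed

lemma minimal_translation_invariant:
  fixes U :: "('a \<Rightarrow> 'f::field) set"
  assumes fin: "finite (carrier G)" and U: "translation_invariant U" and U0: "U \<noteq> {0}"
    and supp: "\<And>w x. w \<in> U \<Longrightarrow> x \<notin> carrier G \<Longrightarrow> w x = 0"
  obtains W where "translation_invariant W" "W \<subseteq> U" "W \<noteq> {0}"
    "\<And>W'. translation_invariant W' \<Longrightarrow> W' \<subseteq> W \<Longrightarrow> W' = {0} \<or> W' = W"
proof -
  let ?P = "\<lambda>W. translation_invariant W \<and> W \<subseteq> U \<and> W \<noteq> {0}"
  obtain W where W: "?P W" and least: "\<And>W'. ?P W' \<Longrightarrow> fun_space.dim W \<le> fun_space.dim W'"
    using ex_has_least_nat[of ?P U fun_space.dim] U U0 by blast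
  have Ws: "fun_space.subspace W" using W by (simp add: translation_invariant_def)
  have basis: "\<exists>B. finite B \<and> fun_space.independent B \<and> fun_space.span B = V \<and> card B = fun_space.dim V"
    if V: "fun_space.subspace V" "V \<subseteq> U" for V
  proof -
    have "w x = 0" if "w \<in> V" "x \<notin> carrier G" for w x using supp that V(2) by blast
    then obtain B where B: "finite B" "fun_space.independent B" "fun_space.span B = V"
      using finite_support_subspace_basis[OF V(1) fin] by blast
    then show ?thesis using fun_space.dim_span_eq_card_independent[OF B(2)] by metis
  qed
  have eq: "W' = W" if W': "translation_invariant W'" "W' \<subseteq> W" "W' \<noteq> {0}" for W'
  proof (rule ccontr)
    assume "W' \<noteq> W"
    then obtain y where y: "y \<in> W" "y \<notin> W'" using W'(2) by blast
    have Ws': "fun_space.subspace W'" using W' by (simp add: translation_invariant_def)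
    obtain B where B: "finite B" "fun_space.independent B" "fun_space.span B = W" "card B = fun_space.dim W"
      using basis[OF Ws] W by blast
    obtain B' where B': "finite B'" "fun_space.independent B'" "fun_space.span B' = W'" "card B' = fun_space.dim W'"
      using basis[OF Ws'] W W'(2) by blast
    have "fun_space.independent (insert y B')"
      using y(2) B'(2,3) by (intro fun_space.independent_insertI) auto
    moreover have "insert y B' \<subseteq> fun_space.span B"
      using y(1) B(3) B'(3) W'(2) fun_space.span_superset[of B'] by blast
    ultimately have "card (insert y B') \<le> card B" using fun_space.independent_span_bound[OF B(1)] by blast
    moreover have "y \<notin> B'" using y(2) B'(3) fun_space.span_base by blast
    ultimately have "fun_space.dim W' < fun_space.dim W" using B(4) B'(1,4) by simp
    moreover have "?P W'" using W W' by auto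
    ultimately show False using least[of W'] by simp
  qed
  show thesis
  proof (rule that[of W])
    show "translation_invariant W" "W \<subseteq> U" "W \<noteq> {0}" using W by auto
    show "W' = {0} \<or> W' = W" if "translation_invariant W'" "W' \<subseteq> W" for W'
      using eq[OF that] by argo
  qed
qed

text \<open>If a minimal normal \<open>M\<close> acted trivially on a nonzero space \<open>W\<close> of null functions, then
  \<open>0 = \<Sum>\<^sub>m\<^sub>\<in>\<^sub>M w(m x) = |M| w(x)\<close> for all \<open>w \<in> W\<close>, and \<open>|M|\<close> is invertible in the field.\<close>
theorem faithful_irreducible_iff_null_function:
  assumes fin: "finite (carrier G)" and char: "\<not> CHAR('f::field) dvd Coset.order G"
  shows "(\<exists>n (\<sigma> :: 'a \<Rightarrow> 'f mat). irreducible_representation G n \<sigma> \<and>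
      (\<forall>g\<in>carrier G. \<sigma> g = 1\<^sub>m n \<longrightarrow> g = \<one>)) \<longleftrightarrow>
    (\<exists>\<phi>\<in>null_functions G (carrier G). \<phi> \<noteq> (0 :: 'a \<Rightarrow> 'f))"
proof
  assume "\<exists>n (\<sigma> :: 'a \<Rightarrow> 'f mat). irreducible_representation G n \<sigma> \<and>
      (\<forall>g\<in>carrier G. \<sigma> g = 1\<^sub>m n \<longrightarrow> g = \<one>)"
  then show "\<exists>\<phi>\<in>null_functions G (carrier G). \<phi> \<noteq> (0 :: 'a \<Rightarrow> 'f)"
    using null_function_of_faithful_irreducible[OF fin] by blast
next
  assume ex: "\<exists>\<phi>\<in>null_functions G (carrier G). \<phi> \<noteq> (0 :: 'a \<Rightarrow> 'f)"
  let ?U = "null_functions G (carrier G) :: ('a \<Rightarrow> 'f) set"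
  have supp: "w x = 0" if "w \<in> ?U" "x \<notin> carrier G" for w x using that unfolding null_functions_def by blast
  have "left_translate G g w \<in> ?U" if g: "g \<in> carrier G" and w: "w \<in> ?U" for g w
  proof -
    have "coset_sum G M (left_translate G g w) = 0" if M: "minimal_normal M G" "M \<subseteq> carrier G" for M
    proof -
      have Mn: "M \<lhd> G" using M by (simp add: minimal_normal_def)
      have "coset_sum G M w = 0" using w M unfolding null_functions_def by blast
      then show ?thesis unfolding coset_sum_left_translate[OF Mn g] by (simp add: left_translate_def fun_eq_iff)
    qed
    moreover have "left_translate G g w x = 0" if "x \<notin> carrier G" for x using that by (simp add: left_translate_def)
    ultimately show ?thesis unfolding null_functions_def by blast
  qed
  then have Uinv: "translation_invariant ?U"
    using subspace_null_functions unfolding translation_invariant_def by blast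
  have U0: "?U \<noteq> {0}" using ex by blast
  obtain W where W: "translation_invariant W" "W \<subseteq> ?U" "W \<noteq> {0}"
    "\<And>W'. translation_invariant W' \<Longrightarrow> W' \<subseteq> W \<Longrightarrow> W' = {0} \<or> W' = W"
    by (rule minimal_translation_invariant[OF fin Uinv U0]) (erule supp, assumption, blast)
  have suppW: "w x = 0" if "w \<in> W" "x \<notin> carrier G" for w x using supp that W(2) by blast
  obtain n and \<sigma> :: "'a \<Rightarrow> 'f mat" where s: "irreducible_representation G n \<sigma>"
    "\<And>g w. g \<in> carrier G \<Longrightarrow> \<sigma> g = 1\<^sub>m n \<Longrightarrow> w \<in> W \<Longrightarrow> left_translate G g w = w"
    by (rule representation_on_functions[OF fin W(1,3)])
      (erule suppW, assumption, erule W(4), assumption, blast)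
  have rep: "representation G n \<sigma>" using s(1) by (simp add: irreducible_representation_def)
  let ?K = "kernel G (GL TYPE('f) n) \<sigma>"
  have K: "?K \<lhd> G" by (rule group_hom.normal_kernel[OF representationD(4)[OF rep]])
  have K_iff: "g \<in> ?K \<longleftrightarrow> g \<in> carrier G \<and> \<sigma> g = 1\<^sub>m n" for g by (simp add: kernel_def GL_simps)
  have "?K = {\<one>}"
  proof (rule ccontr)
    assume "?K \<noteq> {\<one>}"
    moreover have "finite ?K" using normalD(1)[OF K] fin finite_subset by blast
    ultimately obtain M where M: "M \<subseteq> ?K" "minimal_normal M G" using minimal_normal_exists[OF K] by blast
    have Mn: "M \<lhd> G" using M by (simp add: minimal_normal_def)
    have "w = 0" if w: "w \<in> W" for w
    proof
      fix x
      show "w x = 0 x"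
      proof (cases "x \<in> carrier G")
        case True
        have "w (m \<otimes> x) = w x" if m: "m \<in> M" for m
        proof -
          have i: "inv m \<in> ?K" using M(1) normalD(5)[OF Mn m] by blast
          have "left_translate G (inv m) w = w" using s(2) i w unfolding K_iff by blast
          from fun_cong[OF this, of x] show ?thesis using True normalD(3)[OF Mn m] by (simp add: left_translate_def)
        qed
        then have "coset_sum G M w x = of_nat (card M) * w x" using True by (simp add: coset_sum_def)
        moreover have "coset_sum G M w = 0"
          using w W(2) M(2) normalD(1)[OF Mn] unfolding null_functions_def by blast
        ultimately show ?thesis using card_normal_ne_zero[OF fin char Mn] by simp
      next
        case False
        then show ?thesis using suppW[OF w] by simp
      qed
    qed
    then have "W \<subseteq> {0}" by blast
    moreover have "0 \<in> W" using W(1) fun_space.subspace_0 unfolding translation_invariant_def by blast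
    ultimately show False using W(3) by blast
  qed
  then have "\<forall>g\<in>carrier G. \<sigma> g = 1\<^sub>m n \<longrightarrow> g = \<one>" using K_iff by blast
  then show "\<exists>n (\<sigma> :: 'a \<Rightarrow> 'f mat). irreducible_representation G n \<sigma> \<and>
      (\<forall>g\<in>carrier G. \<sigma> g = 1\<^sub>m n \<longrightarrow> g = \<one>)" using s(1) by blast
qed

end

section \<open>Finite abelian groups with few torsion elements\<close>

lemma (in comm_group) ord_mult_coprime:
  assumes a: "a \<in> carrier G" and b: "b \<in> carrier G" and co: "coprime (ord a) (ord b)"
  shows "ord (a \<otimes> b) = ord a * ord b"
proof (rule dvd_antisym)
  show "ord (a \<otimes> b) dvd ord a * ord b" by (rule abelian_ord_mul_divides[OF a b])
  have ab: "a \<otimes> b \<in> carrier G" using a b by simp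
  have dist: "(a \<otimes> b) [^] k = a [^] k \<otimes> b [^] k" for k :: nat by (rule nat_pow_distrib[OF a b])
  have "ord a dvd ord (a \<otimes> b)"
  proof -
    have "a [^] (ord (a \<otimes> b) * ord b) \<otimes> b [^] (ord (a \<otimes> b) * ord b) = \<one>"
      using pow_eq_id[OF ab, of "ord (a \<otimes> b) * ord b"] by (simp add: dist)
    moreover have "b [^] (ord (a \<otimes> b) * ord b) = \<one>" using pow_eq_id[OF b] by simp
    ultimately have "ord a dvd ord (a \<otimes> b) * ord b" using pow_eq_id[OF a] a by simp
    then show ?thesis using co coprime_dvd_mult_left_iff by blast
  qed
  moreover have "ord b dvd ord (a \<otimes> b)"
  proof -
    have "a [^] (ord (a \<otimes> b) * ord a) \<otimes> b [^] (ord (a \<otimes> b) * ord a) = \<one>"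
      using pow_eq_id[OF ab, of "ord (a \<otimes> b) * ord a"] by (simp add: dist)
    moreover have "a [^] (ord (a \<otimes> b) * ord a) = \<one>" using pow_eq_id[OF a] by simp
    ultimately have "ord b dvd ord (a \<otimes> b) * ord a" using pow_eq_id[OF b] b by simp
    then show ?thesis using co coprime_dvd_mult_left_iff coprime_commute by blast
  qed
  ultimately show "ord a * ord b dvd ord (a \<otimes> b)" using co divides_mult by blast
qed

text \<open>If \<open>c\<close> has maximal order and some prime power \<open>p\<^sup>i\<close> divides the order of \<open>x\<close> but not that of \<open>c\<close>, then
  replacing the \<open>p\<close>-part of \<open>c\<close> by an element of order \<open>p\<^sup>i\<close> gives a larger order.\<close>
lemma (in comm_group) exists_maximal_order:
  assumes fin: "finite (carrier G)"
  shows "\<exists>c\<in>carrier G. \<forall>x\<in>carrier G. ord x dvd ord c"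
proof -
  have ne: "ord ` carrier G \<noteq> {}" and f: "finite (ord ` carrier G)" using fin by auto
  obtain c where c: "c \<in> carrier G" "ord c = Max (ord ` carrier G)" using Max_in[OF f ne] by auto
  have max: "ord x \<le> ord c" if "x \<in> carrier G" for x using Max_ge[OF f] that c(2) by simp
  have pos: "ord x > 0" if "x \<in> carrier G" for x using ord_ge_1[OF fin that] by simp
  have "ord x dvd ord c" if x: "x \<in> carrier G" for x
  proof (rule ccontr)
    assume nd: "\<not> ord x dvd ord c"
    have nz: "ord x \<noteq> 0" "ord c \<noteq> 0" using pos[OF x] pos[OF c(1)] by auto
    obtain p where p: "Factorial_Ring.prime p" "multiplicity p (ord x) > multiplicity p (ord c)"
      using multiplicity_le_imp_dvd[OF nz(1), of "ord c"] nd nz by (meson not_le)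
    define i where "i = multiplicity p (ord x)"
    define j where "j = multiplicity p (ord c)"
    have pi: "p ^ i dvd ord x" unfolding i_def by (rule multiplicity_dvd)
    have pj: "p ^ j dvd ord c" unfolding j_def by (rule multiplicity_dvd)
    have pn: "p ^ k > 0" for k using prime_gt_0_nat[OF p(1)] by simp
    define a where "a = x [^] (ord x div p ^ i)"
    define b where "b = c [^] (p ^ j)"
    have ac: "a \<in> carrier G" and bc: "b \<in> carrier G" using x c by (simp_all add: a_def b_def)
    have "ord x div p ^ i dvd ord x" using pi by (metis dvd_div_mult_self dvd_triv_left)
    moreover have "ord x div p ^ i \<noteq> 0" using pi nz(1) by (metis dvd_div_eq_0_iff)
    ultimately have "ord a = ord x div (ord x div p ^ i)" unfolding a_def by (rule ord_pow[OF x])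
    also have "\<dots> = p ^ i" using pi nz(1) by (metis div_div_eq_right dvd_refl div_self mult_1)
    finally have oa: "ord a = p ^ i" .
    have ob: "ord b = ord c div p ^ j" unfolding b_def using pn[of j] by (intro ord_pow[OF c(1) pj]) simp
    have "\<not> p dvd ord c div p ^ j"
      unfolding j_def by (rule multiplicity_decompose) (use nz p in auto)
    then have "coprime (ord a) (ord b)" unfolding oa ob
      using p(1) prime_imp_coprime by (metis coprime_power_left_iff)
    then have "ord (a \<otimes> b) = p ^ i * (ord c div p ^ j)" using ord_mult_coprime[OF ac bc] oa ob by simp
    moreover have "ord c = p ^ j * (ord c div p ^ j)" using pj by simp
    moreover have "p ^ j < p ^ i" using p prime_gt_1_nat[OF p(1)] unfolding i_def j_def by simp
    moreover have "ord c div p ^ j > 0" using nz(2) pj by (metis dvd_div_eq_0_iff neq0_conv)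
    ultimately have "ord c < ord (a \<otimes> b)" by (metis mult_less_mono1)
    then show False using max[of "a \<otimes> b"] ac bc by simp
  qed
  then show ?thesis using c(1) by blast
qed

text \<open>All elements are \<open>d\<close>-torsion for the maximal order \<open>d\<close>, so there are at most \<open>d\<close> of them, and the powers of an
  element of order \<open>d\<close> are all of them. This applies to finite subgroups of the unit group of a field and of
  \<open>\<rat>/\<int>\<close>.\<close>
lemma (in comm_group) cyclic_of_torsion_bound:
  assumes fin: "finite (carrier G)"
    and bound: "\<And>d::nat. d > 0 \<Longrightarrow> card {x \<in> carrier G. x [^] d = \<one>} \<le> d"
  shows "\<exists>c\<in>carrier G. \<forall>x\<in>carrier G. \<exists>j::nat. x = c [^] j"
proof -
  obtain c where c: "c \<in> carrier G" "\<And>x. x \<in> carrier G \<Longrightarrow> ord x dvd ord c"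
    using exists_maximal_order[OF fin] by blast
  have pos: "ord c > 0" using ord_ge_1[OF fin c(1)] by simp
  have "{x \<in> carrier G. x [^] ord c = \<one>} = carrier G" using pow_eq_id c(2) by auto
  then have le: "card (carrier G) \<le> ord c" using bound[OF pos] by simp
  have "inj_on (\<lambda>j. c [^] j) {0..ord c - 1}" by (rule ord_inj[OF c(1)])
  then have "card ((\<lambda>j. c [^] j) ` {0..ord c - 1}) = ord c" using pos by (simp add: card_image)
  moreover have "(\<lambda>j. c [^] j) ` {0..ord c - 1} \<subseteq> carrier G" using c(1) by auto
  ultimately have "(\<lambda>j. c [^] j) ` {0..ord c - 1} = carrier G" using card_seteq[OF fin] le by metis
  then show ?thesis using c(1) by blast
qed

lemma card_set_mset_le_size: "card (set_mset M) \<le> size M"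
proof (induction M)
  case (add x M)
  then show ?case by (simp add: card_insert_if)
qed simp

lemma (in field) card_roots_of_unity_le:
  assumes d: "d > (0::nat)"
  shows "finite {x \<in> carrier R. x [^] d = \<one>} \<and> card {x \<in> carrier R. x [^] d = \<one>} \<le> d"
proof -
  define p where "p = \<one> # (replicate (d - 1) \<zero> @ [\<ominus> \<one>])"
  have len: "length p = Suc d" using d by (simp add: p_def)
  have set_p: "set p \<subseteq> carrier R" by (auto simp: p_def)
  have pc: "p \<in> carrier (poly_ring R)"
    unfolding univ_poly_carrier[symmetric] polynomial_def using set_p by (simp add: p_def)
  have "eval p x = x [^] d \<ominus> \<one>" if x: "x \<in> carrier R" for x
  proof -
    have "eval (replicate (d - 1) \<zero> @ [\<ominus> \<one>]) x = eval [\<ominus> \<one>] x"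
      by (rule eval_replicate) (use x in auto)
    also have "\<dots> = \<ominus> \<one>" using x by simp
    finally show ?thesis using x d by (simp add: p_def a_minus_def)
  qed
  then have sub: "{x \<in> carrier R. x [^] d = \<one>} \<subseteq> set_mset (roots p)"
    using roots_mem_iff_is_root[OF pc] by (auto simp: is_root_def p_def)
  have "card (set_mset (roots p)) \<le> size (roots p)" by (rule card_set_mset_le_size)
  also have "\<dots> \<le> length p - 1" by (rule size_roots_le_degree[OF pc])
  also have "\<dots> = d" using len by simp
  finally have "card (set_mset (roots p)) \<le> d" .
  then show ?thesis using sub card_mono[OF finite_set_mset sub] finite_subset[OF sub] by auto
qed

section \<open>The center of an irreducible representation\<close>

context group
begin

text \<open>The kernel of \<open>A\<close> is an invariant subspace and not the whole space, hence zero.\<close>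
lemma schur:
  fixes \<sigma> :: "'a \<Rightarrow> 'f::field mat"
  assumes irr: "irreducible_representation G n \<sigma>" and A: "A \<in> carrier_mat n n"
    and comm: "\<And>g. g \<in> carrier G \<Longrightarrow> A * \<sigma> g = \<sigma> g * A" and nz: "A \<noteq> 0\<^sub>m n n"
  shows "\<exists>B\<in>carrier_mat n n. A * B = 1\<^sub>m n \<and> B * A = 1\<^sub>m n"
proof -
  have rep: "representation G n \<sigma>"
    and inv: "\<And>W. invariant_subspace G n \<sigma> W \<Longrightarrow> W = {0\<^sub>v n} \<or> W = carrier_vec n"
    using irr by (auto simp: irreducible_representation_def)
  note r = representationD[OF rep]
  define V where "V = {v \<in> carrier_vec n. A *\<^sub>v v = 0\<^sub>v n}"
  have "invariant_subspace G n \<sigma> V"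
    unfolding invariant_subspace_def subspace_vec_iff
  proof (intro conjI ballI allI)
    show "V \<subseteq> carrier_vec n" by (auto simp: V_def)
    show "0\<^sub>v n \<in> V" using mult_mat_zero_vec[OF A] by (simp add: V_def)
    show "v + w \<in> V" if "v \<in> V" "w \<in> V" for v w
      using that by (simp add: V_def mult_add_distrib_mat_vec[OF A])
    show "c \<cdot>\<^sub>v v \<in> V" if "v \<in> V" for c v
      using that by (auto simp: V_def mult_mat_vec[OF A])
    fix g v assume g: "g \<in> carrier G" and v: "v \<in> V"
    have vc: "v \<in> carrier_vec n" using v by (simp add: V_def)
    have "A *\<^sub>v (\<sigma> g *\<^sub>v v) = (A * \<sigma> g) *\<^sub>v v" by (rule assoc_mult_mat_vec[OF A r(1)[OF g] vc, symmetric])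
    also have "\<dots> = \<sigma> g *\<^sub>v (A *\<^sub>v v)" unfolding comm[OF g] by (rule assoc_mult_mat_vec[OF r(1)[OF g] A vc])
    also have "\<dots> = 0\<^sub>v n" using v mult_mat_zero_vec[OF r(1)[OF g]] by (simp add: V_def)
    finally show "\<sigma> g *\<^sub>v v \<in> V" using mult_mat_vec_carrier[OF r(1)[OF g] vc] by (simp add: V_def)
  qed
  then consider "V = {0\<^sub>v n}" | "V = carrier_vec n" using inv by blast
  then show ?thesis
  proof cases
    case 1
    have "det A \<noteq> 0"
    proof
      assume "det A = 0"
      then obtain v where "v \<in> carrier_vec n" "v \<noteq> 0\<^sub>v n" "A *\<^sub>v v = 0\<^sub>v n"
        using det_0_iff_vec_prod_zero_field[OF A] by blast
      then have "v \<in> V" "v \<notin> {0\<^sub>v n}" by (auto simp: V_def)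
      then show False using 1 by simp
    qed
    then have "A \<in> Units (ring_mat TYPE('f) n ())" by (rule det_non_zero_imp_unit[OF A])
    then show ?thesis by (auto simp: Units_def ring_mat_simps)
  next
    case 2
    have "A = 0\<^sub>m n n"
    proof (rule mat_eq_by_vec[OF A zero_carrier_mat])
      fix v :: "'f vec" assume v: "v \<in> carrier_vec n"
      then have "v \<in> V" using 2 by simp
      moreover have "0\<^sub>m n n *\<^sub>v v = 0\<^sub>v n" using v by (intro eq_vecI) simp_all
      ultimately show "A *\<^sub>v v = 0\<^sub>m n n *\<^sub>v v" by (simp add: V_def)
    qed
    then show ?thesis using nz by simp
  qed
qed

text \<open>The commutant of an irreducible representation is a division algebra, whose center is a field containing
  \<open>\<sigma>(Z(G))\<close>. Passing to the center of the commutant is what makes this work over a field that need not be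
  algebraically closed.\<close>
lemma center_image_cyclic:
  fixes \<sigma> :: "'a \<Rightarrow> 'f::field mat"
  assumes fin: "finite (carrier G)" and irr: "irreducible_representation G n \<sigma>"
  shows "\<exists>c\<in>center G. \<forall>z\<in>center G. \<exists>j::nat. \<sigma> z = \<sigma> (c [^] j)"
proof -
  have rep: "representation G n \<sigma>" and n: "0 < n"
    using irr by (auto simp: irreducible_representation_def)
  note r = representationD[OF rep]
  let ?R = "ring_mat TYPE('f) n ()"
  interpret R: ring ?R by (rule ring_mat)
  note Rs = ring_mat_simps
  \<comment> \<open>the commutant and its center\<close>
  define E where "E = {A \<in> carrier_mat n n. \<forall>g\<in>carrier G. A * \<sigma> g = \<sigma> g * A}"
  define D where "D = {A \<in> E. \<forall>B\<in>E. A * B = B * A}"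
  have Ec: "A \<in> E \<Longrightarrow> A \<in> carrier_mat n n" for A by (simp add: E_def)
  have DE: "A \<in> D \<Longrightarrow> A \<in> E" for A by (simp add: D_def)
  have DB: "A * B = B * A" if "A \<in> D" "B \<in> E" for A B using that by (simp add: D_def)
  have minus: "\<ominus>\<^bsub>?R\<^esub> A = - A" if A: "A \<in> carrier_mat n n" for A
  proof (rule R.minus_equality)
    show "- A \<oplus>\<^bsub>?R\<^esub> A = \<zero>\<^bsub>?R\<^esub>" using A by (simp add: Rs uminus_l_inv_mat)
  qed (use A in \<open>simp_all add: Rs\<close>)
  \<comment> \<open>the centralizer of any set \<open>T\<close> of matrices is a subring\<close>
  have sub: "subring S ?R" if S: "S = {A \<in> carrier_mat n n. \<forall>B\<in>T. A * B = B * A}" and T: "T \<subseteq> carrier_mat n n" for S T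
  proof (rule R.subringI)
    show "S \<subseteq> carrier ?R" using S by (auto simp: Rs)
    show "\<one>\<^bsub>?R\<^esub> \<in> S" using S T by (auto simp: Rs)
    fix A assume "A \<in> S"
    then have A: "A \<in> carrier_mat n n" "\<And>B. B \<in> T \<Longrightarrow> A * B = B * A" using S by auto
    have "- A * B = B * - A" if B: "B \<in> T" for B
    proof -
      have Bc: "B \<in> carrier_mat n n" using B T by blast
      have "- A * B = - (A * B)" by (rule uminus_mult_left_mat) (use A Bc in auto)
      also have "\<dots> = B * - A" unfolding A(2)[OF B] by (rule uminus_mult_right_mat[symmetric]) (use A Bc in auto)
      finally show ?thesis .
    qed
    then show "\<ominus>\<^bsub>?R\<^esub> A \<in> S" unfolding minus[OF A(1)] using S A(1) by simp
    fix A' assume "A' \<in> S"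
    then have A': "A' \<in> carrier_mat n n" "\<And>B. B \<in> T \<Longrightarrow> A' * B = B * A'" using S by auto
    have "A * A' * B = B * (A * A')" if B: "B \<in> T" for B
    proof -
      have Bc: "B \<in> carrier_mat n n" using B T by blast
      have "A * A' * B = A * (A' * B)" by (rule assoc_mult_mat[OF A(1) A'(1) Bc])
      also have "\<dots> = A * B * A'" unfolding A'(2)[OF B] by (rule assoc_mult_mat[OF A(1) Bc A'(1), symmetric])
      also have "\<dots> = B * (A * A')" unfolding A(2)[OF B] by (rule assoc_mult_mat[OF Bc A(1) A'(1)])
      finally show ?thesis .
    qed
    then show "A \<otimes>\<^bsub>?R\<^esub> A' \<in> S" using S A(1) A'(1) by (simp add: Rs)
    have "(A + A') * B = B * (A + A')" if B: "B \<in> T" for B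
    proof -
      have Bc: "B \<in> carrier_mat n n" using B T by blast
      show ?thesis
        using add_mult_distrib_mat[OF A(1) A'(1) Bc] mult_add_distrib_mat[OF Bc A(1) A'(1)] A(2)[OF B] A'(2)[OF B] by simp
    qed
    then show "A \<oplus>\<^bsub>?R\<^esub> A' \<in> S" using S A(1) A'(1) by (simp add: Rs)
  qed
  have "E = {A \<in> carrier_mat n n. \<forall>B\<in>\<sigma> ` carrier G. A * B = B * A}" by (auto simp: E_def)
  have D_eq: "D = {A \<in> carrier_mat n n. \<forall>B\<in>\<sigma> ` carrier G \<union> E. A * B = B * A}" by (auto simp: D_def E_def)
  have subD: "subring D ?R"
    by (rule sub[OF D_eq]) (use r(1) Ec in auto)
  have cD: "subcring D ?R"
    by (rule R.subcringI[OF subD]) (use DB DE in \<open>auto simp: Rs\<close>)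
  have one_ne: "1\<^sub>m n \<noteq> (0\<^sub>m n n :: 'f mat)"
  proof
    assume "1\<^sub>m n = (0\<^sub>m n n :: 'f mat)"
    then have "(1\<^sub>m n :: 'f mat) $$ (0, 0) = 0\<^sub>m n n $$ (0, 0)" by simp
    then show False using n by simp
  qed
  have "Units (?R\<lparr>carrier := D\<rparr>) = D - {\<zero>\<^bsub>?R\<^esub>}"
  proof
    show "Units (?R\<lparr>carrier := D\<rparr>) \<subseteq> D - {\<zero>\<^bsub>?R\<^esub>}"
    proof
      fix A assume "A \<in> Units (?R\<lparr>carrier := D\<rparr>)"
      then obtain B where AB: "A \<in> D" "B \<in> D" "B * A = 1\<^sub>m n" by (auto simp: Units_def Rs)
      have "A \<noteq> 0\<^sub>m n n"
      proof
        assume "A = 0\<^sub>m n n"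
        then have "B * A = 0\<^sub>m n n" using Ec[OF DE[OF AB(2)]] by simp
        then show False using AB(3) one_ne by simp
      qed
      then show "A \<in> D - {\<zero>\<^bsub>?R\<^esub>}" using AB(1) by (simp add: Rs)
    qed
    show "D - {\<zero>\<^bsub>?R\<^esub>} \<subseteq> Units (?R\<lparr>carrier := D\<rparr>)"
    proof
      fix A assume "A \<in> D - {\<zero>\<^bsub>?R\<^esub>}"
      then have A: "A \<in> D" "A \<noteq> 0\<^sub>m n n" by (auto simp: Rs)
      have Ac: "A \<in> carrier_mat n n" by (rule Ec[OF DE[OF A(1)]])
      obtain B where B: "B \<in> carrier_mat n n" "A * B = 1\<^sub>m n" "B * A = 1\<^sub>m n"
        using schur[OF irr Ac _ A(2)] DE[OF A(1)] unfolding E_def by blast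
      have "B * C = C * B" if C: "C \<in> \<sigma> ` carrier G \<union> E" for C
      proof -
        have Cc: "C \<in> carrier_mat n n" using C r(1) Ec by auto
        have AC: "A * C = C * A" using A(1) C unfolding D_eq by blast
        have "B * C = B * C * (A * B)" using B Cc by simp
        also have "\<dots> = B * (C * A) * B" using B Cc Ac by (simp add: assoc_mult_mat[of _ n n _ n _ n])
        also have "\<dots> = (B * A) * (C * B)" unfolding AC[symmetric] using B(1) Cc Ac
          by (simp add: assoc_mult_mat[of _ n n _ n _ n])
        also have "\<dots> = C * B" using B Cc by simp
        finally show ?thesis .
      qed
      then have "B \<in> D" using B(1) unfolding D_eq by blast
      then show "A \<in> Units (?R\<lparr>carrier := D\<rparr>)" using A(1) B by (auto simp: Units_def Rs)
    qed
  qed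
  then have "subfield D ?R" by (rule R.subfieldI[OF cD])
  then interpret F: field "?R\<lparr>carrier := D\<rparr>" by (rule R.subfield_iff(2))
  let ?Z = "center G"
  let ?C = "?R\<lparr>carrier := \<sigma> ` ?Z\<rparr>"
  have Zc: "z \<in> ?Z \<Longrightarrow> z \<in> carrier G" for z by (rule center_carrier)
  have CD: "\<sigma> z \<in> D" if z: "z \<in> ?Z" for z
  proof -
    have "\<sigma> z * \<sigma> g = \<sigma> g * \<sigma> z" if g: "g \<in> carrier G" for g
      using r(2)[OF Zc[OF z] g] r(2)[OF g Zc[OF z]] center_comm[OF z g] by simp
    then have "\<sigma> z \<in> E" using r(1)[OF Zc[OF z]] by (simp add: E_def)
    then show ?thesis using Zc[OF z] unfolding D_def E_def by auto
  qed
  note Zs = center_subgroup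
  have C: "comm_group ?C"
  proof (rule comm_groupI)
    show "x \<otimes>\<^bsub>?C\<^esub> y \<in> carrier ?C" if "x \<in> carrier ?C" "y \<in> carrier ?C" for x y
      using that r(2) Zc subgroup.m_closed[OF Zs] by (auto simp: Rs simp flip: r(2))
    show "\<one>\<^bsub>?C\<^esub> \<in> carrier ?C" using subgroup.one_closed[OF Zs] r(3) by (auto simp: Rs intro!: image_eqI[of _ _ \<one>])
    show "x \<otimes>\<^bsub>?C\<^esub> y \<otimes>\<^bsub>?C\<^esub> z = x \<otimes>\<^bsub>?C\<^esub> (y \<otimes>\<^bsub>?C\<^esub> z)"
      if "x \<in> carrier ?C" "y \<in> carrier ?C" "z \<in> carrier ?C" for x y z
      using that r(1) Zc by (auto simp: Rs assoc_mult_mat[of _ n n _ n _ n])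
    show "x \<otimes>\<^bsub>?C\<^esub> y = y \<otimes>\<^bsub>?C\<^esub> x" if "x \<in> carrier ?C" "y \<in> carrier ?C" for x y
      using that DB CD DE by (auto simp: Rs)
    show "\<one>\<^bsub>?C\<^esub> \<otimes>\<^bsub>?C\<^esub> x = x" if "x \<in> carrier ?C" for x
      using that left_mult_one_mat[OF r(1)[OF Zc]] by (auto simp: Rs)
    show "\<exists>y\<in>carrier ?C. y \<otimes>\<^bsub>?C\<^esub> x = \<one>\<^bsub>?C\<^esub>" if x: "x \<in> carrier ?C" for x
    proof -
      obtain z where z: "z \<in> ?Z" "x = \<sigma> z" using x by auto
      have "\<sigma> (inv z) * x = 1\<^sub>m n" using r(2)[of "inv z" z] r(3) Zc[OF z(1)] z(2) by simp
      then show ?thesis using subgroup.m_inv_closed[OF Zs z(1)] by (auto simp: Rs)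
    qed
  qed
  have finC: "finite (carrier ?C)" using fin center_carrier by (simp add: finite_subset[of ?Z "carrier G"] subset_iff)
  have pow: "x [^]\<^bsub>?C\<^esub> d = x [^]\<^bsub>?R\<lparr>carrier := D\<rparr>\<^esub> d" for x and d :: nat by (simp add: nat_pow_def)
  have "card {x \<in> carrier ?C. x [^]\<^bsub>?C\<^esub> d = \<one>\<^bsub>?C\<^esub>} \<le> d" if d: "d > 0" for d :: nat
  proof -
    have "{x \<in> carrier ?C. x [^]\<^bsub>?C\<^esub> d = \<one>\<^bsub>?C\<^esub>} \<subseteq>
      {x \<in> carrier (?R\<lparr>carrier := D\<rparr>). x [^]\<^bsub>?R\<lparr>carrier := D\<rparr>\<^esub> d = \<one>\<^bsub>?R\<lparr>carrier := D\<rparr>\<^esub>}"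
      using CD by (auto simp: pow)
    then show ?thesis using F.card_roots_of_unity_le[OF d] card_mono le_trans by blast
  qed
  from comm_group.cyclic_of_torsion_bound[OF C finC this] obtain c where c: "c \<in> ?Z"
    "\<And>x. x \<in> \<sigma> ` ?Z \<Longrightarrow> \<exists>j::nat. x = \<sigma> c [^]\<^bsub>?C\<^esub> j"
    by auto
  have "\<sigma> c [^]\<^bsub>?C\<^esub> j = \<sigma> (c [^] j)" for j :: nat
  proof (induction j)
    case 0
    then show ?case using r(3) by (simp add: Rs)
  next
    case (Suc j)
    then show ?case using r(2)[of "c [^] j" c] Zc[OF c(1)] by (simp add: Rs)
  qed
  then show ?thesis using c by (intro bexI[of _ c] ballI) auto
qed

end

section \<open>The group of rationals modulo the integers\<close>

definition frac_class :: "rat \<Rightarrow> rat set" where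
  "frac_class r = \<int> #>\<^bsub>rat_group\<^esub> r"

lemma rat_group_comm: "comm_group rat_group"
  by (rule comm_groupI) (auto simp: rat_group_def intro: exI[of _ "- x" for x])

lemma Ints_normal: "\<int> \<lhd> rat_group"
proof -
  interpret comm_group rat_group by (rule rat_group_comm)
  have inv: "inv\<^bsub>rat_group\<^esub> x = - x" for x
    by (rule inv_equality) (auto simp: rat_group_def)
  have "subgroup \<int> rat_group"
    by (rule subgroup.intro) (auto simp: inv, auto simp: rat_group_def)
  then show ?thesis by (rule subgroup_imp_normal)
qed

lemma rat_mod_int_group: "group rat_mod_int"
  unfolding rat_mod_int_def by (rule normal.factorgroup_is_group[OF Ints_normal])

lemma mem_frac_class_iff: "x \<in> frac_class t \<longleftrightarrow> x - t \<in> \<int>"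
proof
  show "x - t \<in> \<int>" if "x \<in> frac_class t"
    using that by (auto simp: frac_class_def r_coset_def rat_group_def)
  show "x \<in> frac_class t" if "x - t \<in> \<int>"
    unfolding frac_class_def r_coset_def rat_group_def using that by (intro UN_I[of "x - t"]) simp_all
qed

lemma frac_class_eq_iff: "frac_class r = frac_class s \<longleftrightarrow> r - s \<in> \<int>"
proof
  show "r - s \<in> \<int>" if "frac_class r = frac_class s"
    using mem_frac_class_iff[of r r] mem_frac_class_iff[of r s] that by simp
  assume i: "r - s \<in> \<int>"
  have "x - r \<in> \<int> \<longleftrightarrow> x - s \<in> \<int>" for x
    using Ints_add[of "x - r" "r - s"] Ints_diff[of "x - s" "r - s"] i by auto
  then show "frac_class r = frac_class s" by (auto simp: mem_frac_class_iff)
qed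

lemma frac_class_carrier: "carrier rat_mod_int = range frac_class"
  by (auto simp: rat_mod_int_def FactGroup_def RCOSETS_def frac_class_def rat_group_def)

lemma frac_class_mult: "frac_class r \<otimes>\<^bsub>rat_mod_int\<^esub> frac_class s = frac_class (r + s)"
proof -
  have "r \<in> carrier rat_group" "s \<in> carrier rat_group" by (auto simp: rat_group_def)
  from normal.rcos_sum[OF Ints_normal this] show ?thesis
    by (simp add: frac_class_def rat_mod_int_def FactGroup_def rat_group_def)
qed

lemma frac_class_one: "\<one>\<^bsub>rat_mod_int\<^esub> = frac_class 0"
  by (auto simp: frac_class_def rat_mod_int_def FactGroup_def r_coset_def rat_group_def)

lemma frac_class_pow: "frac_class r [^]\<^bsub>rat_mod_int\<^esub> n = frac_class (of_nat n * r)" for n :: nat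
proof (induction n)
  case 0
  then show ?case by (simp add: nat_pow_def frac_class_one)
next
  case (Suc n)
  interpret group rat_mod_int by (rule rat_mod_int_group)
  show ?case using Suc by (simp add: frac_class_mult algebra_simps)
qed

lemma rat_mod_int_torsion:
  assumes d: "d > 0"
  shows "{x \<in> carrier rat_mod_int. x [^]\<^bsub>rat_mod_int\<^esub> d = \<one>\<^bsub>rat_mod_int\<^esub>} \<subseteq>
    (\<lambda>j. frac_class (of_nat j / of_nat d)) ` {..<d::nat}"
proof
  fix x assume "x \<in> {x \<in> carrier rat_mod_int. x [^]\<^bsub>rat_mod_int\<^esub> d = \<one>\<^bsub>rat_mod_int\<^esub>}"
  then obtain r where r: "x = frac_class r" "frac_class (of_nat d * r) = frac_class 0"
    unfolding frac_class_carrier by (auto simp: frac_class_pow frac_class_one)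
  then have "of_nat d * r \<in> \<int>" by (simp add: frac_class_eq_iff)
  then obtain m where m: "of_nat d * r = of_int m" by (elim Ints_cases)
  define j where "j = nat (m mod int d)"
  have jd: "j < d" using d by (simp add: j_def nat_less_iff)
  have "of_int m = of_nat d * of_int (m div int d) + (of_nat j :: rat)"
  proof -
    have "m = int d * (m div int d) + int j" using d by (simp add: j_def)
    then have "(of_int m :: rat) = of_int (int d * (m div int d) + int j)" by simp
    then show ?thesis by simp
  qed
  then have "of_nat d * r = of_nat d * of_int (m div int d) + of_nat j" using m by simp
  then have "r - of_nat j / of_nat d = of_int (m div int d)" using d by (simp add: field_simps)
  then have "x = frac_class (of_nat j / of_nat d)" using r(1) by (simp add: frac_class_eq_iff)
  then show "x \<in> (\<lambda>j. frac_class (of_nat j / of_nat d)) ` {..<d}" using jd by blast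
qed

section \<open>Passing to quotients\<close>

lemma (in group) quotient_carrier: "carrier (G Mod K) = (\<lambda>g. K #> g) ` carrier G"
  by (auto simp: FactGroup_def RCOSETS_def)

lemma (in group) quotient_mult:
  assumes "K \<lhd> G" "g \<in> carrier G" "h \<in> carrier G"
  shows "(K #> g) <#> (K #> h) = K #> (g \<otimes> h)"
  by (rule normal.rcos_sum[OF assms])

lemma (in group) quotient_one: "\<one>\<^bsub>G Mod K\<^esub> = K"
  by (simp add: FactGroup_def)

lemma (in group) quotient_eq_iff:
  assumes K: "K \<lhd> G" and g: "g \<in> carrier G" and h: "h \<in> carrier G"
  shows "K #> g = K #> h \<longleftrightarrow> g \<otimes> inv h \<in> K"
proof -
  have s: "subgroup K G" by (rule normal_imp_subgroup[OF K])
  have "K #> g = K #> h \<longleftrightarrow> g \<in> K #> h"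
    using rcos_self[OF g s] repr_independence[OF _ h s, of g] by auto
  also have "\<dots> \<longleftrightarrow> g \<otimes> inv h \<in> K" using subgroup.rcos_module[OF s is_group h g] .
  finally show ?thesis .
qed

lemma (in group) quotient_eq_one_iff:
  assumes K: "K \<lhd> G" and g: "g \<in> carrier G"
  shows "K #> g = K \<longleftrightarrow> g \<in> K"
  using quotient_eq_iff[OF K g one_closed] g normalD(1)[OF K] by (simp add: coset_mult_one)

lemma (in group) quotient_inv:
  assumes K: "K \<lhd> G" and g: "g \<in> carrier G"
  shows "inv\<^bsub>G Mod K\<^esub> (K #> g) = K #> inv g"
proof -
  interpret Q: group "G Mod K" by (rule normal.factorgroup_is_group[OF K])
  have "(K #> inv g) \<otimes>\<^bsub>G Mod K\<^esub> (K #> g) = \<one>\<^bsub>G Mod K\<^esub>"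
    using g quotient_mult[OF K inv_closed[OF g] g] quotient_eq_one_iff[OF K one_closed] normalD(2)[OF K]
    by (simp add: quotient_one)
  then show ?thesis using g by (intro Q.inv_equality) (auto simp: quotient_carrier)
qed

lemma (in group) order_quotient_dvd:
  assumes K: "K \<lhd> G"
  shows "Coset.order (G Mod K) dvd Coset.order G"
  unfolding lagrange[OF normal_imp_subgroup[OF K], symmetric] by (simp add: FactGroup_def Coset.order_def)

lemma (in group) quotient_center_iff:
  assumes K: "K \<lhd> G" and g: "g \<in> carrier G"
  shows "K #> g \<in> center (G Mod K) \<longleftrightarrow> (\<forall>h\<in>carrier G. commutator G g h \<in> K)"
  using center_modulo_iff[OF K, of g] g by (simp add: center_modulo_def)

lemma (in group) preimage_normal:
  assumes K: "K \<lhd> G" and H: "H \<lhd> G Mod K"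
  shows "{g \<in> carrier G. K #> g \<in> H} \<lhd> G"
proof -
  interpret Q: group "G Mod K" by (rule normal.factorgroup_is_group[OF K])
  note HD = Q.normalD[OF H]
  show ?thesis
    unfolding normal_inv_iff
  proof (intro conjI ballI)
    show "subgroup {g \<in> carrier G. K #> g \<in> H} G"
    proof
      show "\<one> \<in> {g \<in> carrier G. K #> g \<in> H}"
        using HD(2) quotient_eq_one_iff[OF K one_closed] normalD(2)[OF K] by (simp add: quotient_one)
      fix x y assume x: "x \<in> {g \<in> carrier G. K #> g \<in> H}" and y: "y \<in> {g \<in> carrier G. K #> g \<in> H}"
      show "x \<otimes> y \<in> {g \<in> carrier G. K #> g \<in> H}"
        using HD(4)[of "K #> x" "K #> y"] x y quotient_mult[OF K, of x y] by simp
    next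
      fix x assume x: "x \<in> {g \<in> carrier G. K #> g \<in> H}"
      show "inv x \<in> {g \<in> carrier G. K #> g \<in> H}"
        using HD(5)[of "K #> x"] x quotient_inv[OF K, of x] by simp
    qed auto
    fix g x assume g: "g \<in> carrier G" and x: "x \<in> {g \<in> carrier G. K #> g \<in> H}"
    have "(K #> g) \<otimes>\<^bsub>G Mod K\<^esub> (K #> x) \<otimes>\<^bsub>G Mod K\<^esub> inv\<^bsub>G Mod K\<^esub> (K #> g) \<in> H"
      using HD(6)[of "K #> g" "K #> x"] g x by (simp add: quotient_carrier)
    then show "g \<otimes> x \<otimes> inv g \<in> {g \<in> carrier G. K #> g \<in> H}"
      using g x by (simp add: quotient_mult[OF K] quotient_inv[OF K])
  qed
qed

lemma (in group) irreducible_quotient_iff: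
  fixes \<sigma> :: "'a \<Rightarrow> 'f::field mat"
  assumes K: "K \<lhd> G" and e: "\<And>g. g \<in> carrier G \<Longrightarrow> \<tau> (K #> g) = \<sigma> g"
  shows "irreducible_representation (G Mod K) n \<tau> \<longleftrightarrow> irreducible_representation G n \<sigma>"
proof -
  have "representation (G Mod K) n \<tau> \<longleftrightarrow> representation G n \<sigma>"
    unfolding representation_def hom_def
    by (auto simp: quotient_carrier Pi_iff e quotient_mult[OF K])
  moreover have "invariant_subspace (G Mod K) n \<tau> W \<longleftrightarrow> invariant_subspace G n \<sigma> W" for W
    unfolding invariant_subspace_def by (auto simp: quotient_carrier e)
  ultimately show ?thesis by (simp add: irreducible_representation_def)
qed

lemma (in group) faithful_irreducible_iff_single_class:
  assumes fin: "finite (carrier G)" and char: "\<not> CHAR('f::field) dvd Coset.order G"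
  shows "(\<exists>n (\<sigma> :: 'a \<Rightarrow> 'f mat). irreducible_representation G n \<sigma> \<and>
      (\<forall>g\<in>carrier G. \<sigma> g = 1\<^sub>m n \<longrightarrow> g = \<one>)) \<longleftrightarrow> generated_by_single_class (SocA G) G"
  unfolding faithful_irreducible_iff_null_function[OF fin char]
  by (rule null_functions_iff_single_class[OF fin char])

lemma (in group) irreducible_with_kernel_iff:
  assumes fin: "finite (carrier G)" and char: "\<not> CHAR('f::field) dvd Coset.order G" and K: "K \<lhd> G"
  shows "(\<exists>n (\<sigma> :: 'a \<Rightarrow> 'f mat). irreducible_representation G n \<sigma> \<and> {g \<in> carrier G. \<sigma> g = 1\<^sub>m n} = K) \<longleftrightarrow>
    generated_by_single_class (SocA (G Mod K)) (G Mod K)"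
proof -
  interpret Q: group "G Mod K" by (rule normal.factorgroup_is_group[OF K])
  have finQ: "finite (carrier (G Mod K))" using fin by (simp add: quotient_carrier)
  have charQ: "\<not> CHAR('f) dvd Coset.order (G Mod K)" using char order_quotient_dvd[OF K] dvd_trans by blast
  have "(\<exists>n (\<sigma> :: 'a \<Rightarrow> 'f mat). irreducible_representation G n \<sigma> \<and> {g \<in> carrier G. \<sigma> g = 1\<^sub>m n} = K) \<longleftrightarrow>
    (\<exists>n (\<tau> :: 'a set \<Rightarrow> 'f mat). irreducible_representation (G Mod K) n \<tau> \<and>
      (\<forall>A\<in>carrier (G Mod K). \<tau> A = 1\<^sub>m n \<longrightarrow> A = \<one>\<^bsub>G Mod K\<^esub>))"
  proof
    assume "\<exists>n (\<sigma> :: 'a \<Rightarrow> 'f mat). irreducible_representation G n \<sigma> \<and> {g \<in> carrier G. \<sigma> g = 1\<^sub>m n} = K"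
    then obtain n and \<sigma> :: "'a \<Rightarrow> 'f mat" where s: "irreducible_representation G n \<sigma>"
      "{g \<in> carrier G. \<sigma> g = 1\<^sub>m n} = K" by blast
    have rep: "representation G n \<sigma>" using s(1) by (simp add: irreducible_representation_def)
    note r = representationD[OF rep]
    \<comment> \<open>\<open>\<sigma>\<close> is constant on the cosets of its kernel\<close>
    define \<tau> where "\<tau> A = the_elem (\<sigma> ` A)" for A
    have t: "\<tau> (K #> g) = \<sigma> g" if g: "g \<in> carrier G" for g
    proof -
      have "\<sigma> (k \<otimes> g) = \<sigma> g" if k: "k \<in> K" for k
      proof -
        have kk: "k \<in> carrier G" "\<sigma> k = 1\<^sub>m n" using k s(2) by auto
        show ?thesis using r(2)[OF kk(1) g] kk(2) r(1)[OF g] by simp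
      qed
      moreover have "g \<in> K #> g" by (rule rcos_self[OF g normal_imp_subgroup[OF K]])
      ultimately have "\<sigma> ` (K #> g) = {\<sigma> g}" by (auto simp: r_coset_def)
      then show ?thesis by (simp add: \<tau>_def)
    qed
    have "irreducible_representation (G Mod K) n \<tau>"
      by (rule irreducible_quotient_iff[where \<sigma> = \<sigma>, OF K, THEN iffD2, OF _ s(1)]) (rule t)
    moreover have "\<forall>A\<in>carrier (G Mod K). \<tau> A = 1\<^sub>m n \<longrightarrow> A = \<one>\<^bsub>G Mod K\<^esub>"
    proof (intro ballI impI)
      fix A assume "A \<in> carrier (G Mod K)" and one: "\<tau> A = 1\<^sub>m n"
      then obtain g where g: "g \<in> carrier G" "A = K #> g" unfolding quotient_carrier by blast
      have "\<sigma> g = 1\<^sub>m n" using t[OF g(1)] one g(2) by simp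
      then have "g \<in> K" using s(2) g(1) by blast
      then show "A = \<one>\<^bsub>G Mod K\<^esub>" unfolding g(2) quotient_one using quotient_eq_one_iff[OF K g(1)] by blast
    qed
    ultimately show "\<exists>n (\<tau> :: 'a set \<Rightarrow> 'f mat). irreducible_representation (G Mod K) n \<tau> \<and>
      (\<forall>A\<in>carrier (G Mod K). \<tau> A = 1\<^sub>m n \<longrightarrow> A = \<one>\<^bsub>G Mod K\<^esub>)" by blast
  next
    assume "\<exists>n (\<tau> :: 'a set \<Rightarrow> 'f mat). irreducible_representation (G Mod K) n \<tau> \<and>
      (\<forall>A\<in>carrier (G Mod K). \<tau> A = 1\<^sub>m n \<longrightarrow> A = \<one>\<^bsub>G Mod K\<^esub>)"
    then obtain n and \<tau> :: "'a set \<Rightarrow> 'f mat" where t: "irreducible_representation (G Mod K) n \<tau>"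
      "\<And>A. A \<in> carrier (G Mod K) \<Longrightarrow> \<tau> A = 1\<^sub>m n \<Longrightarrow> A = \<one>\<^bsub>G Mod K\<^esub>" by blast
    define \<sigma> where "\<sigma> g = \<tau> (K #> g)" for g
    have rep: "representation (G Mod K) n \<tau>" using t(1) by (simp add: irreducible_representation_def)
    have "irreducible_representation G n \<sigma>"
      by (rule irreducible_quotient_iff[where \<tau> = \<tau>, OF K, THEN iffD1, OF _ t(1)]) (simp add: \<sigma>_def)
    moreover have "{g \<in> carrier G. \<sigma> g = 1\<^sub>m n} = K"
    proof
      show "{g \<in> carrier G. \<sigma> g = 1\<^sub>m n} \<subseteq> K"
      proof
        fix g assume "g \<in> {g \<in> carrier G. \<sigma> g = 1\<^sub>m n}"
        then have g: "g \<in> carrier G" "\<tau> (K #> g) = 1\<^sub>m n" by (auto simp: \<sigma>_def)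
        have "K #> g \<in> carrier (G Mod K)" unfolding quotient_carrier using g(1) by (rule imageI)
        then have "K #> g = K" using t(2)[OF _ g(2)] by (simp only: quotient_one)
        then show "g \<in> K" using quotient_eq_one_iff[OF K g(1)] by blast
      qed
      show "K \<subseteq> {g \<in> carrier G. \<sigma> g = 1\<^sub>m n}"
      proof
        fix g assume g: "g \<in> K"
        have "K #> g = \<one>\<^bsub>G Mod K\<^esub>" using g quotient_eq_one_iff[OF K normalD(3)[OF K g]] by (simp add: quotient_one)
        then show "g \<in> {g \<in> carrier G. \<sigma> g = 1\<^sub>m n}"
          using Q.representationD(3)[OF rep] normalD(3)[OF K g] by (simp add: \<sigma>_def)
      qed
    qed
    ultimately show "\<exists>n (\<sigma> :: 'a \<Rightarrow> 'f mat). irreducible_representation G n \<sigma> \<and> {g \<in> carrier G. \<sigma> g = 1\<^sub>m n} = K"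
      by blast
  qed
  then show ?thesis using Q.faithful_irreducible_iff_single_class[OF finQ charQ] by blast
qed

section \<open>Characters of the center\<close>

context group
begin

definition char_kernel :: "('a \<Rightarrow> rat set) \<Rightarrow> 'a set" where
  "char_kernel \<chi> = kernel (center_group G) rat_mod_int \<chi>"

lemma char_kernel_iff: "z \<in> char_kernel \<chi> \<longleftrightarrow> z \<in> center G \<and> \<chi> z = \<one>\<^bsub>rat_mod_int\<^esub>"
  by (simp add: char_kernel_def kernel_def)

lemma central_subgroup_normal:
  assumes S: "subgroup S G" and c: "S \<subseteq> center G"
  shows "S \<lhd> G"
  unfolding normal_inv_iff
proof (intro conjI ballI S)
  fix g z assume g: "g \<in> carrier G" and z: "z \<in> S"
  have zc: "z \<in> center G" "z \<in> carrier G" using z c center_carrier by auto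
  have "g \<otimes> z \<otimes> inv g = z \<otimes> g \<otimes> inv g" using center_comm[OF zc(1) g] by simp
  then show "g \<otimes> z \<otimes> inv g \<in> S" using z zc g by (simp add: m_assoc)
qed

lemma dualD:
  assumes "\<chi> \<in> carrier (pontryagin_dual (center_group G))"
  shows "z \<in> center G \<Longrightarrow> \<chi> z \<in> carrier rat_mod_int"
    "z \<in> center G \<Longrightarrow> w \<in> center G \<Longrightarrow> \<chi> (z \<otimes> w) = \<chi> z \<otimes>\<^bsub>rat_mod_int\<^esub> \<chi> w"
    "group_hom (center_group G) rat_mod_int \<chi>"
proof -
  have h: "\<chi> \<in> hom (center_group G) rat_mod_int" using assms by (simp add: pontryagin_dual_def)
  then show "z \<in> center G \<Longrightarrow> \<chi> z \<in> carrier rat_mod_int"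
    "z \<in> center G \<Longrightarrow> w \<in> center G \<Longrightarrow> \<chi> (z \<otimes> w) = \<chi> z \<otimes>\<^bsub>rat_mod_int\<^esub> \<chi> w"
    by (auto simp: hom_def)
  show "group_hom (center_group G) rat_mod_int \<chi>"
    using h subgroup_imp_group[OF center_subgroup] rat_mod_int_group by (simp add: group_hom_def group_hom_axioms_def)
qed

lemma char_kernel_normal:
  assumes \<chi>: "\<chi> \<in> carrier (pontryagin_dual (center_group G))"
  shows "char_kernel \<chi> \<lhd> G"
proof (rule central_subgroup_normal)
  have "subgroup (char_kernel \<chi>) (center_group G)"
    unfolding char_kernel_def by (rule group_hom.subgroup_kernel[OF dualD(3)[OF \<chi>]])
  then show "subgroup (char_kernel \<chi>) G" using incl_subgroup[OF center_subgroup] by blast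
qed (auto simp: char_kernel_iff)

text \<open>An element \<open>z Z(G)\<close> is in the kernel of \<open>\<omega>\<^sub>\<chi>\<close> iff \<open>[z,g] \<in> ker \<chi>\<close> for all \<open>g\<close>. As \<open>ker \<chi>\<close> is central, this
  condition by itself implies that \<open>z\<close> is in the second center, so \<open>z\<close> may range over all of \<open>G\<close>.\<close>
lemma omega_inj_iff:
  assumes \<chi>: "\<chi> \<in> carrier (pontryagin_dual (center_group G))"
  shows "inj_on (omega G \<chi>) (carrier (second_center_quotient G)) \<longleftrightarrow>
    (\<forall>g\<in>carrier G. (\<forall>h\<in>carrier G. commutator G g h \<in> char_kernel \<chi>) \<longrightarrow> g \<in> center G)"
proof -
  have Q: "carrier (second_center_quotient G) = (\<lambda>z. center G #> z) ` second_center G"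
    by (auto simp: FactGroup_def RCOSETS_def r_coset_def)
  have Ab: "carrier (abelianization G) = (\<lambda>g. derived G (carrier G) #> g) ` carrier G" by (rule quotient_carrier)
  have ext: "omega G \<chi> C \<in> extensional (carrier (abelianization G))" if "C \<in> carrier (second_center_quotient G)" for C
    using that by (simp add: omega_def)
  have sc: "z \<in> carrier G" if "z \<in> second_center G" for z using that by (simp add: second_center_iff)
  have comm: "commutator G z g \<in> center G" if "z \<in> second_center G" "g \<in> carrier G" for z g
    using that by (simp add: second_center_iff)
  have omega_eq: "omega G \<chi> (center G #> z) = omega G \<chi> (center G #> w) \<longleftrightarrow>
      (\<forall>g\<in>carrier G. \<chi> (commutator G z g) = \<chi> (commutator G w g))"
    if z: "z \<in> second_center G" and w: "w \<in> second_center G" for z w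
  proof
    assume e: "omega G \<chi> (center G #> z) = omega G \<chi> (center G #> w)"
    show "\<forall>g\<in>carrier G. \<chi> (commutator G z g) = \<chi> (commutator G w g)"
      using omega_coset[OF z, of _ \<chi>] omega_coset[OF w, of _ \<chi>] e by metis
  next
    assume e: "\<forall>g\<in>carrier G. \<chi> (commutator G z g) = \<chi> (commutator G w g)"
    show "omega G \<chi> (center G #> z) = omega G \<chi> (center G #> w)"
    proof (rule extensionalityI[OF ext ext])
      show "center G #> z \<in> carrier (second_center_quotient G)" "center G #> w \<in> carrier (second_center_quotient G)"
        using z w Q by auto
      fix D assume "D \<in> carrier (abelianization G)"
      then obtain g where "g \<in> carrier G" "D = derived G (carrier G) #> g" unfolding Ab by blast
      then show "omega G \<chi> (center G #> z) D = omega G \<chi> (center G #> w) D"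
        using omega_coset[OF z, of g \<chi>] omega_coset[OF w, of g \<chi>] e by simp
    qed
  qed
  interpret R: group rat_mod_int by (rule rat_mod_int_group)
  show ?thesis
  proof
    assume inj: "inj_on (omega G \<chi>) (carrier (second_center_quotient G))"
    show "\<forall>g\<in>carrier G. (\<forall>h\<in>carrier G. commutator G g h \<in> char_kernel \<chi>) \<longrightarrow> g \<in> center G"
    proof (intro ballI impI)
      fix g assume g: "g \<in> carrier G" and k: "\<forall>h\<in>carrier G. commutator G g h \<in> char_kernel \<chi>"
      have gs: "g \<in> second_center G" using g k by (simp add: second_center_iff char_kernel_iff)
      have os: "\<one> \<in> second_center G" by (rule subgroup.one_closed[OF second_center_subgroup])
      have "\<chi> (commutator G \<one> h) = \<one>\<^bsub>rat_mod_int\<^esub>" if "h \<in> carrier G" for h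
        using that commutator_center[OF subgroup.one_closed[OF center_subgroup]] group_hom.hom_one[OF dualD(3)[OF \<chi>]] by simp
      then have "omega G \<chi> (center G #> g) = omega G \<chi> (center G #> \<one>)"
        unfolding omega_eq[OF gs os] using k by (simp add: char_kernel_iff)
      then have "center G #> g = center G #> \<one>"
        using inj_onD[OF inj] Q gs os by blast
      then show "g \<in> center G" using quotient_eq_iff[OF center_normal g one_closed] g by simp
    qed
  next
    assume a: "\<forall>g\<in>carrier G. (\<forall>h\<in>carrier G. commutator G g h \<in> char_kernel \<chi>) \<longrightarrow> g \<in> center G"
    show "inj_on (omega G \<chi>) (carrier (second_center_quotient G))"
    proof (rule inj_onI)
      fix C C' assume "C \<in> carrier (second_center_quotient G)" "C' \<in> carrier (second_center_quotient G)"
        and e: "omega G \<chi> C = omega G \<chi> C'"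
      then obtain z w where z: "z \<in> second_center G" "C = center G #> z" and w: "w \<in> second_center G" "C' = center G #> w"
        unfolding Q by blast
      define u where "u = z \<otimes> inv w"
      have wi: "inv w \<in> second_center G" by (rule subgroup.m_inv_closed[OF second_center_subgroup w(1)])
      have us: "u \<in> second_center G" unfolding u_def by (rule subgroup.m_closed[OF second_center_subgroup z(1) wi])
      have uw: "u \<otimes> w = z" unfolding u_def using sc[OF z(1)] sc[OF w(1)] by (simp add: m_assoc)
      have "commutator G u h \<in> char_kernel \<chi>" if h: "h \<in> carrier G" for h
      proof -
        have "\<chi> (commutator G u h) \<otimes>\<^bsub>rat_mod_int\<^esub> \<chi> (commutator G w h) = \<chi> (commutator G z h)"
          using commutator_mult_left[OF us w(1) h] uw dualD(2)[OF \<chi> comm[OF us h] comm[OF w(1) h]] by simp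
        also have "\<dots> = \<chi> (commutator G w h)" using e omega_eq[OF z(1) w(1)] z(2) w(2) h by simp
        finally have "\<chi> (commutator G u h) = \<one>\<^bsub>rat_mod_int\<^esub>"
          using dualD(1)[OF \<chi> comm[OF us h]] dualD(1)[OF \<chi> comm[OF w(1) h]] R.l_cancel_one' R.l_cancel_one
          by (metis R.one_closed R.r_cancel R.l_one)
        then show ?thesis using comm[OF us h] by (simp add: char_kernel_iff)
      qed
      then have "u \<in> center G" using a sc[OF us] by blast
      then show "C = C'" unfolding z(2) w(2) u_def
        using quotient_eq_iff[OF center_normal sc[OF z(1)] sc[OF w(1)]] by simp
    qed
  qed
qed

lemma rep_center_eq:
  fixes \<sigma> :: "'a \<Rightarrow> 'f::field mat"
  assumes rep: "representation G n \<sigma>" and N: "N = {g \<in> carrier G. \<sigma> g = 1\<^sub>m n}"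
  shows "rep_center G n \<sigma> = {g \<in> carrier G. \<forall>h\<in>carrier G. commutator G g h \<in> N}"
proof -
  note r = representationD[OF rep]
  have "\<sigma> g * \<sigma> h = \<sigma> h * \<sigma> g \<longleftrightarrow> commutator G g h \<in> N" if g: "g \<in> carrier G" and h: "h \<in> carrier G" for g h
  proof -
    have c: "commutator G g h \<in> carrier G" by (rule commutator_closed[OF g h])
    have e: "\<sigma> g * \<sigma> h = \<sigma> (commutator G g h) * (\<sigma> h * \<sigma> g)"
      using commutator_swap[OF g h] r(2)[OF g h] r(2)[OF h g] r(2)[OF c m_closed[OF h g]] by simp
    show ?thesis
    proof
      assume s: "\<sigma> g * \<sigma> h = \<sigma> h * \<sigma> g"
      define k where "k = inv (h \<otimes> g)"
      have kc: "k \<in> carrier G" using g h by (simp add: k_def)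
      have "\<sigma> (h \<otimes> g) * \<sigma> k = 1\<^sub>m n" using r(2)[OF m_closed[OF h g] kc] r(3) g h by (simp add: k_def)
      then have hk: "\<sigma> h * \<sigma> g * \<sigma> k = 1\<^sub>m n" using r(2)[OF h g] by simp
      have "\<sigma> (commutator G g h) = \<sigma> (commutator G g h) * (\<sigma> h * \<sigma> g * \<sigma> k)" unfolding hk using r(1)[OF c] by simp
      also have "\<dots> = \<sigma> (commutator G g h) * (\<sigma> h * \<sigma> g) * \<sigma> k"
        by (rule assoc_mult_mat[OF r(1)[OF c] mult_carrier_mat[OF r(1)[OF h] r(1)[OF g]] r(1)[OF kc], symmetric])
      also have "\<dots> = 1\<^sub>m n" unfolding e[symmetric] s by (rule hk)
      finally show "commutator G g h \<in> N" using c N by simp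
    next
      assume "commutator G g h \<in> N"
      then show "\<sigma> g * \<sigma> h = \<sigma> h * \<sigma> g"
        using e N left_mult_one_mat[OF mult_carrier_mat[OF r(1)[OF h] r(1)[OF g]]] by simp
    qed
  qed
  then show ?thesis unfolding rep_center_def center_def by (auto simp: GL_simps)
qed

text \<open>If \<open>\<sigma>(Z(G))\<close> is cyclic of order \<open>e\<close>, generated by \<open>\<sigma>(c)\<close>, then \<open>\<sigma>(z) = \<sigma>(c)\<^sup>j \<mapsto> j/e\<close> is an embedding of
  \<open>\<sigma>(Z(G))\<close> into \<open>\<rat>/\<int>\<close>; \<open>\<chi>\<close> is its composition with \<open>\<sigma>\<close>.\<close>
lemma character_of_central_kernel:
  fixes \<sigma> :: "'a \<Rightarrow> 'f::field mat"
  assumes fin: "finite (carrier G)" and irr: "irreducible_representation G n \<sigma>"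
  shows "\<exists>\<chi>\<in>carrier (pontryagin_dual (center_group G)). char_kernel \<chi> = {z \<in> center G. \<sigma> z = 1\<^sub>m n}"
proof -
  have rep: "representation G n \<sigma>" using irr by (simp add: irreducible_representation_def)
  note r = representationD[OF rep]
  interpret h: group_hom G "GL TYPE('f) n" \<sigma> by (rule r(4))
  obtain c where c: "c \<in> center G" "\<And>z. z \<in> center G \<Longrightarrow> \<exists>j::nat. \<sigma> z = \<sigma> (c [^] j)"
    using center_image_cyclic[OF fin irr] by blast
  have cc: "c \<in> carrier G" by (rule center_carrier[OF c(1)])
  note Zs = center_subgroup
  \<comment> \<open>the order of the cyclic group \<open>\<sigma>(Z(G))\<close>\<close>
  define e where "e = group.ord (GL TYPE('f) n) (\<sigma> c)"
  have pow: "\<sigma> (c [^] j) = \<sigma> c [^]\<^bsub>GL TYPE('f) n\<^esub> j" for j :: nat by (rule h.hom_nat_pow[OF cc])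
  have pow_one: "\<sigma> (c [^] j) = 1\<^sub>m n \<longleftrightarrow> e dvd j" for j :: nat
    using h.H.pow_eq_id[OF h.hom_closed[OF cc], of j] unfolding pow e_def by (simp add: GL_simps)
  have pow_eq: "\<sigma> (c [^] i) = \<sigma> (c [^] j) \<longleftrightarrow> int e dvd int j - int i" for i j :: nat
    using h.H.int_pow_eq[OF h.hom_closed[OF cc], of "int i" "int j"] unfolding pow e_def by (simp add: int_pow_int)
  have epos: "e > 0"
  proof -
    have "c [^] Coset.order G = \<one>" by (rule pow_order_eq_1[OF cc])
    then have "e dvd Coset.order G" using pow_one[of "Coset.order G"] r(3) by simp
    moreover have "Coset.order G > 0" using fin by (simp add: order_gt_0_iff_finite)
    ultimately show ?thesis using dvd_pos_nat by blast
  qed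
  \<comment> \<open>a discrete logarithm to the base \<open>\<sigma>(c)\<close>, determined only modulo \<open>e\<close>\<close>
  define j where "j z = (SOME j::nat. \<sigma> z = \<sigma> (c [^] j))" for z
  have j: "\<sigma> z = \<sigma> (c [^] j z)" if "z \<in> center G" for z
    unfolding j_def by (rule someI_ex[OF c(2)[OF that]])
  define \<chi> where "\<chi> = (\<lambda>z\<in>center G. frac_class (of_nat (j z) / of_nat e))"
  have frac: "frac_class (of_nat k / of_nat e) = frac_class (of_nat l / of_nat e) \<longleftrightarrow> int e dvd int k - int l" for k l :: nat
  proof -
    have eq: "of_nat k / of_nat e - of_nat l / of_nat e = (of_int (int k - int l) / of_int (int e) :: rat)"
      by (simp add: diff_divide_distrib)
    show ?thesis unfolding frac_class_eq_iff eq of_int_div_of_int_in_Ints_iff using epos by simp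
  qed
  have "\<chi> \<in> hom (center_group G) rat_mod_int"
  proof (rule homI)
    show "\<chi> z \<in> carrier rat_mod_int" if "z \<in> carrier (center_group G)" for z
      using that by (simp add: \<chi>_def frac_class_carrier)
    fix z w assume "z \<in> carrier (center_group G)" "w \<in> carrier (center_group G)"
    then have z: "z \<in> center G" and w: "w \<in> center G" by auto
    have zw: "z \<otimes> w \<in> center G" by (rule subgroup.m_closed[OF Zs z w])
    have "\<sigma> (c [^] j (z \<otimes> w)) = \<sigma> (c [^] (j z + j w))"
      using j[OF zw] j[OF z] j[OF w] r(2)[OF center_carrier[OF z] center_carrier[OF w]]
        r(2)[of "c [^] j z" "c [^] j w"] nat_pow_mult[OF cc, of "j z" "j w"] cc by simp
    then have "frac_class (of_nat (j (z \<otimes> w)) / of_nat e) = frac_class (of_nat (j z + j w) / of_nat e)"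
      unfolding pow_eq frac using dvd_diff_commute by blast
    then show "\<chi> (z \<otimes>\<^bsub>center_group G\<^esub> w) = \<chi> z \<otimes>\<^bsub>rat_mod_int\<^esub> \<chi> w"
      using z w zw by (simp add: \<chi>_def frac_class_mult add_divide_distrib)
  qed
  then have dual: "\<chi> \<in> carrier (pontryagin_dual (center_group G))"
    by (simp add: pontryagin_dual_def \<chi>_def)
  have "\<chi> z = \<one>\<^bsub>rat_mod_int\<^esub> \<longleftrightarrow> \<sigma> z = 1\<^sub>m n" if z: "z \<in> center G" for z
  proof -
    have "\<chi> z = \<one>\<^bsub>rat_mod_int\<^esub> \<longleftrightarrow> int e dvd int (j z) - int 0"
      using z frac[of "j z" 0] by (simp add: \<chi>_def frac_class_one)
    also have "\<dots> \<longleftrightarrow> e dvd j z" by simp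
    also have "\<dots> \<longleftrightarrow> \<sigma> z = 1\<^sub>m n" using pow_one[of "j z"] j[OF z] by simp
    finally show ?thesis .
  qed
  then have "char_kernel \<chi> = {z \<in> center G. \<sigma> z = 1\<^sub>m n}" by (auto simp: char_kernel_iff)
  then show ?thesis using dual by blast
qed

text \<open>The kernel of \<open>\<sigma>\<close> is contained in \<open>Z(\<sigma>)\<close>. So if \<open>Z(\<sigma>) = Z(G)\<close>, it is central and equal to \<open>ker \<chi>\<close>
  for some character \<open>\<chi>\<close>.\<close>
theorem center_faithful_iff:
  assumes fin: "finite (carrier G)" and char: "\<not> CHAR('f::field) dvd Coset.order G"
  shows "(\<exists>n (\<sigma> :: 'a \<Rightarrow> 'f mat). irreducible_representation G n \<sigma> \<and> rep_center G n \<sigma> = center G) \<longleftrightarrow>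
    (\<exists>\<chi>\<in>carrier (pontryagin_dual (center_group G)).
       inj_on (omega G \<chi>) (carrier (second_center_quotient G)) \<and>
       generated_by_single_class (SocA (G Mod char_kernel \<chi>)) (G Mod char_kernel \<chi>))"
proof
  assume "\<exists>n (\<sigma> :: 'a \<Rightarrow> 'f mat). irreducible_representation G n \<sigma> \<and> rep_center G n \<sigma> = center G"
  then obtain n and \<sigma> :: "'a \<Rightarrow> 'f mat" where s: "irreducible_representation G n \<sigma>" "rep_center G n \<sigma> = center G"
    by blast
  have rep: "representation G n \<sigma>" using s(1) by (simp add: irreducible_representation_def)
  note r = representationD[OF rep]
  obtain \<chi> where \<chi>: "\<chi> \<in> carrier (pontryagin_dual (center_group G))" "char_kernel \<chi> = {z \<in> center G. \<sigma> z = 1\<^sub>m n}"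
    using character_of_central_kernel[OF fin s(1)] by blast
  have sub: "g \<in> rep_center G n \<sigma>" if g: "g \<in> carrier G" "\<sigma> g = 1\<^sub>m n" for g
  proof -
    have "1\<^sub>m n \<in> \<sigma> ` carrier G" using g by (metis imageI)
    then show ?thesis
      using g left_mult_one_mat[OF r(1)] right_mult_one_mat[OF r(1)]
      unfolding rep_center_def center_def by (auto simp: GL_simps)
  qed
  have N: "char_kernel \<chi> = {g \<in> carrier G. \<sigma> g = 1\<^sub>m n}"
    using \<chi>(2) sub s(2) center_carrier by auto
  have "inj_on (omega G \<chi>) (carrier (second_center_quotient G))"
    unfolding omega_inj_iff[OF \<chi>(1)] using rep_center_eq[OF rep N] s(2) by blast
  moreover have "generated_by_single_class (SocA (G Mod char_kernel \<chi>)) (G Mod char_kernel \<chi>)"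
    using irreducible_with_kernel_iff[OF fin char char_kernel_normal[OF \<chi>(1)]] s(1) N by blast
  ultimately show "\<exists>\<chi>\<in>carrier (pontryagin_dual (center_group G)).
       inj_on (omega G \<chi>) (carrier (second_center_quotient G)) \<and>
       generated_by_single_class (SocA (G Mod char_kernel \<chi>)) (G Mod char_kernel \<chi>)" using \<chi>(1) by blast
next
  assume "\<exists>\<chi>\<in>carrier (pontryagin_dual (center_group G)).
       inj_on (omega G \<chi>) (carrier (second_center_quotient G)) \<and>
       generated_by_single_class (SocA (G Mod char_kernel \<chi>)) (G Mod char_kernel \<chi>)"
  then obtain \<chi> where \<chi>: "\<chi> \<in> carrier (pontryagin_dual (center_group G))"
    and inj: "inj_on (omega G \<chi>) (carrier (second_center_quotient G))"
    and gen: "generated_by_single_class (SocA (G Mod char_kernel \<chi>)) (G Mod char_kernel \<chi>)" by blast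
  obtain n and \<sigma> :: "'a \<Rightarrow> 'f mat" where s: "irreducible_representation G n \<sigma>"
    "{g \<in> carrier G. \<sigma> g = 1\<^sub>m n} = char_kernel \<chi>"
    using irreducible_with_kernel_iff[OF fin char char_kernel_normal[OF \<chi>]] gen by blast
  have rep: "representation G n \<sigma>" using s(1) by (simp add: irreducible_representation_def)
  have "rep_center G n \<sigma> = {g \<in> carrier G. \<forall>h\<in>carrier G. commutator G g h \<in> char_kernel \<chi>}"
    by (rule rep_center_eq[OF rep s(2)[symmetric]])
  also have "\<dots> = center G"
  proof
    show "{g \<in> carrier G. \<forall>h\<in>carrier G. commutator G g h \<in> char_kernel \<chi>} \<subseteq> center G"
      using inj unfolding omega_inj_iff[OF \<chi>] by blast
    show "center G \<subseteq> {g \<in> carrier G. \<forall>h\<in>carrier G. commutator G g h \<in> char_kernel \<chi>}"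
      using center_carrier commutator_center normalD(2)[OF char_kernel_normal[OF \<chi>]] by auto
  qed
  finally show "\<exists>n (\<sigma> :: 'a \<Rightarrow> 'f mat). irreducible_representation G n \<sigma> \<and> rep_center G n \<sigma> = center G"
    using s(1) by blast
qed

section \<open>Nilpotent groups\<close>

lemma upper_central_normal: "upper_central G i \<lhd> G"
proof (induction i)
  case 0
  then show ?case by (simp add: one_is_normal)
next
  case (Suc i)
  interpret Q: group "G Mod upper_central G i" by (rule normal.factorgroup_is_group[OF Suc])
  show ?case using preimage_normal[OF Suc Q.center_normal] by (simp add: center_modulo_def)
qed

text \<open>Let \<open>P\<close> be the preimage of \<open>M\<close> and \<open>i\<close> the first index for which the \<open>i\<close>-th term of the upper central
  series contains some \<open>x \<in> P - K\<close>. The commutators of \<open>x\<close> lie in \<open>P\<close> and in the previous term, hence in \<open>K\<close>,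
  so \<open>x\<close> is central modulo \<open>K\<close> and \<open>M\<close>, meeting the center of \<open>G/K\<close> nontrivially, lies
  inside it.\<close>
lemma nilpotent_minimal_normal_central:
  assumes nil: "nilpotent_group G" and K: "K \<lhd> G" and M: "minimal_normal M (G Mod K)"
  shows "M \<subseteq> center (G Mod K)"
proof -
  interpret Q: group "G Mod K" by (rule normal.factorgroup_is_group[OF K])
  have Mn: "M \<lhd> G Mod K" and M1: "M \<noteq> {\<one>\<^bsub>G Mod K\<^esub>}" using M by (auto simp: minimal_normal_def)
  define P where "P = {g \<in> carrier G. K #> g \<in> M}"
  have P: "P \<lhd> G" unfolding P_def by (rule preimage_normal[OF K Mn])
  obtain A where A: "A \<in> M" "A \<noteq> \<one>\<^bsub>G Mod K\<^esub>" using M1 Q.normalD(2)[OF Mn] by blast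
  obtain g where g: "g \<in> carrier G" "A = K #> g" using Q.normalD(3)[OF Mn A(1)] by (auto simp: quotient_carrier)
  have gP: "g \<in> P" "g \<notin> K" using A g quotient_eq_one_iff[OF K g(1)] by (auto simp: P_def quotient_one)
  obtain c where "upper_central G c = carrier G" using nil by (auto simp: nilpotent_group_def)
  then have ex: "\<exists>i. \<not> P \<inter> upper_central G i \<subseteq> K" using gP g(1) by blast
  define i where "i = (LEAST i. \<not> P \<inter> upper_central G i \<subseteq> K)"
  have i: "\<not> P \<inter> upper_central G i \<subseteq> K" unfolding i_def by (rule LeastI_ex[OF ex])
  have "i \<noteq> 0" using i normalD(2)[OF K] by (cases i) auto
  then obtain l where l: "i = Suc l" using not0_implies_Suc by blast
  have less: "P \<inter> upper_central G l \<subseteq> K" using not_less_Least[of l "\<lambda>i. \<not> P \<inter> upper_central G i \<subseteq> K"] l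
    unfolding i_def[symmetric] by simp
  obtain x where x: "x \<in> P" "x \<in> upper_central G i" "x \<notin> K" using i by blast
  have xc: "x \<in> carrier G" using x(1) by (simp add: P_def)
  have "commutator G x h \<in> K" if h: "h \<in> carrier G" for h
  proof -
    have "commutator G x h \<in> upper_central G l"
      using x(2) h unfolding l by (simp add: center_modulo_iff[OF upper_central_normal])
    moreover have "x \<otimes> (h \<otimes> inv x \<otimes> inv h) \<in> P"
      by (rule normalD(4)[OF P x(1) normalD(6)[OF P h normalD(5)[OF P x(1)]]])
    then have "commutator G x h \<in> P" using xc h by (simp add: commutator_def m_assoc)
    ultimately show ?thesis using less by blast
  qed
  then have xZ: "K #> x \<in> center (G Mod K)" using quotient_center_iff[OF K xc] by blast
  have xM: "K #> x \<in> M" using x(1) by (simp add: P_def)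
  show ?thesis
  proof (rule ccontr)
    assume "\<not> M \<subseteq> center (G Mod K)"
    then have "M \<inter> center (G Mod K) = {\<one>\<^bsub>G Mod K\<^esub>}" by (rule Q.minimal_normal_Int[OF M Q.center_normal])
    then have "K #> x = K" using xZ xM by (auto simp: quotient_one)
    then show False using x(3) quotient_eq_one_iff[OF K xc] by simp
  qed
qed

text \<open>The socle is central, and a central element of \<open>G/ker \<chi>\<close> comes from \<open>Z(G)\<close> by injectivity of \<open>\<omega>\<^sub>\<chi>\<close>. So \<open>\<chi>\<close>
  embeds the socle into \<open>\<rat>/\<int>\<close>, and the socle is generated by one element, which is its own conjugacy class.\<close>
lemma nilpotent_single_class:
  assumes fin: "finite (carrier G)" and nil: "nilpotent_group G"
    and \<chi>: "\<chi> \<in> carrier (pontryagin_dual (center_group G))"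
    and inj: "inj_on (omega G \<chi>) (carrier (second_center_quotient G))"
  shows "generated_by_single_class (SocA (G Mod char_kernel \<chi>)) (G Mod char_kernel \<chi>)"
proof -
  let ?K = "char_kernel \<chi>"
  let ?L = "G Mod ?K"
  let ?S = "SocA ?L"
  have K: "?K \<lhd> G" by (rule char_kernel_normal[OF \<chi>])
  interpret L: group ?L by (rule normal.factorgroup_is_group[OF K])
  have finL: "finite (carrier ?L)" using fin by (simp add: quotient_carrier)
  have Sn: "?S \<lhd> ?L" by (rule L.direct_abelian_normal[OF L.SocA_direct_abelian[OF finL]])
  have SZ: "?S \<subseteq> center ?L"
    unfolding SocA_def
    by (rule L.generate_subgroup_incl[OF _ L.center_subgroup]) (use nilpotent_minimal_normal_central[OF nil K] in blast)
  have lift: "\<exists>z\<in>center G. A = ?K #> z" if A: "A \<in> ?S" for A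
  proof -
    obtain g where g: "g \<in> carrier G" "A = ?K #> g" using L.normalD(3)[OF Sn A] by (auto simp: quotient_carrier)
    have "A \<in> center ?L" using A SZ by blast
    then have "\<forall>h\<in>carrier G. commutator G g h \<in> ?K" using g quotient_center_iff[OF K g(1)] by simp
    then have "g \<in> center G" using inj g(1) unfolding omega_inj_iff[OF \<chi>] by blast
    then show ?thesis using g(2) by blast
  qed
  define z where "z A = (SOME z. z \<in> center G \<and> A = ?K #> z)" for A
  have z: "z A \<in> center G" "A = ?K #> z A" if "A \<in> ?S" for A
    using someI_ex[of "\<lambda>z. z \<in> center G \<and> A = ?K #> z"] lift[OF that] unfolding z_def by blast+
  have zc: "z A \<in> carrier G" if "A \<in> ?S" for A using center_carrier[OF z(1)[OF that]] .
  interpret R: group rat_mod_int by (rule rat_mod_int_group)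
  interpret h: group_hom "center_group G" rat_mod_int \<chi> by (rule dualD(3)[OF \<chi>])
  let ?C = "?L\<lparr>carrier := ?S\<rparr>"
  have gC: "group ?C" by (rule L.subgroup_imp_group[OF normal_imp_subgroup[OF Sn]])
  have comm: "comm_group ?C"
    by (rule group.group_comm_groupI[OF gC]) (use L.center_comm L.normalD(3)[OF Sn] SZ in auto)
  have finC: "finite (carrier ?C)" using finL L.normalD(1)[OF Sn] finite_subset by auto
  have inj': "inj_on (\<lambda>A. \<chi> (z A)) ?S"
  proof (rule inj_onI)
    fix A B assume A: "A \<in> ?S" and B: "B \<in> ?S" and e: "\<chi> (z A) = \<chi> (z B)"
    note Zs = center_subgroup
    have Bi: "inv (z B) \<in> center G" by (rule subgroup.m_inv_closed[OF Zs z(1)[OF B]])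
    have "\<chi> (z A \<otimes> inv (z B)) = \<chi> (z B) \<otimes>\<^bsub>rat_mod_int\<^esub> \<chi> (inv (z B))"
      using dualD(2)[OF \<chi> z(1)[OF A] Bi] e by simp
    also have "\<dots> = \<chi> (z B \<otimes> inv (z B))" using dualD(2)[OF \<chi> z(1)[OF B] Bi] by simp
    also have "\<dots> = \<one>\<^bsub>rat_mod_int\<^esub>" using h.hom_one zc[OF B] by simp
    finally have "z A \<otimes> inv (z B) \<in> ?K"
      using subgroup.m_closed[OF Zs z(1)[OF A] Bi] by (simp add: char_kernel_iff)
    then show "A = B" using quotient_eq_iff[OF K zc[OF A] zc[OF B]] z(2)[OF A] z(2)[OF B] by simp
  qed
  have powL: "(?K #> g) [^]\<^bsub>?L\<^esub> d = ?K #> (g [^] d)" if g: "g \<in> carrier G" for g and d :: nat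
  proof (induction d)
    case 0
    then show ?case using quotient_eq_one_iff[OF K one_closed] normalD(2)[OF K] by (simp add: quotient_one)
  next
    case (Suc d)
    then show ?case using quotient_mult[OF K, of "g [^] d" g] g by simp
  qed
  have powC: "A [^]\<^bsub>?C\<^esub> d = A [^]\<^bsub>?L\<^esub> d" for A and d :: nat by (simp add: nat_pow_def)
  have powZ: "w [^]\<^bsub>center_group G\<^esub> d = w [^] d" for w and d :: nat by (simp add: nat_pow_def)
  have bound: "card {A \<in> carrier ?C. A [^]\<^bsub>?C\<^esub> d = \<one>\<^bsub>?C\<^esub>} \<le> d" if d: "d > 0" for d :: nat
  proof -
    let ?T = "{A \<in> carrier ?C. A [^]\<^bsub>?C\<^esub> d = \<one>\<^bsub>?C\<^esub>}"
    have "(\<lambda>A. \<chi> (z A)) ` ?T \<subseteq> {x \<in> carrier rat_mod_int. x [^]\<^bsub>rat_mod_int\<^esub> d = \<one>\<^bsub>rat_mod_int\<^esub>}"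
    proof
      fix x assume "x \<in> (\<lambda>A. \<chi> (z A)) ` ?T"
      then obtain A where A: "A \<in> ?S" "A [^]\<^bsub>?L\<^esub> d = ?K" "x = \<chi> (z A)" by (auto simp: powC quotient_one)
      have "?K #> (z A [^] d) = ?K" using A(2) powL[OF zc[OF A(1)]] z(2)[OF A(1)] by metis
      then have "z A [^] d \<in> ?K" using quotient_eq_one_iff[OF K] zc[OF A(1)] by simp
      then have "\<chi> (z A [^] d) = \<one>\<^bsub>rat_mod_int\<^esub>" by (simp add: char_kernel_iff)
      moreover have "\<chi> (z A [^] d) = \<chi> (z A) [^]\<^bsub>rat_mod_int\<^esub> d"
        using h.hom_nat_pow[of "z A" d] z(1)[OF A(1)] by (simp add: powZ)
      ultimately show "x \<in> {x \<in> carrier rat_mod_int. x [^]\<^bsub>rat_mod_int\<^esub> d = \<one>\<^bsub>rat_mod_int\<^esub>}"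
        using A(3) dualD(1)[OF \<chi> z(1)[OF A(1)]] by simp
    qed
    then have sub: "(\<lambda>A. \<chi> (z A)) ` ?T \<subseteq> (\<lambda>j. frac_class (of_nat j / of_nat d)) ` {..<d}"
      using rat_mod_int_torsion[OF d] by blast
    have "inj_on (\<lambda>A. \<chi> (z A)) ?T" by (rule inj_on_subset[OF inj']) auto
    then have "card ?T \<le> card ((\<lambda>j. frac_class (of_nat j / of_nat d)) ` {..<d})"
      using card_inj_on_le[OF _ sub] by simp
    also have "\<dots> \<le> d" using card_image_le[of "{..<d}"] by simp
    finally show ?thesis .
  qed
  obtain c where c: "c \<in> ?S" "\<And>A. A \<in> ?S \<Longrightarrow> \<exists>j::nat. A = c [^]\<^bsub>?L\<^esub> j"
    using comm_group.cyclic_of_torsion_bound[OF comm finC bound] by (auto simp: powC)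
  have cL: "c \<in> carrier ?L" by (rule L.normalD(3)[OF Sn c(1)])
  have conj: "g \<otimes>\<^bsub>?L\<^esub> c \<otimes>\<^bsub>?L\<^esub> inv\<^bsub>?L\<^esub> g = c" if g: "g \<in> carrier ?L" for g
  proof -
    have "c \<in> center ?L" using c(1) SZ by blast
    then have "g \<otimes>\<^bsub>?L\<^esub> c \<otimes>\<^bsub>?L\<^esub> inv\<^bsub>?L\<^esub> g = c \<otimes>\<^bsub>?L\<^esub> g \<otimes>\<^bsub>?L\<^esub> inv\<^bsub>?L\<^esub> g"
      using L.center_comm[of c g] g by (simp only:)
    also have "\<dots> = c \<otimes>\<^bsub>?L\<^esub> (g \<otimes>\<^bsub>?L\<^esub> inv\<^bsub>?L\<^esub> g)" by (rule L.m_assoc[OF cL g L.inv_closed[OF g]])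
    also have "\<dots> = c" unfolding L.r_inv[OF g] by (rule L.r_one[OF cL])
    finally show ?thesis .
  qed
  have "conjugacy_class ?L c = {c}"
    unfolding conjugacy_class_def using conj L.one_closed by (auto intro!: image_eqI[of c _ "\<one>\<^bsub>?L\<^esub>"] simp del: mult_FactGroup one_FactGroup)
  moreover have "?S = generate ?L {c}"
  proof
    have G: "subgroup (generate ?L {c}) ?L" by (rule L.generate_is_subgroup) (use cL in simp)
    have "c [^]\<^bsub>?L\<^esub> j \<in> generate ?L {c}" for j :: nat
    proof (induction j)
      case 0
      then show ?case using subgroup.one_closed[OF G] by simp
    next
      case (Suc j)
      then show ?case using subgroup.m_closed[OF G Suc] generate.incl[of c "{c}" ?L] by simp
    qed
    then show "?S \<subseteq> generate ?L {c}" using c(2) by blast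
    show "generate ?L {c} \<subseteq> ?S" using c(1) by (intro L.generate_subgroup_incl normal_imp_subgroup[OF Sn]) simp
  qed
  ultimately show ?thesis unfolding generated_by_single_class_def using cL by metis
qed

end

theorem corollary4p7:
  fixes G :: "('a, 'b) monoid_scheme"
  assumes "group G"
    and "finite (carrier G)"
    and "\<not> CHAR('f :: field) dvd Coset.order G"
  shows "((\<exists>n (\<sigma> :: 'a \<Rightarrow> 'f mat).
             irreducible_representation G n \<sigma> \<and> rep_center G n \<sigma> = center G)
          \<longleftrightarrow>
          (\<exists>\<chi> \<in> carrier (pontryagin_dual (center_group G)).
             inj_on (omega G \<chi>) (carrier (second_center_quotient G)) \<and>
             (let L = G Mod kernel (center_group G) rat_mod_int \<chi>
              in generated_by_single_class (SocA L) L)))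
       \<and>
         (nilpotent_group G \<longrightarrow>
           ((\<exists>n (\<sigma> :: 'a \<Rightarrow> 'f mat).
               irreducible_representation G n \<sigma> \<and> rep_center G n \<sigma> = center G)
            \<longleftrightarrow>
            (\<exists>\<chi> \<in> carrier (pontryagin_dual (center_group G)).
               inj_on (omega G \<chi>) (carrier (second_center_quotient G)))))"
proof -
  interpret group G by (rule assms(1))
  note iff = center_faithful_iff[OF assms(2,3)]
  show ?thesis
    unfolding Let_def char_kernel_def[symmetric] iff
    using nilpotent_single_class[OF assms(2)] by blast
qed

end
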